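(* Let $G$ be a finite group. The following are equivalent. (i) The $\mathcal{O}$-algebra $\mathcal{O}G/\mathcal{O}\left(\sum_{x\in G}x\right)$ is symmetric. (ii) The group $G$ is $p$-nilpotent and has cyclic Sylow $p$-subgroups.
   Context: Let $p$ be a prime and $\mathcal{O}$ a complete discrete valuation ring with residue field $k$ of characteristic $p$ and quotient field $K$ of characteristic zero (here $K$ and $k$ are not required to be splitting fields for $G$). An $\mathcal{O}$-algebra $A$ is symmetric if $A$ is finitely generated projective as an $\mathcal{O}$-module and $A\cong\mathrm{Hom}_{\mathcal{O}}(A,\mathcal{O})$ as $A$-$A$-bimodules. *)

theory Defs
  imports "HOL-Algebra.Algebra"
begin

section \<open>Complete discrete valuation rings\<close>

text \<open>A discrete valuation ring is a principal ideal domain with exactly one maximal ideal that is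
  not a field. Its residue field is \<open>R Quot \<mm>\<close>.\<close>

locale discrete_valuation_ring = principal_domain R + maximalideal \<mm> R
  for R :: "('a, 'b) ring_scheme" (structure) and \<mm> :: "'a set" +
  assumes unique_maximalideal: "maximalideal J R \<Longrightarrow> J = \<mm>"
    and maximalideal_nonzero: "\<mm> \<noteq> {\<zero>}"

text \<open>Completeness is convergence of Cauchy sequences in the \<open>\<mm>\<close>-adic topology. Powers of \<open>\<mm>\<close> are
  taken in the monoid of ideals, whose unit is \<open>carrier R\<close>.\<close>

locale complete_discrete_valuation_ring = discrete_valuation_ring +
  assumes Cauchy_converges:
    "\<lbrakk> \<And>i::nat. x i \<in> carrier R;
       \<And>n::nat. \<exists>N. \<forall>i\<ge>N. \<forall>j\<ge>N. x i \<ominus> x j \<in> \<mm> [^]\<^bsub>ideals_set R\<^esub> n \<rbrakk> \<Longrightarrow>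
     \<exists>l\<in>carrier R. \<forall>n::nat. \<exists>N. \<forall>i\<ge>N. x i \<ominus> l \<in> \<mm> [^]\<^bsub>ideals_set R\<^esub> n"

text \<open>The library's order of an element is \<open>0\<close> when no positive multiple of it vanishes.\<close>

definition characteristic :: "('a, 'b) ring_scheme \<Rightarrow> nat"
  where "characteristic R = group.ord (add_monoid R) \<one>\<^bsub>R\<^esub>"

definition is_quotient_field ::
    "('a, 'b) ring_scheme \<Rightarrow> ('c, 'd) ring_scheme \<Rightarrow> ('a \<Rightarrow> 'c) \<Rightarrow> bool"
  where "is_quotient_field R K \<iota> \<longleftrightarrow>
    field K \<and> \<iota> \<in> ring_hom R K \<and> inj_on \<iota> (carrier R) \<and>
    (\<forall>x\<in>carrier K. \<exists>a\<in>carrier R. \<exists>b\<in>carrier R - {\<zero>\<^bsub>R\<^esub>}. x = \<iota> a \<otimes>\<^bsub>K\<^esub> inv\<^bsub>K\<^esub> (\<iota> b))"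


section \<open>Modules\<close>

text \<open>The record of modules extends that of rings. Modules that carry no multiplication leave the
  fields \<^const>\<open>monoid.mult\<close> and \<^const>\<open>one\<close> undefined; none of the notions below looks at them.\<close>

definition module_hom ::
    "('a, 'r) ring_scheme \<Rightarrow> ('a, 'm, 's) module_scheme \<Rightarrow> ('a, 'n, 't) module_scheme \<Rightarrow> ('m \<Rightarrow> 'n) set"
  where "module_hom R M N = {f \<in> carrier M \<rightarrow> carrier N.
    (\<forall>x\<in>carrier M. \<forall>y\<in>carrier M. f (x \<oplus>\<^bsub>M\<^esub> y) = f x \<oplus>\<^bsub>N\<^esub> f y) \<and>
    (\<forall>r\<in>carrier R. \<forall>x\<in>carrier M. f (r \<odot>\<^bsub>M\<^esub> x) = r \<odot>\<^bsub>N\<^esub> f x)}"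

definition module_iso ::
    "('a, 'r) ring_scheme \<Rightarrow> ('a, 'm, 's) module_scheme \<Rightarrow> ('a, 'n, 't) module_scheme \<Rightarrow> ('m \<Rightarrow> 'n) set"
  where "module_iso R M N = {f \<in> module_hom R M N. bij_betw f (carrier M) (carrier N)}"

definition finitely_generated_module :: "('a, 'r) ring_scheme \<Rightarrow> ('a, 'm, 's) module_scheme \<Rightarrow> bool"
  where "finitely_generated_module R M \<longleftrightarrow>
    (\<exists>S\<subseteq>carrier M. finite S \<and>
      (\<forall>x\<in>carrier M. \<exists>c\<in>S \<rightarrow> carrier R. x = (\<Oplus>\<^bsub>M\<^esub>s\<in>S. c s \<odot>\<^bsub>M\<^esub> s)))"

definition free_module :: "('a, 'r) ring_scheme \<Rightarrow> 'i set \<Rightarrow> ('a, 'i \<Rightarrow> 'a) module"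
  where "free_module R I =
    \<lparr>carrier = {f \<in> I \<rightarrow>\<^sub>E carrier R. finite {i \<in> I. f i \<noteq> \<zero>\<^bsub>R\<^esub>}},
     monoid.mult = undefined, one = undefined,
     ring.zero = (\<lambda>i\<in>I. \<zero>\<^bsub>R\<^esub>), add = (\<lambda>f g. \<lambda>i\<in>I. f i \<oplus>\<^bsub>R\<^esub> g i),
     smult = (\<lambda>r f. \<lambda>i\<in>I. r \<otimes>\<^bsub>R\<^esub> f i)\<rparr>"

text \<open>A module is projective if it is isomorphic to a direct summand of a free module. Basis elements
  may be taken in the type of \<open>M\<close>, since \<open>M\<close> is a quotient of the free module on \<open>carrier M\<close>.\<close>

definition projective_module :: "('a, 'r) ring_scheme \<Rightarrow> ('a, 'm, 's) module_scheme \<Rightarrow> bool"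
  where "projective_module R M \<longleftrightarrow>
    (\<exists>(I :: 'm set) P Q. let F = free_module R I in
      submodule P R F \<and> submodule Q R F \<and> P \<inter> Q = {\<zero>\<^bsub>F\<^esub>} \<and> P <+>\<^bsub>F\<^esub> Q = carrier F \<and>
      module_iso R M (F\<lparr>carrier := P\<rparr>) \<noteq> {})"


section \<open>Symmetric algebras\<close>

text \<open>The library's \<^locale>\<open>algebra\<close> is commutative.\<close>

locale assoc_algebra = module R A + ring A
  for R :: "('a, 'r) ring_scheme" (structure) and A :: "('a, 'm, 's) module_scheme" (structure) +
  assumes smult_mult_left:
      "\<lbrakk> r \<in> carrier R; x \<in> carrier A; y \<in> carrier A \<rbrakk> \<Longrightarrow>
       (r \<odot>\<^bsub>A\<^esub> x) \<otimes>\<^bsub>A\<^esub> y = r \<odot>\<^bsub>A\<^esub> (x \<otimes>\<^bsub>A\<^esub> y)"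
    and smult_mult_right:
      "\<lbrakk> r \<in> carrier R; x \<in> carrier A; y \<in> carrier A \<rbrakk> \<Longrightarrow>
       x \<otimes>\<^bsub>A\<^esub> (r \<odot>\<^bsub>A\<^esub> y) = r \<odot>\<^bsub>A\<^esub> (x \<otimes>\<^bsub>A\<^esub> y)"

record ('r, 'a, 'm) bimodule = "('r, 'm) module" +
  lact :: "'a \<Rightarrow> 'm \<Rightarrow> 'm"
  ract :: "'m \<Rightarrow> 'a \<Rightarrow> 'm"

definition bimodule_iso ::
    "('r, 'p) ring_scheme \<Rightarrow> ('r, 'a, 'q) module_scheme \<Rightarrow>
     ('r, 'a, 'm, 's) bimodule_scheme \<Rightarrow> ('r, 'a, 'n, 't) bimodule_scheme \<Rightarrow> ('m \<Rightarrow> 'n) set"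
  where "bimodule_iso R A M N = {f \<in> module_iso R M N. \<forall>a\<in>carrier A. \<forall>x\<in>carrier M.
    f (lact M a x) = lact N a (f x) \<and> f (ract M x a) = ract N (f x) a}"

definition regular_bimodule :: "('r, 'a, 's) module_scheme \<Rightarrow> ('r, 'a, 'a) bimodule"
  where "regular_bimodule A =
    \<lparr>carrier = carrier A, monoid.mult = undefined, one = undefined, ring.zero = \<zero>\<^bsub>A\<^esub>, add = add A,
     smult = smult A, lact = monoid.mult A, ract = monoid.mult A\<rparr>"

definition ring_as_module :: "('r, 'p) ring_scheme \<Rightarrow> ('r, 'r) module"
  where "ring_as_module R =
    \<lparr>carrier = carrier R, monoid.mult = monoid.mult R, one = \<one>\<^bsub>R\<^esub>, ring.zero = \<zero>\<^bsub>R\<^esub>,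
     add = add R, smult = monoid.mult R\<rparr>"

text \<open>\<open>Hom\<^sub>R(A, R)\<close> with the actions \<open>(a \<cdot> f \<cdot> b)(x) = f (b x a)\<close>. Homomorphisms are taken
  extensional, so that equality of functions is equality on \<open>carrier A\<close>.\<close>

definition dual_bimodule ::
    "('r, 'p) ring_scheme \<Rightarrow> ('r, 'a, 's) module_scheme \<Rightarrow> ('r, 'a, 'a \<Rightarrow> 'r) bimodule"
  where "dual_bimodule R A =
    \<lparr>carrier = module_hom R A (ring_as_module R) \<inter> extensional (carrier A),
     monoid.mult = undefined, one = undefined,
     ring.zero = (\<lambda>x\<in>carrier A. \<zero>\<^bsub>R\<^esub>),
     add = (\<lambda>f g. \<lambda>x\<in>carrier A. f x \<oplus>\<^bsub>R\<^esub> g x),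
     smult = (\<lambda>r f. \<lambda>x\<in>carrier A. r \<otimes>\<^bsub>R\<^esub> f x),
     lact = (\<lambda>a f. \<lambda>x\<in>carrier A. f (x \<otimes>\<^bsub>A\<^esub> a)),
     ract = (\<lambda>f a. \<lambda>x\<in>carrier A. f (a \<otimes>\<^bsub>A\<^esub> x))\<rparr>"

definition symmetric_algebra :: "('r, 'p) ring_scheme \<Rightarrow> ('r, 'a, 's) module_scheme \<Rightarrow> bool"
  where "symmetric_algebra R A \<longleftrightarrow>
    assoc_algebra R A \<and> finitely_generated_module R A \<and> projective_module R A \<and>
    bimodule_iso R A (regular_bimodule A) (dual_bimodule R A) \<noteq> {}"


section \<open>Group algebras and quotient algebras\<close>

text \<open>The group algebra of a finite group: \<open>f\<close> stands for \<open>\<Sum>x\<in>G. f(x) x\<close>, and multiplication is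
  convolution.\<close>

definition group_algebra :: "('r, 'p) ring_scheme \<Rightarrow> ('g, 'q) monoid_scheme \<Rightarrow> ('r, 'g \<Rightarrow> 'r) module"
  where "group_algebra R G =
    \<lparr>carrier = carrier G \<rightarrow>\<^sub>E carrier R,
     monoid.mult = (\<lambda>f g. \<lambda>x\<in>carrier G. \<Oplus>\<^bsub>R\<^esub>y\<in>carrier G. f y \<otimes>\<^bsub>R\<^esub> g (inv\<^bsub>G\<^esub> y \<otimes>\<^bsub>G\<^esub> x)),
     one = (\<lambda>x\<in>carrier G. if x = \<one>\<^bsub>G\<^esub> then \<one>\<^bsub>R\<^esub> else \<zero>\<^bsub>R\<^esub>),
     ring.zero = (\<lambda>x\<in>carrier G. \<zero>\<^bsub>R\<^esub>),
     add = (\<lambda>f g. \<lambda>x\<in>carrier G. f x \<oplus>\<^bsub>R\<^esub> g x),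
     smult = (\<lambda>r f. \<lambda>x\<in>carrier G. r \<otimes>\<^bsub>R\<^esub> f x)\<rparr>"

definition group_elt :: "('r, 'p) ring_scheme \<Rightarrow> ('g, 'q) monoid_scheme \<Rightarrow> 'g \<Rightarrow> 'g \<Rightarrow> 'r"
  where "group_elt R G x = (\<lambda>y\<in>carrier G. if y = x then \<one>\<^bsub>R\<^esub> else \<zero>\<^bsub>R\<^esub>)"

definition scalar_multiples :: "('r, 'p) ring_scheme \<Rightarrow> ('r, 'm, 's) module_scheme \<Rightarrow> 'm \<Rightarrow> 'm set"
  where "scalar_multiples R M x = {r \<odot>\<^bsub>M\<^esub> x | r. r \<in> carrier R}"

text \<open>The quotient ring \<open>A Quot I\<close> with the scalar multiplication \<open>r (I + x) = I + r x\<close>, written as a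
  union over representatives as in \<^const>\<open>rcoset_mult\<close>.\<close>

definition quotient_algebra :: "('r, 'a, 's) module_scheme \<Rightarrow> 'a set \<Rightarrow> ('r, 'a set) module"
  where "quotient_algebra A I =
    \<lparr>carrier = carrier (A Quot I), monoid.mult = monoid.mult (A Quot I), one = \<one>\<^bsub>A Quot I\<^esub>,
     ring.zero = \<zero>\<^bsub>A Quot I\<^esub>, add = add (A Quot I),
     smult = (\<lambda>r C. \<Union>x\<in>C. I +>\<^bsub>A\<^esub> (r \<odot>\<^bsub>A\<^esub> x))\<rparr>"


section \<open>Finite groups\<close>

text \<open>\<open>G\<close> has a normal \<open>p\<close>-complement.\<close>

definition p_nilpotent :: "nat \<Rightarrow> ('g, 'q) monoid_scheme \<Rightarrow> bool"
  where "p_nilpotent p G \<longleftrightarrow>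
    (\<exists>N. N \<lhd> G \<and> coprime p (card N) \<and> (\<exists>k. order (G Mod N) = p ^ k))"

definition sylow_subgroup :: "nat \<Rightarrow> 'g set \<Rightarrow> ('g, 'q) monoid_scheme \<Rightarrow> bool"
  where "sylow_subgroup p P G \<longleftrightarrow> subgroup P G \<and> card P = p ^ multiplicity p (order G)"

end

theory Submission
  imports Defs
begin

text \<open>
  Write \<open>A\<close> for the group algebra, \<open>z\<close> for the sum of the group elements and \<open>\<epsilon>\<close> for the augmentation
  (the sum of the coefficients). The proof turns on the augmentation ideal \<open>ker \<epsilon>\<close>.

  \<^emph>\<open>Symmetry means that \<open>ker \<epsilon>\<close> has a central generator.\<close> Every linear form on \<open>A\<close> reads
  \<open>f \<mapsto> (f u)(1)\<close> for exactly one \<open>u\<close>, and it vanishes on \<open>z\<close> iff \<open>\<epsilon> u = 0\<close>. So the dual of \<open>A/Rz\<close> is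
  \<open>ker \<epsilon>\<close> as a bimodule, because \<open>f \<mapsto> f(1)\<close> is a trace form. A bimodule isomorphism
  \<open>A/Rz \<rightarrow> ker \<epsilon>\<close> sends \<open>1\<close> to some \<open>w\<close>, which is then central with \<open>A w = ker \<epsilon>\<close>. Conversely, given
  such a \<open>w\<close>, multiplication by \<open>w\<close> maps \<open>A\<close> onto \<open>ker \<epsilon>\<close>, and its kernel is \<open>Rz\<close>: if \<open>k w = 0\<close> then
  \<open>k\<close> kills \<open>A w\<close>, so \<open>k (x - 1) = 0\<close> for all \<open>x\<close> in \<open>G\<close>, and \<open>k\<close> is constant. Finally \<open>A/Rz\<close> is always
  free, on the images of the group elements other than \<open>1\<close>. This is \<open>symmetric_iff_central_generator\<close>.

  \<^emph>\<open>From a generator to the group.\<close> A central generator \<open>w\<close> survives reduction to the residue field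
  (\<open>central_generator_map\<close>), where dimensions are available. The ideals \<open>A w\<^sup>i\<close> become stationary, so
  \<open>w\<^sup>n = b w\<^sup>2\<^sup>n\<close> for some \<open>b\<close>, and \<open>e = 1 - b w\<^sup>n\<close> is central with \<open>w\<^sup>n e = 0\<close> and \<open>\<epsilon> e = 1\<close>; it is the
  idempotent of the principal block. Let \<open>N\<close> be the subgroup of all \<open>x\<close> with \<open>x e = e\<close>. Since \<open>e\<close> is
  constant on the cosets of \<open>N\<close> and \<open>\<epsilon> e = 1\<close>, the characteristic \<open>p\<close> does not divide \<open>card N\<close>. As \<open>A\<close> is
  the sum of the scalars and \<open>A w\<close>, descending induction on \<open>j\<close> shows that \<open>A w\<^sup>j e\<close> is central, so
  \<open>A e\<close> is commutative and \<open>G/N\<close> is abelian. If \<open>x - 1\<close> lies in \<open>A w\<^sup>j\<close> then \<open>x\<^sup>p - 1\<close> lies in \<open>A w\<^sup>j\<^sup>+\<^sup>1\<close>, so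
  \<open>G/N\<close> is a \<open>p\<close>-group and \<open>N\<close> is a normal \<open>p\<close>-complement. For cyclicity, extend an additive map
  \<open>\<phi>\<close> from \<open>G\<close> to the field linearly to \<open>A\<close>. On \<open>ker \<epsilon> = A w\<close> it is \<open>a w \<mapsto> \<epsilon>(a) \<phi>(w)\<close>, hence one suitable
  \<open>g\<close> detects all such maps. If \<open>g\<close> did not generate \<open>G/N\<close>, a maximal subgroup containing \<open>N\<close> and
  \<open>g\<close> would give a nonzero map to the prime field that kills \<open>g\<close>. So \<open>G/N\<close> is cyclic, and it is isomorphic
  to each Sylow \<open>p\<close>-subgroup.

  \<^emph>\<open>From the group to a generator.\<close> Let \<open>N\<close> be a normal \<open>p\<close>-complement and let \<open>g\<close> generate \<open>G\<close> modulo
  \<open>N\<close>. The number \<open>card N\<close> is invertible in \<open>R\<close>, so the mean \<open>e\<close> of the elements of \<open>N\<close> is a central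
  idempotent, and \<open>w = (1 - e) + (g - 1) e\<close> generates \<open>ker \<epsilon>\<close> (\<open>exists_central_generator\<close>).
\<close>

section \<open>Normal complements and cyclic Sylow subgroups\<close>

lemma (in group) inv_mult_cancel_left:
  "x \<in> carrier G \<Longrightarrow> y \<in> carrier G \<Longrightarrow> inv x \<otimes> (x \<otimes> y) = y"
  by (simp add: m_assoc[symmetric])

lemma (in group) subgroup_pow_card:
  assumes "subgroup H G" "finite (carrier G)" "x \<in> H"
  shows "x [^] card H = \<one>"
proof -
  interpret H: group "G\<lparr>carrier := H\<rparr>" using subgroup_imp_group[OF assms(1)] .
  have "x [^]\<^bsub>G\<lparr>carrier := H\<rparr>\<^esub> order (G\<lparr>carrier := H\<rparr>) = \<one>"
    using H.pow_order_eq_1[of x] assms(3) by simp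
  then show ?thesis by (simp add: order_def nat_pow_consistent[symmetric])
qed

lemma (in group) pow_mem_bezout:
  assumes "subgroup H G" "x \<in> carrier G" "x [^] (a::int) \<in> H" "x [^] (b::int) \<in> H" "coprime a b"
  shows "x \<in> H"
proof -
  obtain u v where uv: "a * u + b * v = 1"
    using bezout_int[of a b] assms(5) by (metis coprime_imp_gcd_eq_1 mult.commute)
  have "(x [^] a) [^] u \<in> H" "(x [^] b) [^] v \<in> H"
    using subgroup_int_pow_closed[OF assms(1)] assms by auto
  then have "(x [^] a) [^] u \<otimes> (x [^] b) [^] v \<in> H"
    using subgroup.m_closed[OF assms(1)] by blast
  moreover have "(x [^] a) [^] u \<otimes> (x [^] b) [^] v = x"
    using assms(2) uv by (simp add: int_pow_pow int_pow_mult[symmetric])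
  ultimately show ?thesis by simp
qed

text \<open>A prime divisor \<open>q \<noteq> p\<close> of the order would give, by Sylow, a subgroup of order \<open>q\<close>, whose elements are
  killed by both \<open>q\<close> and a power of \<open>p\<close>.\<close>

lemma (in group) order_prime_power_if_exponent:
  assumes fin: "finite (carrier G)" and p: "Factorial_Ring.prime (p::nat)"
    and exp: "\<And>x. x \<in> carrier G \<Longrightarrow> x [^] (p ^ m) = \<one>"
  shows "\<exists>k. order G = p ^ k"
proof -
  have pos: "order G > 0" using fin order_gt_0_iff_finite by blast
  obtain r where r: "order G = p ^ multiplicity p (order G) * r" "\<not> p dvd r"
    using multiplicity_decompose'[of "order G" p] p pos by (metis not_prime_unit not_gr_zero)
  have "r = 1"
  proof (rule ccontr)
    assume "r \<noteq> 1"
    then obtain q where q: "Factorial_Ring.prime q" "q dvd r" using prime_factor_nat by blast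
    then obtain s where s: "order G = q ^ 1 * s"
      using r(1) by (metis dvd_mult dvdE power_one_right)
    obtain H where H: "subgroup H G" "card H = q"
      using sylow_thm[OF q(1) is_group s fin] by auto
    have "\<not> H \<subseteq> {\<one>}"
      using H(2) prime_gt_1_nat[OF q(1)] card_mono[of "{\<one>}" H] by auto
    then obtain x where x: "x \<in> H" "x \<noteq> \<one>" by blast
    then have xG: "x \<in> carrier G" using subgroup.subset[OF H(1)] by blast
    have "ord x dvd q" using subgroup_pow_card[OF H(1) fin x(1)] H(2) pow_eq_id[OF xG] by simp
    moreover have "ord x dvd p ^ m" using exp[OF xG] pow_eq_id[OF xG] by simp
    moreover have "coprime q (p ^ m)"
      using q r(2) p by (metis coprime_power_right_iff primes_coprime)
    ultimately have "ord x = 1" by (meson coprime_common_divisor_nat)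
    then show False using x(2) ord_eq_1[OF xG] by simp
  qed
  then show ?thesis using r(1) by auto
qed

text \<open>Applied to a normal \<open>p\<close>-complement \<open>N\<close> and a Sylow \<open>p\<close>-subgroup \<open>P\<close>: coprimality makes \<open>N\<close> and \<open>P\<close>
  meet trivially, and counting cosets makes the injection onto.\<close>

lemma (in group) coprime_complement_iso:
  assumes N: "N \<lhd> G" and P: "subgroup P G" and fin: "finite (carrier G)"
    and cop: "coprime (card N) (card P)" and card: "card N * card P = order G"
  shows "(\<lambda>x. N #> x) \<in> iso (G\<lparr>carrier := P\<rparr>) (G Mod N)"
proof -
  interpret N: normal N G by (rule N)
  have sub: "P \<subseteq> carrier G" using subgroup.subset[OF P] .
  have hom: "(\<lambda>x. N #> x) \<in> hom (G\<lparr>carrier := P\<rparr>) (G Mod N)"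
    using sub by (intro homI) (auto simp: FactGroup_def RCOSETS_def N.rcos_sum[OF subsetD[OF sub] subsetD[OF sub]])
  have inj: "inj_on (\<lambda>x. N #> x) P"
  proof (rule inj_onI)
    fix x y assume xy: "x \<in> P" "y \<in> P" "N #> x = N #> y"
    have [simp]: "x \<in> carrier G" "y \<in> carrier G" using xy sub by auto
    let ?z = "x \<otimes> inv y"
    have zP: "?z \<in> P" using xy P by (simp add: subgroup.m_closed subgroup.m_inv_closed)
    have "x \<in> N #> y" using xy(3) rcos_self[OF _ N.subgroup_axioms, of x] by simp
    then have zN: "?z \<in> N" by (metis N.rcos_module_imp \<open>y \<in> carrier G\<close> is_group)
    have "?z [^] card N = \<one>" "?z [^] card P = \<one>"
      using subgroup_pow_card[OF _ fin] N.subgroup_axioms P zN zP by auto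
    then have "ord ?z = 1"
      using cop by (metis coprime_common_divisor_nat pow_eq_id m_closed inv_closed \<open>x \<in> carrier G\<close> \<open>y \<in> carrier G\<close>)
    then have "?z = \<one>" using ord_eq_1[of ?z] by simp
    then show "x = y" by (metis \<open>x \<in> carrier G\<close> \<open>y \<in> carrier G\<close> inv_closed inv_equality inv_inv)
  qed
  have "card (rcosets N) * card N = order G" using lagrange[OF N.subgroup_axioms] .
  moreover have "card N > 0"
    using fin N.subset N.one_closed by (metis card_gt_0_iff empty_iff finite_subset)
  ultimately have c: "card (rcosets N) = card P" using card by (metis mult.commute mult_cancel1 not_gr0)
  have "(\<lambda>x. N #> x) ` P = rcosets N"
  proof (rule card_subset_eq)
    show "finite (rcosets N)" using fin by (simp add: RCOSETS_def)
    show "(\<lambda>x. N #> x) ` P \<subseteq> rcosets N" using sub by (auto simp: RCOSETS_def)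
    show "card ((\<lambda>x. N #> x) ` P) = card (rcosets N)" using c inj by (simp add: card_image)
  qed
  then show ?thesis using hom inj by (simp add: iso_def bij_betw_def FactGroup_def)
qed

text \<open>Take \<open>M\<close> maximal among the proper subgroups containing \<open>H\<close>. It is normal because it contains all
  commutators, and any \<open>x\<close> outside \<open>M\<close> generates \<open>G\<close> modulo \<open>M\<close>. By maximality \<open>x\<^sup>p\<close> lies in \<open>M\<close>, so \<open>G/M\<close>
  is cyclic of order \<open>p\<close>, and \<open>\<alpha>\<close> reads off the exponent of \<open>x\<close>. Values are integers, read modulo \<open>p\<close>,
  so that they can later be interpreted in any field of characteristic \<open>p\<close>.\<close>

lemma (in group) exists_hom_mod_prime:
  assumes fin: "finite (carrier G)" and p: "Factorial_Ring.prime (p::nat)"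
    and H: "subgroup H G" "H \<noteq> carrier G"
    and comm: "\<And>x y. x \<in> carrier G \<Longrightarrow> y \<in> carrier G \<Longrightarrow> x \<otimes> y \<otimes> inv x \<otimes> inv y \<in> H"
    and exp: "\<And>x. x \<in> carrier G \<Longrightarrow> x [^] (p ^ m) \<in> H"
  obtains \<alpha> :: "'a \<Rightarrow> int" and x where
    "\<And>x y. x \<in> carrier G \<Longrightarrow> y \<in> carrier G \<Longrightarrow> int p dvd \<alpha> (x \<otimes> y) - (\<alpha> x + \<alpha> y)"
    "\<And>x. x \<in> H \<Longrightarrow> int p dvd \<alpha> x"
    "x \<in> carrier G" "\<not> int p dvd \<alpha> x"
proof -
  define S where "S = {M. subgroup M G \<and> H \<subseteq> M \<and> M \<noteq> carrier G}"
  have "finite S"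
    unfolding S_def by (rule finite_subset[of _ "Pow (carrier G)"]) (auto simp: fin dest: subgroup.subset)
  moreover have "H \<in> S" using H by (simp add: S_def)
  ultimately have "\<exists>M\<in>S. \<forall>K\<in>S. M \<subseteq> K \<longrightarrow> M = K"
    by (intro finite_has_maximal) auto
  then obtain M where "M \<in> S" and maximal: "\<forall>K\<in>S. M \<subseteq> K \<longrightarrow> M = K"
    by blast
  then have M: "subgroup M G" "H \<subseteq> M" "M \<noteq> carrier G" by (auto simp: S_def)
  have Mn: "M \<lhd> G"
  proof (rule normal_invI[OF M(1)])
    fix x h assume x: "x \<in> carrier G" and h: "h \<in> M"
    then have hG: "h \<in> carrier G" using subgroup.subset[OF M(1)] by blast
    have "x \<otimes> h \<otimes> inv x \<otimes> inv h \<in> M" using comm[OF x hG] M(2) by blast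
    then have "x \<otimes> h \<otimes> inv x \<otimes> inv h \<otimes> h \<in> M" using h subgroup.m_closed[OF M(1)] by blast
    then show "x \<otimes> h \<otimes> inv x \<in> M" using x hG by (simp add: m_assoc)
  qed
  interpret M: normal M G by (rule Mn)
  have cover: "\<exists>i::int. z \<otimes> inv (y [^] i) \<in> M"
    if y: "y \<in> carrier G" "y \<notin> M" and z: "z \<in> carrier G" for y z
  proof -
    let ?K = "M <#> generate G {y}"
    have gen: "subgroup (generate G {y}) G" using generate_is_subgroup[of "{y}"] y by simp
    have K: "subgroup ?K G" using mult_norm_subgroup[OF Mn gen] .
    have "M \<subseteq> ?K"
    proof
      fix h assume "h \<in> M"
      then have "h \<otimes> \<one> \<in> ?K" using generate.one unfolding set_mult_def by blast
      then show "h \<in> ?K" using \<open>h \<in> M\<close> M.mem_carrier by simp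
    qed
    moreover have "y \<in> ?K"
    proof -
      have "\<one> \<otimes> y \<in> ?K" using generate.incl[of y "{y}" G] M.one_closed unfolding set_mult_def by blast
      then show ?thesis using y by simp
    qed
    ultimately have "?K = carrier G" using maximal K M(2) y(2) unfolding S_def by blast
    then obtain h t where ht: "h \<in> M" "t \<in> generate G {y}" "z = h \<otimes> t"
      using z unfolding set_mult_def by blast
    obtain i :: int where i: "t = y [^] i" using ht(2) generate_pow[OF y(1)] by blast
    have "z \<otimes> inv (y [^] i) = h" using ht i y(1) M.mem_carrier by (simp add: m_assoc)
    then show ?thesis using ht(1) by metis
  qed
  obtain x where x: "x \<in> carrier G" "x \<notin> M" using M by (metis subgroup.subset subsetI subset_antisym)
  \<comment> \<open>If not, \<open>x\<^sup>p\<close> would generate \<open>G\<close> modulo \<open>M\<close> as well; then a power of \<open>x\<close> prime to \<open>p\<close> is in \<open>M\<close>.\<close>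
  have xp: "x [^] (int p) \<in> M"
  proof (rule ccontr)
    assume n: "x [^] (int p) \<notin> M"
    then obtain i :: int where "x \<otimes> inv ((x [^] (int p)) [^] i) \<in> M" using cover[of "x [^] (int p)" x] x by auto
    moreover have "x \<otimes> inv ((x [^] (int p)) [^] i) = x [^] (1 - int p * i)"
      using x(1) by (simp add: int_pow_pow int_pow_diff)
    ultimately have 1: "x [^] (1 - int p * i) \<in> M" by simp
    have 2: "x [^] (int (p ^ m)) \<in> M" unfolding int_pow_int using exp[OF x(1)] M(2) by blast
    have "coprime (1 - int p * i) (int p)"
    proof (rule coprimeI)
      fix c assume "c dvd 1 - int p * i" "c dvd int p"
      then have "c dvd (1 - int p * i) + int p * i" by (intro dvd_add dvd_mult2)
      then show "is_unit c" by simp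
    qed
    then have "coprime (1 - int p * i) (int (p ^ m))" by simp
    then show False using pow_mem_bezout[OF M(1) x(1) 1 2] x(2) by blast
  qed
  have pdvd: "int p dvd i" if "x [^] i \<in> M" for i :: int
  proof (rule ccontr)
    assume "\<not> int p dvd i"
    then have "coprime (int p) i" using p by (intro prime_imp_coprime) simp_all
    then show False using pow_mem_bezout[OF M(1) x(1) xp that] x(2) by blast
  qed
  define \<alpha> where "\<alpha> z = (SOME i::int. z \<otimes> inv (x [^] i) \<in> M)" for z
  have \<alpha>: "z \<otimes> inv (x [^] \<alpha> z) \<in> M" if "z \<in> carrier G" for z
    unfolding \<alpha>_def using cover[OF x that] by (rule someI_ex)
  have \<alpha>_eq: "int p dvd \<alpha> z - i" if z: "z \<in> carrier G" and i: "z \<otimes> inv (x [^] i) \<in> M" for z i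
  proof -
    have "inv (z \<otimes> inv (x [^] \<alpha> z)) \<otimes> (z \<otimes> inv (x [^] i)) \<in> M" using \<alpha>[OF z] i by blast
    also have "inv (z \<otimes> inv (x [^] \<alpha> z)) \<otimes> (z \<otimes> inv (x [^] i)) = x [^] (\<alpha> z - i)"
      using z x(1) by (simp add: inv_mult_group m_assoc inv_mult_cancel_left int_pow_diff)
    finally show ?thesis using pdvd by simp
  qed
  show thesis
  proof
    fix y z assume y: "y \<in> carrier G" and z: "z \<in> carrier G"
    let ?a = "x [^] \<alpha> y" and ?b = "x [^] \<alpha> z"
    have [simp]: "?a \<in> carrier G" "?b \<in> carrier G" using x(1) by auto
    have "y \<otimes> inv ?a \<otimes> (?a \<otimes> (z \<otimes> inv ?b) \<otimes> inv ?a) \<in> M"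
      using \<alpha>[OF y] M.inv_op_closed2[OF _ \<alpha>[OF z], of ?a] by auto
    also have "y \<otimes> inv ?a \<otimes> (?a \<otimes> (z \<otimes> inv ?b) \<otimes> inv ?a) = y \<otimes> z \<otimes> inv (x [^] (\<alpha> y + \<alpha> z))"
      using y z x(1) by (simp add: m_assoc inv_mult_cancel_left int_pow_mult inv_mult_group)
    finally show "int p dvd \<alpha> (y \<otimes> z) - (\<alpha> y + \<alpha> z)" using \<alpha>_eq y z by blast
  next
    fix y assume "y \<in> H"
    then have "y \<in> M" using M(2) by blast
    then show "int p dvd \<alpha> y" using \<alpha>_eq[of y 0] by simp
  next
    show "x \<in> carrier G" by fact
    have "int p dvd \<alpha> x - 1" using \<alpha>_eq[of x 1] x(1) by simp
    moreover have "\<not> int p dvd 1"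
      using prime_gt_1_nat[OF p] by simp
    ultimately show "\<not> int p dvd \<alpha> x" using dvd_diff[of "int p" "\<alpha> x" "\<alpha> x - 1"] by auto
  qed
qed

text \<open>For a normal \<open>p\<close>-complement, the Sylow \<open>p\<close>-subgroups have the order of the quotient.\<close>

lemma (in group) order_normal_complement:
  assumes "N \<lhd> G" "finite (carrier G)" "Factorial_Ring.prime (p::nat)" "coprime p (card N)"
    "order (G Mod N) = p ^ k"
  shows "order G = card N * p ^ k" "multiplicity p (order G) = k"
proof -
  interpret N: normal N G by fact
  show o: "order G = card N * p ^ k"
    using lagrange[OF N.subgroup_axioms] assms(5) by (simp add: order_def FactGroup_def mult.commute)
  have "\<not> p dvd card N" using assms(3,4) by (metis coprime_absorb_left not_prime_unit)
  then show "multiplicity p (order G) = k"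
    unfolding o using assms(3) N.one_closed finite_subset[OF N.subset assms(2)]
    by (subst prime_elem_multiplicity_mult_distrib)
      (auto simp: not_dvd_imp_multiplicity_0 prime_gt_0_nat) 
qed

text \<open>The hypotheses are what the group algebra delivers: \<open>G/N\<close> is an abelian group of exponent dividing
  \<open>p\<^sup>m\<close>, and a single element \<open>g\<close> detects all homomorphisms to \<open>\<int>/p\<close>. By \<open>exists_hom_mod_prime\<close> the subgroup
  generated by \<open>N\<close> and \<open>g\<close> cannot be proper.\<close>

lemma (in group) p_nilpotent_cyclicI:
  assumes fin: "finite (carrier G)" and p: "Factorial_Ring.prime (p::nat)"
    and N: "N \<lhd> G" and cop: "coprime p (card N)"
    and comm: "\<And>x y. x \<in> carrier G \<Longrightarrow> y \<in> carrier G \<Longrightarrow> x \<otimes> y \<otimes> inv x \<otimes> inv y \<in> N"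
    and exp: "\<And>x. x \<in> carrier G \<Longrightarrow> x [^] (p ^ m) \<in> N"
    and g: "g \<in> carrier G"
    and hom: "\<And>\<alpha> :: 'a \<Rightarrow> int. (\<And>x y. x \<in> carrier G \<Longrightarrow> y \<in> carrier G \<Longrightarrow>
        int p dvd \<alpha> (x \<otimes> y) - (\<alpha> x + \<alpha> y)) \<Longrightarrow> int p dvd \<alpha> g \<Longrightarrow>
        (\<And>x. x \<in> carrier G \<Longrightarrow> int p dvd \<alpha> x)"
  shows "p_nilpotent p G \<and> (\<forall>P. sylow_subgroup p P G \<longrightarrow> cyclic_group (G\<lparr>carrier := P\<rparr>))"
proof -
  interpret N: normal N G by (rule N)
  interpret Q: group "G Mod N" by (rule N.factorgroup_is_group)
  have "\<exists>k. order (G Mod N) = p ^ k"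
  proof (rule Q.order_prime_power_if_exponent[OF _ p])
    show "finite (carrier (G Mod N))" using fin by (simp add: FactGroup_def RCOSETS_def)
    fix C assume "C \<in> carrier (G Mod N)"
    then obtain x where x: "x \<in> carrier G" "C = N #> x" by (auto simp: FactGroup_def RCOSETS_def)
    have "C [^]\<^bsub>G Mod N\<^esub> (p ^ m) = N #> (x [^] (p ^ m))"
      using x N.FactGroup_pow by simp
    also have "\<dots> = \<one>\<^bsub>G Mod N\<^esub>"
      using exp[OF x(1)] x(1) by (simp add: FactGroup_def coset_join2 N.subgroup_axioms)
    finally show "C [^]\<^bsub>G Mod N\<^esub> (p ^ m) = \<one>\<^bsub>G Mod N\<^esub>" .
  qed
  then obtain k where k: "order (G Mod N) = p ^ k" by blast
  note ord = order_normal_complement[OF N fin p cop k]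
  let ?H = "N <#> generate G {g}"
  have gen: "subgroup (generate G {g}) G" using generate_is_subgroup[of "{g}"] g by simp
  have H: "subgroup ?H G" using mult_norm_subgroup[OF N gen] .
  have NH: "N \<subseteq> ?H"
  proof
    fix h assume "h \<in> N"
    then have "h \<otimes> \<one> \<in> ?H" using generate.one unfolding set_mult_def by blast
    then show "h \<in> ?H" using \<open>h \<in> N\<close> N.mem_carrier by simp
  qed
  have gH: "g \<in> ?H"
  proof -
    have "\<one> \<otimes> g \<in> ?H" using generate.incl[of g "{g}" G] N.one_closed unfolding set_mult_def by blast
    then show ?thesis using g by simp
  qed
  have HG: "?H = carrier G"
  proof (rule ccontr)
    assume ne: "?H \<noteq> carrier G"
    show False
    proof (rule exists_hom_mod_prime[OF fin p H ne])
      show "x \<otimes> y \<otimes> inv x \<otimes> inv y \<in> ?H" if "x \<in> carrier G" "y \<in> carrier G" for x y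
        using comm[OF that] NH by blast
      show "x [^] (p ^ m) \<in> ?H" if "x \<in> carrier G" for x
        using exp[OF that] NH by blast
      fix \<alpha> :: "'a \<Rightarrow> int" and x
      assume \<alpha>: "\<And>x y. x \<in> carrier G \<Longrightarrow> y \<in> carrier G \<Longrightarrow> int p dvd \<alpha> (x \<otimes> y) - (\<alpha> x + \<alpha> y)"
        and kills: "\<And>x. x \<in> ?H \<Longrightarrow> int p dvd \<alpha> x"
        and x: "x \<in> carrier G" "\<not> int p dvd \<alpha> x"
      show False using hom[OF \<alpha> kills[OF gH] x(1)] x(2) by blast
    qed
  qed
  have cycQ: "cyclic_group (G Mod N)"
  proof -
    let ?C = "subgroup_generated G {g}"
    have cC: "carrier ?C = generate G {g}" using g by (simp add: carrier_subgroup_generated)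
    have "(\<lambda>x. N #> x) \<in> hom ?C (G Mod N)"
      using subgroup.mem_carrier[OF gen]
      by (intro homI) (auto simp: cC FactGroup_def RCOSETS_def
        N.rcos_sum[OF subgroup.mem_carrier[OF gen] subgroup.mem_carrier[OF gen]])
    moreover have "(\<lambda>x. N #> x) ` carrier ?C = carrier (G Mod N)"
    proof
      show "(\<lambda>x. N #> x) ` carrier ?C \<subseteq> carrier (G Mod N)"
        using gen by (auto simp: cC FactGroup_def RCOSETS_def dest: subgroup.mem_carrier)
      show "carrier (G Mod N) \<subseteq> (\<lambda>x. N #> x) ` carrier ?C"
      proof
        fix C assume "C \<in> carrier (G Mod N)"
        then obtain x where x: "x \<in> carrier G" "C = N #> x" by (auto simp: FactGroup_def RCOSETS_def)
        then obtain n t where nt: "n \<in> N" "t \<in> generate G {g}" "x = n \<otimes> t"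
          using HG unfolding set_mult_def by blast
        have tG: "t \<in> carrier G" using subgroup.mem_carrier[OF gen nt(2)] .
        have "N #> x = N #> n #> t"
          using nt tG N.mem_carrier[OF nt(1)] by (simp add: coset_mult_assoc N.subset)
        also have "N #> n = N" using nt(1) N.mem_carrier by (simp add: coset_join2 N.subgroup_axioms)
        finally have "C = N #> t" using x(2) by simp
        then show "C \<in> (\<lambda>x. N #> x) ` carrier ?C" by (rule image_eqI) (simp add: cC nt(2))
      qed
    qed
    ultimately show ?thesis
      using group.cyclic_group_epimorphic_image[of ?C "\<lambda>x. N #> x" "G Mod N"]
        group_subgroup_generated cyclic_group_generated Q.is_group by (auto simp: epi_def)
  qed
  have "cyclic_group (G\<lparr>carrier := P\<rparr>)" if "sylow_subgroup p P G" for P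
  proof -
    have P: "subgroup P G" "card P = p ^ k" using that ord(2) by (auto simp: sylow_subgroup_def)
    have "(\<lambda>x. N #> x) \<in> iso (G\<lparr>carrier := P\<rparr>) (G Mod N)"
      using coprime_complement_iso[OF N P(1) fin] cop ord(1) P(2) by (simp add: coprime_commute)
    then have "G\<lparr>carrier := P\<rparr> \<cong> G Mod N" by (auto simp: is_iso_def)
    then show ?thesis
      using isomorphic_group_cyclicity[OF _ subgroup_imp_group[OF P(1)] Q.is_group] cycQ by blast
  qed
  then show ?thesis using N cop k unfolding p_nilpotent_def by blast
qed

text \<open>The exponents of \<open>g\<close> are natural numbers, so that \<open>g\<^sup>i - 1\<close> is visibly a multiple of \<open>g - 1\<close> in
  the group algebra.\<close>

lemma (in group) p_nilpotent_cyclicE: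
  assumes fin: "finite (carrier G)" and p: "Factorial_Ring.prime (p::nat)"
    and nil: "p_nilpotent p G" and cyc: "\<forall>P. sylow_subgroup p P G \<longrightarrow> cyclic_group (G\<lparr>carrier := P\<rparr>)"
  obtains N g where "N \<lhd> G" "coprime p (card N)" "comm_group (G Mod N)" "g \<in> carrier G"
    "\<And>x. x \<in> carrier G \<Longrightarrow> \<exists>n\<in>N. \<exists>i::nat. x = n \<otimes> g [^] i"
proof -
  obtain N k where N: "N \<lhd> G" and cop: "coprime p (card N)" and k: "order (G Mod N) = p ^ k"
    using nil by (auto simp: p_nilpotent_def)
  interpret N: normal N G by (rule N)
  interpret Q: group "G Mod N" by (rule N.factorgroup_is_group)
  note ord = order_normal_complement[OF N fin p cop k]
  obtain P where P: "subgroup P G" "card P = p ^ k"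
    using sylow_thm[OF p is_group, of k "card N"] ord(1) fin by (auto simp: mult.commute)
  have "cyclic_group (G\<lparr>carrier := P\<rparr>)"
    using cyc P ord(2) by (simp add: sylow_subgroup_def)
  moreover have "G\<lparr>carrier := P\<rparr> \<cong> G Mod N"
    using coprime_complement_iso[OF N P(1) fin] cop ord(1) P(2) by (auto simp: is_iso_def coprime_commute)
  ultimately have cycQ: "cyclic_group (G Mod N)"
    using isomorphic_group_cyclicity[OF _ subgroup_imp_group[OF P(1)] Q.is_group] by blast
  then obtain C where C: "C \<in> carrier (G Mod N)"
    and gen: "carrier (G Mod N) = range (\<lambda>i::int. C [^]\<^bsub>G Mod N\<^esub> i)"
    using Q.cyclic_group by blast
  obtain g where g: "g \<in> carrier G" "C = N #> g" using C by (auto simp: FactGroup_def RCOSETS_def)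
  show thesis
  proof (rule that[OF N cop Q.cyclic_imp_abelian_group[OF cycQ] g(1)])
    fix x assume x: "x \<in> carrier G"
    have "N #> x \<in> carrier (G Mod N)" using x by (auto simp: FactGroup_def RCOSETS_def)
    then obtain i :: int where "N #> x = C [^]\<^bsub>G Mod N\<^esub> i" using gen by blast
    also have "\<dots> = N #> (g [^] i)" using N.FactGroup_int_pow[OF g(1)] g(2) by simp
    finally have "x \<in> N #> (g [^] i)" using rcos_self[OF x N.subgroup_axioms] by simp
    then obtain n where n: "n \<in> N" "x = n \<otimes> g [^] i" by (auto simp: r_coset_def)
    have "g [^] i \<in> generate G {g}" using generate_pow[OF g(1)] by blast
    then obtain j :: nat where "g [^] i = g [^] j"
      using generate_pow_on_finite_carrier[OF fin g(1)] by auto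
    then show "\<exists>n\<in>N. \<exists>i::nat. x = n \<otimes> g [^] i" using n by auto
  qed
qed

section \<open>The group algebra and its augmentation\<close>

lemma (in abelian_monoid) finsum_swap:
  assumes "finite I" "finite Y" "\<And>x y. x \<in> I \<Longrightarrow> y \<in> Y \<Longrightarrow> F x y \<in> carrier G"
  shows "(\<Oplus>x\<in>I. \<Oplus>y\<in>Y. F x y) = (\<Oplus>y\<in>Y. \<Oplus>x\<in>I. F x y)"
  using assms(1,3)
proof (induction I rule: finite_induct)
  case empty
  then show ?case by simp
next
  case (insert x I)
  have "(\<Oplus>x\<in>insert x I. \<Oplus>y\<in>Y. F x y) = (\<Oplus>y\<in>Y. F x y) \<oplus> (\<Oplus>x\<in>I. \<Oplus>y\<in>Y. F x y)"
    using insert by (subst finsum_insert) (auto intro!: finsum_closed)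
  also have "\<dots> = (\<Oplus>y\<in>Y. F x y) \<oplus> (\<Oplus>y\<in>Y. \<Oplus>x\<in>I. F x y)"
    using insert by simp
  also have "\<dots> = (\<Oplus>y\<in>Y. F x y \<oplus> (\<Oplus>x\<in>I. F x y))"
    using insert by (subst finsum_addf) (auto intro!: finsum_closed)
  also have "\<dots> = (\<Oplus>y\<in>Y. \<Oplus>x\<in>insert x I. F x y)"
    using insert by (intro finsum_cong') (auto intro!: finsum_closed)
  finally show ?case .
qed

lemma (in abelian_monoid) finsum_single:
  assumes "finite I" "a \<in> I" "F a \<in> carrier G" "\<And>x. x \<in> I \<Longrightarrow> x \<noteq> a \<Longrightarrow> F x = \<zero>"
  shows "(\<Oplus>x\<in>I. F x) = F a"
proof -
  have c: "F \<in> I - {a} \<rightarrow> carrier G"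
    using assms(4) by (metis DiffE Pi_I singletonI zero_closed)
  have "(\<Oplus>x\<in>I. F x) = (\<Oplus>x\<in>insert a (I - {a}). F x)"
    using assms(2) by (simp add: insert_absorb)
  also have "\<dots> = F a \<oplus> (\<Oplus>x\<in>I - {a}. F x)"
    using assms(1,3) c by (subst finsum_insert) auto
  also have "(\<Oplus>x\<in>I - {a}. F x) = (\<Oplus>x\<in>I - {a}. \<zero>)"
    using assms by (intro finsum_cong') auto
  finally show ?thesis using assms(3) by simp
qed

lemma (in ring) minus_add_minus:
  assumes "a \<in> carrier R" "b \<in> carrier R" "c \<in> carrier R"
  shows "(a \<ominus> b) \<oplus> (c \<ominus> a) = c \<ominus> b"
  using assms by algebra

definition augmentation :: "('r, 'b) ring_scheme \<Rightarrow> ('g, 'e) monoid_scheme \<Rightarrow> ('g \<Rightarrow> 'r) \<Rightarrow> 'r"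
  where "augmentation R G f = (\<Oplus>\<^bsub>R\<^esub>x\<in>carrier G. f x)"

locale finite_group_ring = R: cring R + G: group G
  for R :: "('r, 'b) ring_scheme" (structure) and G :: "('g, 'e) monoid_scheme" +
  assumes finite_G [simp, intro]: "finite (carrier G)"
begin

abbreviation A :: "('r, 'g \<Rightarrow> 'r) module" where "A \<equiv> group_algebra R G"
abbreviation \<delta> :: "'g \<Rightarrow> 'g \<Rightarrow> 'r" where "\<delta> \<equiv> group_elt R G"
abbreviation \<epsilon> :: "('g \<Rightarrow> 'r) \<Rightarrow> 'r" where "\<epsilon> \<equiv> augmentation R G"

lemma carrier_A: "carrier A = carrier G \<rightarrow>\<^sub>E carrier R"
  by (simp add: group_algebra_def)

lemma coeff_closed [simp, intro]: "f \<in> carrier A \<Longrightarrow> x \<in> carrier G \<Longrightarrow> f x \<in> carrier R"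
  by (auto simp: carrier_A)

lemma restrict_mem_A [intro]: "(\<And>x. x \<in> carrier G \<Longrightarrow> f x \<in> carrier R) \<Longrightarrow> (\<lambda>x\<in>carrier G. f x) \<in> carrier A"
  by (auto simp: carrier_A)

lemma A_eqI:
  "f \<in> carrier A \<Longrightarrow> g \<in> carrier A \<Longrightarrow> (\<And>x. x \<in> carrier G \<Longrightarrow> f x = g x) \<Longrightarrow> f = g"
  unfolding carrier_A by (rule PiE_ext)

lemma add_coeff [simp]: "x \<in> carrier G \<Longrightarrow> (f \<oplus>\<^bsub>A\<^esub> g) x = f x \<oplus> g x"
  and zero_coeff [simp]: "x \<in> carrier G \<Longrightarrow> \<zero>\<^bsub>A\<^esub> x = \<zero>"
  and smult_coeff [simp]: "x \<in> carrier G \<Longrightarrow> (r \<odot>\<^bsub>A\<^esub> f) x = r \<otimes> f x"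
  and mult_coeff: "x \<in> carrier G \<Longrightarrow>
    (f \<otimes>\<^bsub>A\<^esub> g) x = (\<Oplus>y\<in>carrier G. f y \<otimes> g (inv\<^bsub>G\<^esub> y \<otimes>\<^bsub>G\<^esub> x))"
  and group_elt_coeff: "x \<in> carrier G \<Longrightarrow> \<delta> y x = (if x = y then \<one> else \<zero>)"
  by (simp_all add: group_algebra_def group_elt_def)

lemma group_elt_one: "\<delta> \<one>\<^bsub>G\<^esub> = \<one>\<^bsub>A\<^esub>"
  by (simp add: group_algebra_def group_elt_def)

lemma A_closed [simp]:
  "f \<in> carrier A \<Longrightarrow> g \<in> carrier A \<Longrightarrow> f \<oplus>\<^bsub>A\<^esub> g \<in> carrier A"
  "\<zero>\<^bsub>A\<^esub> \<in> carrier A" "\<one>\<^bsub>A\<^esub> \<in> carrier A"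
  "r \<in> carrier R \<Longrightarrow> f \<in> carrier A \<Longrightarrow> r \<odot>\<^bsub>A\<^esub> f \<in> carrier A"
  "f \<in> carrier A \<Longrightarrow> g \<in> carrier A \<Longrightarrow> f \<otimes>\<^bsub>A\<^esub> g \<in> carrier A"
  and group_elt_closed [simp, intro]: "\<delta> x \<in> carrier A"
  by (auto simp: group_algebra_def group_elt_def intro!: R.finsum_closed)

lemma finsum_translate:
  assumes "u \<in> carrier G" "\<And>x. x \<in> carrier G \<Longrightarrow> f x \<in> carrier R"
  shows "(\<Oplus>y\<in>carrier G. f (u \<otimes>\<^bsub>G\<^esub> y)) = (\<Oplus>y\<in>carrier G. f y)"
proof -
  have "(\<Oplus>y\<in>(\<lambda>y. u \<otimes>\<^bsub>G\<^esub> y) ` carrier G. f y) = (\<Oplus>y\<in>carrier G. f (u \<otimes>\<^bsub>G\<^esub> y))"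
    using assms by (intro R.finsum_reindex) (auto simp: G.inj_on_cmult)
  then show ?thesis
    using assms by (simp add: G.surj_const_mult)
qed

text \<open>The substitution \<open>y \<mapsto> u y\<^sup>-\<^sup>1\<close> exchanges the two arguments of a convolution at \<open>u\<close>.\<close>

lemma finsum_translate_inv:
  assumes "u \<in> carrier G" "\<And>x. x \<in> carrier G \<Longrightarrow> f x \<in> carrier R"
  shows "(\<Oplus>y\<in>carrier G. f (u \<otimes>\<^bsub>G\<^esub> inv\<^bsub>G\<^esub> y)) = (\<Oplus>y\<in>carrier G. f y)"
proof -
  have inj: "inj_on (\<lambda>y. u \<otimes>\<^bsub>G\<^esub> inv\<^bsub>G\<^esub> y) (carrier G)"
    using assms(1) by (auto intro!: inj_onI simp: G.inv_eq_imp_eq)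
  have im: "(\<lambda>y. u \<otimes>\<^bsub>G\<^esub> inv\<^bsub>G\<^esub> y) ` carrier G = carrier G"
    using assms(1) inj by (intro card_subset_eq) (auto simp: card_image)
  show ?thesis
    using R.finsum_reindex[OF _ inj, of f] assms im by simp
qed

lemma A_assoc:
  assumes [simp]: "f \<in> carrier A" "g \<in> carrier A" "h \<in> carrier A"
  shows "(f \<otimes>\<^bsub>A\<^esub> g) \<otimes>\<^bsub>A\<^esub> h = f \<otimes>\<^bsub>A\<^esub> (g \<otimes>\<^bsub>A\<^esub> h)"
proof (rule A_eqI)
  fix x assume x [simp]: "x \<in> carrier G"
  have "((f \<otimes>\<^bsub>A\<^esub> g) \<otimes>\<^bsub>A\<^esub> h) x =
      (\<Oplus>y\<in>carrier G. (\<Oplus>u\<in>carrier G. f u \<otimes> g (inv\<^bsub>G\<^esub> u \<otimes>\<^bsub>G\<^esub> y)) \<otimes> h (inv\<^bsub>G\<^esub> y \<otimes>\<^bsub>G\<^esub> x))"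
    unfolding mult_coeff[OF x] by (intro R.finsum_cong') (auto simp: mult_coeff)
  also have "\<dots> = (\<Oplus>y\<in>carrier G. \<Oplus>u\<in>carrier G. f u \<otimes> g (inv\<^bsub>G\<^esub> u \<otimes>\<^bsub>G\<^esub> y) \<otimes> h (inv\<^bsub>G\<^esub> y \<otimes>\<^bsub>G\<^esub> x))"
    by (intro R.finsum_cong') (auto simp: R.finsum_ldistr Pi_def)
  also have "\<dots> = (\<Oplus>u\<in>carrier G. \<Oplus>y\<in>carrier G. f u \<otimes> g (inv\<^bsub>G\<^esub> u \<otimes>\<^bsub>G\<^esub> y) \<otimes> h (inv\<^bsub>G\<^esub> y \<otimes>\<^bsub>G\<^esub> x))"
    by (intro R.finsum_swap) auto
  also have "\<dots> = (\<Oplus>u\<in>carrier G. f u \<otimes> (g \<otimes>\<^bsub>A\<^esub> h) (inv\<^bsub>G\<^esub> u \<otimes>\<^bsub>G\<^esub> x))"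
  proof (intro R.finsum_cong')
    fix u assume u [simp]: "u \<in> carrier G"
    have "(\<Oplus>y\<in>carrier G. f u \<otimes> g (inv\<^bsub>G\<^esub> u \<otimes>\<^bsub>G\<^esub> y) \<otimes> h (inv\<^bsub>G\<^esub> y \<otimes>\<^bsub>G\<^esub> x)) =
      (\<Oplus>v\<in>carrier G. f u \<otimes> g (inv\<^bsub>G\<^esub> u \<otimes>\<^bsub>G\<^esub> (u \<otimes>\<^bsub>G\<^esub> v)) \<otimes> h (inv\<^bsub>G\<^esub> (u \<otimes>\<^bsub>G\<^esub> v) \<otimes>\<^bsub>G\<^esub> x))"
      by (rule finsum_translate[symmetric]) auto
    also have "\<dots> = (\<Oplus>v\<in>carrier G. f u \<otimes> (g v \<otimes> h (inv\<^bsub>G\<^esub> v \<otimes>\<^bsub>G\<^esub> (inv\<^bsub>G\<^esub> u \<otimes>\<^bsub>G\<^esub> x))))"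
      by (intro R.finsum_cong')
        (auto simp: G.inv_mult_group G.m_assoc R.m_assoc G.inv_mult_cancel_left)
    finally show "(\<Oplus>y\<in>carrier G. f u \<otimes> g (inv\<^bsub>G\<^esub> u \<otimes>\<^bsub>G\<^esub> y) \<otimes> h (inv\<^bsub>G\<^esub> y \<otimes>\<^bsub>G\<^esub> x)) =
       f u \<otimes> (g \<otimes>\<^bsub>A\<^esub> h) (inv\<^bsub>G\<^esub> u \<otimes>\<^bsub>G\<^esub> x)"
      by (simp add: mult_coeff R.finsum_rdistr Pi_def)
  qed auto
  also have "\<dots> = (f \<otimes>\<^bsub>A\<^esub> (g \<otimes>\<^bsub>A\<^esub> h)) x"
    by (simp add: mult_coeff[of x])
  finally show "((f \<otimes>\<^bsub>A\<^esub> g) \<otimes>\<^bsub>A\<^esub> h) x = (f \<otimes>\<^bsub>A\<^esub> (g \<otimes>\<^bsub>A\<^esub> h)) x" .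
qed (auto intro: A_closed)

lemma group_elt_mult_coeff:
  assumes [simp]: "f \<in> carrier A" "x \<in> carrier G" "y \<in> carrier G"
  shows "(\<delta> x \<otimes>\<^bsub>A\<^esub> f) y = f (inv\<^bsub>G\<^esub> x \<otimes>\<^bsub>G\<^esub> y)"
  unfolding mult_coeff[OF assms(3)]
  by (subst R.finsum_single[where a = x]) (auto simp: group_elt_coeff)

lemma mult_group_elt_coeff:
  assumes [simp]: "f \<in> carrier A" "x \<in> carrier G" "y \<in> carrier G"
  shows "(f \<otimes>\<^bsub>A\<^esub> \<delta> x) y = f (y \<otimes>\<^bsub>G\<^esub> inv\<^bsub>G\<^esub> x)"
proof -
  have "inv\<^bsub>G\<^esub> u \<otimes>\<^bsub>G\<^esub> y = x \<longleftrightarrow> u = y \<otimes>\<^bsub>G\<^esub> inv\<^bsub>G\<^esub> x" if "u \<in> carrier G" for u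
    using that by (metis G.inv_closed G.inv_solve_left G.inv_solve_right assms(2,3) G.m_closed)
  then show ?thesis
    unfolding mult_coeff[OF assms(3)]
    by (subst R.finsum_single[where a = "y \<otimes>\<^bsub>G\<^esub> inv\<^bsub>G\<^esub> x"]) (auto simp: group_elt_coeff)
qed

lemma group_algebra_abelian_group: "abelian_group A"
proof (rule abelian_groupI)
  fix f assume f [simp]: "f \<in> carrier A"
  show "\<exists>g\<in>carrier A. g \<oplus>\<^bsub>A\<^esub> f = \<zero>\<^bsub>A\<^esub>"
    by (rule bexI[of _ "\<lambda>x\<in>carrier G. \<ominus> f x"]) (auto intro!: A_eqI A_closed restrict_mem_A simp: R.l_neg)
qed (auto intro!: A_eqI simp: A_closed R.a_ac)

lemma group_algebra_ring: "ring A"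
proof (rule ringI)
  show "monoid A"
  proof (rule monoidI)
    fix f assume f [simp]: "f \<in> carrier A"
    show "\<one>\<^bsub>A\<^esub> \<otimes>\<^bsub>A\<^esub> f = f"
      unfolding group_elt_one[symmetric]
      by (rule A_eqI) (simp_all add: A_closed group_elt_mult_coeff)
    show "f \<otimes>\<^bsub>A\<^esub> \<one>\<^bsub>A\<^esub> = f"
      unfolding group_elt_one[symmetric]
      by (rule A_eqI) (simp_all add: A_closed mult_group_elt_coeff)
  qed (auto simp: A_closed A_assoc)
next
  fix f g h assume [simp]: "f \<in> carrier A" "g \<in> carrier A" "h \<in> carrier A"
  show "(f \<oplus>\<^bsub>A\<^esub> g) \<otimes>\<^bsub>A\<^esub> h = f \<otimes>\<^bsub>A\<^esub> h \<oplus>\<^bsub>A\<^esub> g \<otimes>\<^bsub>A\<^esub> h"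
  proof (rule A_eqI)
    fix x assume [simp]: "x \<in> carrier G"
    show "((f \<oplus>\<^bsub>A\<^esub> g) \<otimes>\<^bsub>A\<^esub> h) x = (f \<otimes>\<^bsub>A\<^esub> h \<oplus>\<^bsub>A\<^esub> g \<otimes>\<^bsub>A\<^esub> h) x"
      by (simp add: mult_coeff, subst R.finsum_addf[symmetric]) (auto simp: R.l_distr simp del: R.finsum_addf intro!: R.finsum_cong')
  qed auto
  show "h \<otimes>\<^bsub>A\<^esub> (f \<oplus>\<^bsub>A\<^esub> g) = h \<otimes>\<^bsub>A\<^esub> f \<oplus>\<^bsub>A\<^esub> h \<otimes>\<^bsub>A\<^esub> g"
  proof (rule A_eqI)
    fix x assume [simp]: "x \<in> carrier G"
    show "(h \<otimes>\<^bsub>A\<^esub> (f \<oplus>\<^bsub>A\<^esub> g)) x = (h \<otimes>\<^bsub>A\<^esub> f \<oplus>\<^bsub>A\<^esub> h \<otimes>\<^bsub>A\<^esub> g) x"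
      by (simp add: mult_coeff, subst R.finsum_addf[symmetric]) (auto simp: R.r_distr simp del: R.finsum_addf intro!: R.finsum_cong')
  qed auto
qed (rule group_algebra_abelian_group)

lemma group_algebra_assoc_algebra: "assoc_algebra R A"
proof (intro assoc_algebra.intro assoc_algebra_axioms.intro group_algebra_ring moduleI R.is_cring
    group_algebra_abelian_group)
  fix r f g assume [simp]: "r \<in> carrier R" "f \<in> carrier A" "g \<in> carrier A"
  show "(r \<odot>\<^bsub>A\<^esub> f) \<otimes>\<^bsub>A\<^esub> g = r \<odot>\<^bsub>A\<^esub> (f \<otimes>\<^bsub>A\<^esub> g)"
  proof (rule A_eqI)
    fix x assume [simp]: "x \<in> carrier G"
    show "((r \<odot>\<^bsub>A\<^esub> f) \<otimes>\<^bsub>A\<^esub> g) x = (r \<odot>\<^bsub>A\<^esub> (f \<otimes>\<^bsub>A\<^esub> g)) x"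
      by (simp add: mult_coeff, subst R.finsum_rdistr) (auto simp: R.m_assoc intro!: R.finsum_cong')
  qed auto
  show "f \<otimes>\<^bsub>A\<^esub> (r \<odot>\<^bsub>A\<^esub> g) = r \<odot>\<^bsub>A\<^esub> (f \<otimes>\<^bsub>A\<^esub> g)"
  proof (rule A_eqI)
    fix x assume [simp]: "x \<in> carrier G"
    show "(f \<otimes>\<^bsub>A\<^esub> (r \<odot>\<^bsub>A\<^esub> g)) x = (r \<odot>\<^bsub>A\<^esub> (f \<otimes>\<^bsub>A\<^esub> g)) x"
      by (simp add: mult_coeff, subst R.finsum_rdistr) (auto simp: R.m_lcomm intro!: R.finsum_cong')
  qed auto
qed (auto intro!: A_eqI simp: R.l_distr R.r_distr R.m_assoc)

sublocale A: assoc_algebra R A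
  by (rule group_algebra_assoc_algebra)

lemma a_inv_coeff [simp]: "f \<in> carrier A \<Longrightarrow> x \<in> carrier G \<Longrightarrow> (\<ominus>\<^bsub>A\<^esub> f) x = \<ominus> f x"
proof -
  assume f: "f \<in> carrier A" and x: "x \<in> carrier G"
  have "(\<ominus>\<^bsub>A\<^esub> f) x \<oplus> f x = (\<ominus>\<^bsub>A\<^esub> f \<oplus>\<^bsub>A\<^esub> f) x" using x by simp
  also have "\<dots> = \<zero>" using f x by (simp add: A.M.l_neg)
  finally show ?thesis using f x by (simp add: R.minus_equality)
qed

lemma minus_coeff [simp]:
  "f \<in> carrier A \<Longrightarrow> g \<in> carrier A \<Longrightarrow> x \<in> carrier G \<Longrightarrow> (f \<ominus>\<^bsub>A\<^esub> g) x = f x \<ominus> g x"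
  by (simp add: a_minus_def)

lemma finsum_coeff:
  assumes "finite I" "\<And>i. i \<in> I \<Longrightarrow> F i \<in> carrier A" "x \<in> carrier G"
  shows "(\<Oplus>\<^bsub>A\<^esub>i\<in>I. F i) x = (\<Oplus>i\<in>I. F i x)"
  using assms(1,2)
proof (induction I rule: finite_induct)
  case (insert i I)
  then show ?case
    using assms(3) by (subst A.M.finsum_insert) (auto simp: R.finsum_insert Pi_def)
qed (simp add: assms)

lemma group_elt_mult:
  assumes [simp]: "x \<in> carrier G" "y \<in> carrier G"
  shows "\<delta> x \<otimes>\<^bsub>A\<^esub> \<delta> y = \<delta> (x \<otimes>\<^bsub>G\<^esub> y)"
proof (rule A_eqI)
  fix u assume [simp]: "u \<in> carrier G"
  show "(\<delta> x \<otimes>\<^bsub>A\<^esub> \<delta> y) u = \<delta> (x \<otimes>\<^bsub>G\<^esub> y) u"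
    by (simp add: group_elt_mult_coeff group_elt_coeff G.inv_solve_left')
qed auto

lemma group_elt_pow: "x \<in> carrier G \<Longrightarrow> \<delta> x [^]\<^bsub>A\<^esub> (n::nat) = \<delta> (x [^]\<^bsub>G\<^esub> n)"
  by (induction n) (simp_all add: group_elt_one group_elt_mult)

lemma basis_expansion:
  assumes [simp]: "f \<in> carrier A"
  shows "f = (\<Oplus>\<^bsub>A\<^esub>x\<in>carrier G. f x \<odot>\<^bsub>A\<^esub> \<delta> x)"
proof (rule A_eqI)
  fix y assume y [simp]: "y \<in> carrier G"
  have "(\<Oplus>x\<in>carrier G. f x \<otimes> \<delta> x y) = f y"
    by (subst R.finsum_single[where a = y]) (auto simp: group_elt_coeff)
  then show "f y = (\<Oplus>\<^bsub>A\<^esub>x\<in>carrier G. f x \<odot>\<^bsub>A\<^esub> \<delta> x) y"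
    by (subst finsum_coeff) auto
qed (auto intro!: A.M.finsum_closed)

lemma augmentation_closed [simp, intro]: "f \<in> carrier A \<Longrightarrow> \<epsilon> f \<in> carrier R"
  by (auto simp: augmentation_def intro!: R.finsum_closed)

lemma augmentation_add [simp]:
  "f \<in> carrier A \<Longrightarrow> g \<in> carrier A \<Longrightarrow> \<epsilon> (f \<oplus>\<^bsub>A\<^esub> g) = \<epsilon> f \<oplus> \<epsilon> g"
  unfolding augmentation_def
  by (subst R.finsum_addf[symmetric]) (auto simp del: R.finsum_addf intro!: R.finsum_cong')

lemma augmentation_smult [simp]:
  "r \<in> carrier R \<Longrightarrow> f \<in> carrier A \<Longrightarrow> \<epsilon> (r \<odot>\<^bsub>A\<^esub> f) = r \<otimes> \<epsilon> f"
  unfolding augmentation_def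
  by (subst R.finsum_rdistr) (auto intro!: R.finsum_cong')

lemma augmentation_group_elt [simp]: "x \<in> carrier G \<Longrightarrow> \<epsilon> (\<delta> x) = \<one>"
  unfolding augmentation_def
  by (subst R.finsum_single[where a = x]) (auto simp: group_elt_coeff)

lemma augmentation_one [simp]: "\<epsilon> \<one>\<^bsub>A\<^esub> = \<one>"
  using augmentation_group_elt[of "\<one>\<^bsub>G\<^esub>"] by (simp add: group_elt_one)

lemma augmentation_zero [simp]: "\<epsilon> \<zero>\<^bsub>A\<^esub> = \<zero>"
  unfolding augmentation_def by (rule R.add.finprod_one_eqI) auto

lemma augmentation_a_inv [simp]: "f \<in> carrier A \<Longrightarrow> \<epsilon> (\<ominus>\<^bsub>A\<^esub> f) = \<ominus> \<epsilon> f"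
  using augmentation_add[of "\<ominus>\<^bsub>A\<^esub> f" f] by (simp add: A.M.l_neg R.minus_equality)

lemma augmentation_minus [simp]:
  "f \<in> carrier A \<Longrightarrow> g \<in> carrier A \<Longrightarrow> \<epsilon> (f \<ominus>\<^bsub>A\<^esub> g) = \<epsilon> f \<ominus> \<epsilon> g"
  by (simp add: a_minus_def)

lemma augmentation_mult [simp]:
  assumes [simp]: "f \<in> carrier A" "g \<in> carrier A"
  shows "\<epsilon> (f \<otimes>\<^bsub>A\<^esub> g) = \<epsilon> f \<otimes> \<epsilon> g"
proof -
  have "\<epsilon> (f \<otimes>\<^bsub>A\<^esub> g) = (\<Oplus>x\<in>carrier G. \<Oplus>y\<in>carrier G. f y \<otimes> g (inv\<^bsub>G\<^esub> y \<otimes>\<^bsub>G\<^esub> x))"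
    unfolding augmentation_def by (intro R.finsum_cong') (auto simp: mult_coeff)
  also have "\<dots> = (\<Oplus>y\<in>carrier G. \<Oplus>x\<in>carrier G. f y \<otimes> g (inv\<^bsub>G\<^esub> y \<otimes>\<^bsub>G\<^esub> x))"
    by (intro R.finsum_swap) auto
  also have "\<dots> = (\<Oplus>y\<in>carrier G. f y \<otimes> \<epsilon> g)"
    by (intro R.finsum_cong')
      (auto simp: R.finsum_rdistr[symmetric] Pi_def finsum_translate augmentation_def)
  also have "\<dots> = \<epsilon> f \<otimes> \<epsilon> g"
    by (simp add: augmentation_def R.finsum_ldistr Pi_def R.finsum_closed)
  finally show ?thesis .
qed

lemma augmentation_pow: "f \<in> carrier A \<Longrightarrow> \<epsilon> (f [^]\<^bsub>A\<^esub> (n::nat)) = \<epsilon> f [^] n"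
  by (induction n) simp_all

lemma class_function_central:
  assumes [simp]: "w \<in> carrier A" "b \<in> carrier A"
    and "\<And>x y. x \<in> carrier G \<Longrightarrow> y \<in> carrier G \<Longrightarrow> w (x \<otimes>\<^bsub>G\<^esub> y) = w (y \<otimes>\<^bsub>G\<^esub> x)"
  shows "b \<otimes>\<^bsub>A\<^esub> w = w \<otimes>\<^bsub>A\<^esub> b"
proof (rule A_eqI)
  fix x assume x [simp]: "x \<in> carrier G"
  have "(w \<otimes>\<^bsub>A\<^esub> b) x = (\<Oplus>y\<in>carrier G. w (x \<otimes>\<^bsub>G\<^esub> inv\<^bsub>G\<^esub> y) \<otimes> b (inv\<^bsub>G\<^esub> (x \<otimes>\<^bsub>G\<^esub> inv\<^bsub>G\<^esub> y) \<otimes>\<^bsub>G\<^esub> x))"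
    unfolding mult_coeff[OF x] by (rule finsum_translate_inv[symmetric]) auto
  also have "\<dots> = (b \<otimes>\<^bsub>A\<^esub> w) x"
    unfolding mult_coeff[OF x]
    by (intro R.finsum_cong') (auto simp: G.inv_mult_group G.m_assoc assms(3) R.m_comm)
  finally show "(b \<otimes>\<^bsub>A\<^esub> w) x = (w \<otimes>\<^bsub>A\<^esub> b) x" by simp
qed auto

text \<open>The elements \<open>x - 1\<close> span the augmentation ideal: if \<open>\<epsilon> f = 0\<close> then \<open>f\<close> is the sum of the \<open>f(x) (x - 1)\<close>.\<close>

lemma augmentation_ideal_induct:
  assumes "\<zero>\<^bsub>A\<^esub> \<in> S" "\<And>f g. f \<in> S \<Longrightarrow> g \<in> S \<Longrightarrow> f \<oplus>\<^bsub>A\<^esub> g \<in> S" "S \<subseteq> carrier A"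
    and "\<And>r f. r \<in> carrier R \<Longrightarrow> f \<in> S \<Longrightarrow> r \<odot>\<^bsub>A\<^esub> f \<in> S"
    and "\<And>x. x \<in> carrier G \<Longrightarrow> \<delta> x \<ominus>\<^bsub>A\<^esub> \<one>\<^bsub>A\<^esub> \<in> S"
    and [simp]: "f \<in> carrier A" and "\<epsilon> f = \<zero>"
  shows "f \<in> S"
proof -
  have eq: "f = (\<Oplus>\<^bsub>A\<^esub>x\<in>carrier G. f x \<odot>\<^bsub>A\<^esub> (\<delta> x \<ominus>\<^bsub>A\<^esub> \<one>\<^bsub>A\<^esub>))"
  proof (rule A_eqI)
    fix y assume y [simp]: "y \<in> carrier G"
    have "(\<Oplus>x\<in>carrier G. f x \<otimes> (\<delta> x y \<ominus> \<one>\<^bsub>A\<^esub> y)) = 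
       (\<Oplus>x\<in>carrier G. f x \<otimes> \<delta> x y \<oplus> f x \<otimes> (\<ominus> \<one>\<^bsub>A\<^esub> y))"
      by (intro R.finsum_cong') (auto simp: a_minus_def R.r_distr)
    also have "\<dots> = (\<Oplus>x\<in>carrier G. f x \<otimes> \<delta> x y) \<oplus> \<epsilon> f \<otimes> (\<ominus> \<one>\<^bsub>A\<^esub> y)"
      by (subst R.finsum_addf) (auto simp: augmentation_def R.finsum_ldistr Pi_def)
    also have "(\<Oplus>x\<in>carrier G. f x \<otimes> \<delta> x y) = f y"
      by (subst R.finsum_single[where a = y]) (auto simp: group_elt_coeff)
    finally show "f y = (\<Oplus>\<^bsub>A\<^esub>x\<in>carrier G. f x \<odot>\<^bsub>A\<^esub> (\<delta> x \<ominus>\<^bsub>A\<^esub> \<one>\<^bsub>A\<^esub>)) y"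
      by (subst finsum_coeff) (auto simp: assms(7))
  qed (auto intro!: A.M.finsum_closed)
  have sum_mem: "(\<Oplus>\<^bsub>A\<^esub>x\<in>I. f x \<odot>\<^bsub>A\<^esub> (\<delta> x \<ominus>\<^bsub>A\<^esub> \<one>\<^bsub>A\<^esub>)) \<in> S" if "finite I" "I \<subseteq> carrier G" for I
    using that
  proof (induction I rule: finite_induct)
    case (insert x I)
    then show ?case
      using assms(2,4,5) by (subst A.M.finsum_insert) (auto simp: subset_iff)
  qed (use assms(1) in simp)
  show ?thesis by (subst eq) (rule sum_mem[OF finite_G order_refl])
qed

text \<open>The factor is \<open>s = 1 + x + \<dots> + x\<^sup>m\<^sup>-\<^sup>1\<close>. What matters is its augmentation: in characteristic \<open>p\<close> and for
  \<open>m = p\<close> it vanishes, so that \<open>s\<close> lies in the augmentation ideal.\<close>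

lemma geometric_factor:
  assumes [simp]: "x \<in> carrier A" and "\<epsilon> x = \<one>"
  shows "\<exists>s\<in>carrier A. x [^]\<^bsub>A\<^esub> (m::nat) \<ominus>\<^bsub>A\<^esub> \<one>\<^bsub>A\<^esub> = s \<otimes>\<^bsub>A\<^esub> (x \<ominus>\<^bsub>A\<^esub> \<one>\<^bsub>A\<^esub>) \<and> \<epsilon> s = [m] \<cdot> \<one>"
proof (induction m)
  case 0
  show ?case by (rule bexI[of _ "\<zero>\<^bsub>A\<^esub>"]) (simp_all add: a_minus_def A.M.r_neg)
next
  case (Suc m)
  then obtain s where s [simp]: "s \<in> carrier A" and
    eq: "x [^]\<^bsub>A\<^esub> m \<ominus>\<^bsub>A\<^esub> \<one>\<^bsub>A\<^esub> = s \<otimes>\<^bsub>A\<^esub> (x \<ominus>\<^bsub>A\<^esub> \<one>\<^bsub>A\<^esub>)" and \<epsilon>s: "\<epsilon> s = [m] \<cdot> \<one>" by blast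
  show ?case
  proof (intro bexI conjI)
    let ?t = "x [^]\<^bsub>A\<^esub> m"
    have "(s \<oplus>\<^bsub>A\<^esub> ?t) \<otimes>\<^bsub>A\<^esub> (x \<ominus>\<^bsub>A\<^esub> \<one>\<^bsub>A\<^esub>) = (?t \<ominus>\<^bsub>A\<^esub> \<one>\<^bsub>A\<^esub>) \<oplus>\<^bsub>A\<^esub> ?t \<otimes>\<^bsub>A\<^esub> (x \<ominus>\<^bsub>A\<^esub> \<one>\<^bsub>A\<^esub>)"
      by (simp add: A.l_distr eq)
    also have "\<dots> = ?t \<otimes>\<^bsub>A\<^esub> x \<ominus>\<^bsub>A\<^esub> \<one>\<^bsub>A\<^esub>"
      using A.minus_add_minus[of ?t "\<one>\<^bsub>A\<^esub>" "?t \<otimes>\<^bsub>A\<^esub> x"] by (simp add: a_minus_def A.r_distr A.r_minus)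
    finally show "x [^]\<^bsub>A\<^esub> Suc m \<ominus>\<^bsub>A\<^esub> \<one>\<^bsub>A\<^esub> = (s \<oplus>\<^bsub>A\<^esub> ?t) \<otimes>\<^bsub>A\<^esub> (x \<ominus>\<^bsub>A\<^esub> \<one>\<^bsub>A\<^esub>)" by simp
    show "\<epsilon> (s \<oplus>\<^bsub>A\<^esub> ?t) = [Suc m] \<cdot> \<one>"
      using assms(2) by (simp add: \<epsilon>s augmentation_pow)
  qed simp
qed

definition central_generator :: "('g \<Rightarrow> 'r) \<Rightarrow> bool"
  where "central_generator w \<longleftrightarrow> w \<in> carrier A \<and> \<epsilon> w = \<zero> \<and>
    (\<forall>b\<in>carrier A. b \<otimes>\<^bsub>A\<^esub> w = w \<otimes>\<^bsub>A\<^esub> b) \<and>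
    (\<forall>f\<in>carrier A. \<epsilon> f = \<zero> \<longrightarrow> (\<exists>a\<in>carrier A. f = a \<otimes>\<^bsub>A\<^esub> w))"

lemma augmentation_generated:
  assumes "central_generator w" "f \<in> carrier A" "\<epsilon> f = \<zero>"
  obtains a where "a \<in> carrier A" "f = a \<otimes>\<^bsub>A\<^esub> w"
  using assms unfolding central_generator_def by blast

end

section \<open>Free modules and quotient algebras\<close>

text \<open>Finiteness of \<open>B\<close> makes the finite support condition in \<^const>\<open>free_module\<close> vacuous.\<close>

lemma free_module_module:
  assumes "cring R" "finite B"
  shows "module R (free_module R B)"
proof -
  interpret R: cring R by fact
  have F: "carrier (free_module R B) = B \<rightarrow>\<^sub>E carrier R"
    using assms(2) by (auto simp: free_module_def)
  have ext: "f = g" if "f \<in> B \<rightarrow>\<^sub>E carrier R" "g \<in> B \<rightarrow>\<^sub>E carrier R" "\<And>x. x \<in> B \<Longrightarrow> f x = g x" for f g :: "'c \<Rightarrow> 'a"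
    using that by (rule PiE_ext)
  show ?thesis
  proof (rule moduleI[OF assms(1) abelian_groupI])
    fix f assume f: "f \<in> carrier (free_module R B)"
    show "\<exists>g\<in>carrier (free_module R B). g \<oplus>\<^bsub>free_module R B\<^esub> f = \<zero>\<^bsub>free_module R B\<^esub>"
    proof (rule bexI)
      show "(\<lambda>x\<in>B. \<ominus>\<^bsub>R\<^esub> f x) \<in> carrier (free_module R B)" using f unfolding F by auto
      show "(\<lambda>x\<in>B. \<ominus>\<^bsub>R\<^esub> f x) \<oplus>\<^bsub>free_module R B\<^esub> f = \<zero>\<^bsub>free_module R B\<^esub>"
        using f unfolding F by (auto simp: free_module_def R.l_neg PiE_iff)
    qed
  qed (unfold F, auto simp: free_module_def R.a_ac R.l_distr R.r_distr R.m_assoc PiE_iff extensional_def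
        intro!: ext)
qed

lemma (in module) free_on_finite_basis:
  assumes fin: "finite B" and B: "B \<subseteq> carrier M"
    and span: "\<And>x. x \<in> carrier M \<Longrightarrow> \<exists>c\<in>B \<rightarrow>\<^sub>E carrier R. x = (\<Oplus>\<^bsub>M\<^esub>b\<in>B. c b \<odot>\<^bsub>M\<^esub> b)"
    and indep: "\<And>c d. c \<in> B \<rightarrow>\<^sub>E carrier R \<Longrightarrow> d \<in> B \<rightarrow>\<^sub>E carrier R \<Longrightarrow>
      (\<Oplus>\<^bsub>M\<^esub>b\<in>B. c b \<odot>\<^bsub>M\<^esub> b) = (\<Oplus>\<^bsub>M\<^esub>b\<in>B. d b \<odot>\<^bsub>M\<^esub> b) \<Longrightarrow> c = d"
  shows "finitely_generated_module R M" "projective_module R M"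
proof -
  show "finitely_generated_module R M"
    unfolding finitely_generated_module_def
  proof (intro exI conjI ballI)
    fix x assume "x \<in> carrier M"
    then obtain c where "c \<in> B \<rightarrow>\<^sub>E carrier R" "x = (\<Oplus>\<^bsub>M\<^esub>b\<in>B. c b \<odot>\<^bsub>M\<^esub> b)" using span by blast
    then show "\<exists>c\<in>B \<rightarrow> carrier R. x = (\<Oplus>\<^bsub>M\<^esub>b\<in>B. c b \<odot>\<^bsub>M\<^esub> b)" by (auto simp: PiE_def)
  qed (use fin B in auto)
  define F where "F = free_module R B"
  have carrier_F: "carrier F = B \<rightarrow>\<^sub>E carrier R"
    using fin by (auto simp: F_def free_module_def)
  interpret F: module R F
    unfolding F_def by (rule free_module_module[OF R.is_cring fin])
  have F_zero: "\<zero>\<^bsub>F\<^esub> \<in> carrier F" by simp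
  define lin where "lin c = (\<Oplus>\<^bsub>M\<^esub>b\<in>B. c b \<odot>\<^bsub>M\<^esub> b)" for c
  have term_closed: "c b \<odot>\<^bsub>M\<^esub> b \<in> carrier M" if "c \<in> carrier F" "b \<in> B" for c b
    using that B by (auto simp: carrier_F)
  have lin_closed: "lin c \<in> carrier M" if "c \<in> carrier F" for c
    unfolding lin_def using term_closed[OF that] by (intro M.finsum_closed) auto
  have bij: "bij_betw lin (carrier F) (carrier M)"
    unfolding bij_betw_def
  proof
    show "inj_on lin (carrier F)"
      using indep by (auto intro!: inj_onI simp: lin_def carrier_F)
    show "lin ` carrier F = carrier M"
      using lin_closed span unfolding lin_def carrier_F by blast
  qed
  have lin_add: "lin (c \<oplus>\<^bsub>F\<^esub> d) = lin c \<oplus>\<^bsub>M\<^esub> lin d" if "c \<in> carrier F" "d \<in> carrier F" for c d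
  proof -
    have "lin c \<oplus>\<^bsub>M\<^esub> lin d = (\<Oplus>\<^bsub>M\<^esub>b\<in>B. c b \<odot>\<^bsub>M\<^esub> b \<oplus>\<^bsub>M\<^esub> d b \<odot>\<^bsub>M\<^esub> b)"
      unfolding lin_def using term_closed that by (intro M.finsum_addf[symmetric]) auto
    also have "\<dots> = lin (c \<oplus>\<^bsub>F\<^esub> d)"
      unfolding lin_def
    proof (intro M.finsum_cong')
      fix b assume b: "b \<in> B"
      then have "c b \<in> carrier R" "d b \<in> carrier R" "b \<in> carrier M" using that B by (auto simp: carrier_F)
      then show "c b \<odot>\<^bsub>M\<^esub> b \<oplus>\<^bsub>M\<^esub> d b \<odot>\<^bsub>M\<^esub> b = (c \<oplus>\<^bsub>F\<^esub> d) b \<odot>\<^bsub>M\<^esub> b"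
        using b by (simp add: F_def free_module_def smult_l_distr)
    qed (use that in \<open>auto intro!: term_closed\<close>)
    finally show ?thesis by simp
  qed
  have lin_smult: "lin (r \<odot>\<^bsub>F\<^esub> c) = r \<odot>\<^bsub>M\<^esub> lin c" if "r \<in> carrier R" "c \<in> carrier F" for r c
  proof -
    have "r \<odot>\<^bsub>M\<^esub> lin c = (\<Oplus>\<^bsub>M\<^esub>b\<in>B. r \<odot>\<^bsub>M\<^esub> (c b \<odot>\<^bsub>M\<^esub> b))"
      unfolding lin_def using term_closed that by (intro finsum_smult_ldistr fin) auto
    also have "\<dots> = lin (r \<odot>\<^bsub>F\<^esub> c)"
      unfolding lin_def
    proof (intro M.finsum_cong')
      fix b assume b: "b \<in> B"
      then have "c b \<in> carrier R" "b \<in> carrier M" using that B by (auto simp: carrier_F)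
      then show "r \<odot>\<^bsub>M\<^esub> (c b \<odot>\<^bsub>M\<^esub> b) = (r \<odot>\<^bsub>F\<^esub> c) b \<odot>\<^bsub>M\<^esub> b"
        using b that by (simp add: F_def free_module_def smult_assoc1)
    qed (use that in \<open>auto intro!: term_closed\<close>)
    finally show ?thesis by simp
  qed
  define coord where "coord = the_inv_into (carrier F) lin"
  have inj: "inj_on lin (carrier F)" using bij by (rule bij_betw_imp_inj_on)
  have bij': "bij_betw coord (carrier M) (carrier F)"
    unfolding coord_def by (rule bij_betw_the_inv_into[OF bij])
  have coord_closed: "coord x \<in> carrier F" if "x \<in> carrier M" for x
    using bij' that by (rule bij_betw_apply)
  have coord_lin: "coord (lin c) = c" if "c \<in> carrier F" for c
    unfolding coord_def using inj that by (rule the_inv_into_f_f)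
  have lin_coord: "lin (coord x) = x" if "x \<in> carrier M" for x
    unfolding coord_def using bij that by (rule f_the_inv_into_f_bij_betw)
  have "coord \<in> module_iso R M F"
    unfolding module_iso_def module_hom_def
  proof (intro CollectI conjI ballI)
    show "coord \<in> carrier M \<rightarrow> carrier F" using coord_closed by blast
    show "bij_betw coord (carrier M) (carrier F)" by (rule bij')
    fix x assume x: "x \<in> carrier M"
    show "coord (x \<oplus>\<^bsub>M\<^esub> y) = coord x \<oplus>\<^bsub>F\<^esub> coord y" if "y \<in> carrier M" for y
      using coord_lin[of "coord x \<oplus>\<^bsub>F\<^esub> coord y"] lin_add[of "coord x" "coord y"] x that
      by (simp add: coord_closed lin_coord)
  next
    fix r x assume "r \<in> carrier R" "x \<in> carrier M"
    then show "coord (r \<odot>\<^bsub>M\<^esub> x) = r \<odot>\<^bsub>F\<^esub> coord x"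
      using coord_lin[of "r \<odot>\<^bsub>F\<^esub> coord x"] lin_smult[of r "coord x"]
      by (simp add: coord_closed lin_coord)
  qed
  then have iso: "module_iso R M (F\<lparr>carrier := carrier F\<rparr>) \<noteq> {}" by auto
  have sub0: "submodule {\<zero>\<^bsub>F\<^esub>} R F" by (rule F.submoduleI) auto
  have sum: "carrier F <+>\<^bsub>F\<^esub> {\<zero>\<^bsub>F\<^esub>} = carrier F"
    by (auto simp: set_add_def')
  have int: "carrier F \<inter> {\<zero>\<^bsub>F\<^esub>} = {\<zero>\<^bsub>F\<^esub>}" by simp
  show "projective_module R M"
    unfolding projective_module_def Let_def
    by (rule exI[of _ B], rule exI[of _ "carrier F"], rule exI[of _ "{\<zero>\<^bsub>F\<^esub>}"], fold F_def,
        intro conjI F.carrier_is_submodule sub0 int sum iso)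
qed

text \<open>An ideal of the ring \<open>A\<close> is automatically stable under scalars, since \<open>r \<odot> a = (r \<odot> 1) \<otimes> a\<close>; this
  makes the scalar multiplication on cosets well defined.\<close>

locale algebra_quotient = A: assoc_algebra R A + I: ideal I A
  for R :: "('r, 'b) ring_scheme" (structure) and A :: "('r, 'a, 's) module_scheme" and I
begin

abbreviation Q :: "('r, 'a set) module" where "Q \<equiv> quotient_algebra A I"
abbreviation q :: "'a \<Rightarrow> 'a set" where "q a \<equiv> I +>\<^bsub>A\<^esub> a"

lemma q_eq_iff: "a \<in> carrier A \<Longrightarrow> b \<in> carrier A \<Longrightarrow> q a = q b \<longleftrightarrow> a \<ominus>\<^bsub>A\<^esub> b \<in> I"
  using A.quotient_eq_iff_same_a_r_cos[OF I.is_ideal] by simp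

lemma carrier_Q: "carrier Q = q ` carrier A"
  by (auto simp: quotient_algebra_def FactRing_def A_RCOSETS_def RCOSETS_def a_r_coset_def)

lemma q_closed [simp, intro]: "a \<in> carrier A \<Longrightarrow> q a \<in> carrier Q"
  by (simp add: carrier_Q)

lemma q_add [simp]: "a \<in> carrier A \<Longrightarrow> b \<in> carrier A \<Longrightarrow> q a \<oplus>\<^bsub>Q\<^esub> q b = q (a \<oplus>\<^bsub>A\<^esub> b)"
  by (simp add: quotient_algebra_def FactRing_def I.a_rcos_sum)

lemma q_mult [simp]: "a \<in> carrier A \<Longrightarrow> b \<in> carrier A \<Longrightarrow> q a \<otimes>\<^bsub>Q\<^esub> q b = q (a \<otimes>\<^bsub>A\<^esub> b)"
  by (simp add: quotient_algebra_def FactRing_def I.rcoset_mult_add)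

lemma q_one: "\<one>\<^bsub>Q\<^esub> = q \<one>\<^bsub>A\<^esub>"
  by (simp add: quotient_algebra_def FactRing_def)

lemma q_zero: "\<zero>\<^bsub>Q\<^esub> = q \<zero>\<^bsub>A\<^esub>"
  by (simp add: quotient_algebra_def FactRing_def I.a_subset)

lemma q_smult [simp]:
  assumes r [simp]: "r \<in> carrier R" and a [simp]: "a \<in> carrier A"
  shows "r \<odot>\<^bsub>Q\<^esub> q a = q (r \<odot>\<^bsub>A\<^esub> a)"
proof -
  have "q (r \<odot>\<^bsub>A\<^esub> b) = q (r \<odot>\<^bsub>A\<^esub> a)" if b: "b \<in> q a" for b
  proof -
    have bA [simp]: "b \<in> carrier A" using b A.a_r_coset_subset_G[OF I.a_subset a] by blast
    have "q b = q a" using A.a_repr_independence[OF b a I.a_subgroup] by simp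
    then have "b \<ominus>\<^bsub>A\<^esub> a \<in> I" by (simp add: q_eq_iff)
    then have "(r \<odot>\<^bsub>A\<^esub> \<one>\<^bsub>A\<^esub>) \<otimes>\<^bsub>A\<^esub> (b \<ominus>\<^bsub>A\<^esub> a) \<in> I" by (intro I.I_l_closed) auto
    also have "(r \<odot>\<^bsub>A\<^esub> \<one>\<^bsub>A\<^esub>) \<otimes>\<^bsub>A\<^esub> (b \<ominus>\<^bsub>A\<^esub> a) = r \<odot>\<^bsub>A\<^esub> b \<ominus>\<^bsub>A\<^esub> r \<odot>\<^bsub>A\<^esub> a"
      by (simp add: A.smult_mult_left a_minus_def A.smult_r_distr A.smult_r_minus)
    finally show ?thesis by (simp add: q_eq_iff)
  qed
  moreover have "a \<in> q a" by (rule I.a_rcos_self) simp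
  ultimately have "(\<Union>b\<in>q a. q (r \<odot>\<^bsub>A\<^esub> b)) = q (r \<odot>\<^bsub>A\<^esub> a)" by blast
  then show ?thesis by (simp add: quotient_algebra_def)
qed

lemma quotient_assoc_algebra: "assoc_algebra R Q"
proof -
  have ab: "abelian_group Q"
  proof (rule abelian_groupI)
    fix C assume "C \<in> carrier Q"
    then obtain a where "a \<in> carrier A" "C = q a" by (auto simp: carrier_Q)
    then show "\<exists>D\<in>carrier Q. D \<oplus>\<^bsub>Q\<^esub> C = \<zero>\<^bsub>Q\<^esub>"
      by (intro bexI[of _ "q (\<ominus>\<^bsub>A\<^esub> a)"]) (simp_all add: q_zero A.M.l_neg)
  qed (auto simp: carrier_Q q_zero A.M.a_ac)
  have "ring Q"
  proof (rule ringI[OF ab])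
    show "monoid Q" by (rule monoidI) (auto simp: carrier_Q q_one A.m_assoc)
  qed (auto simp: carrier_Q A.l_distr A.r_distr)
  then show ?thesis
    by (intro assoc_algebra.intro assoc_algebra_axioms.intro moduleI A.R.is_cring ab)
      (auto simp: carrier_Q A.smult_l_distr A.smult_r_distr A.smult_assoc1 A.smult_mult_left
        A.smult_mult_right)
qed

sublocale Q: assoc_algebra R Q by (rule quotient_assoc_algebra)

lemma q_finsum:
  assumes "finite K" "\<And>i. i \<in> K \<Longrightarrow> F i \<in> carrier A"
  shows "(\<Oplus>\<^bsub>Q\<^esub>i\<in>K. q (F i)) = q (\<Oplus>\<^bsub>A\<^esub>i\<in>K. F i)"
  using assms
proof (induction K rule: finite_induct)
  case (insert i K)
  then have "(\<Oplus>\<^bsub>Q\<^esub>i\<in>insert i K. q (F i)) = q (F i) \<oplus>\<^bsub>Q\<^esub> (\<Oplus>\<^bsub>Q\<^esub>i\<in>K. q (F i))"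
    by (intro Q.M.finsum_insert) auto
  moreover have "(\<Oplus>\<^bsub>A\<^esub>i\<in>insert i K. F i) = F i \<oplus>\<^bsub>A\<^esub> (\<Oplus>\<^bsub>A\<^esub>i\<in>K. F i)"
    using insert by (intro A.M.finsum_insert) auto
  ultimately show ?case using insert by (auto simp: A.M.finsum_closed)
qed (simp add: q_zero)

end

section \<open>Symmetrizing forms and central generators\<close>

context finite_group_ring
begin

abbreviation J :: "('g \<Rightarrow> 'r) set"
  where "J \<equiv> scalar_multiples R A (\<Oplus>\<^bsub>A\<^esub>x\<in>carrier G. \<delta> x)"

lemma group_sum_coeff [simp]: "y \<in> carrier G \<Longrightarrow> (\<Oplus>\<^bsub>A\<^esub>x\<in>carrier G. \<delta> x) y = \<one>"
  by (subst finsum_coeff, simp, simp, simp, subst R.finsum_single[where a = y]) (auto simp: group_elt_coeff)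

text \<open>The ideal \<open>J\<close> consists of the constant functions on \<open>G\<close>.\<close>

lemma mem_J_iff: "f \<in> J \<longleftrightarrow> f \<in> carrier A \<and> (\<forall>x\<in>carrier G. f x = f \<one>\<^bsub>G\<^esub>)"
proof
  have z: "(\<Oplus>\<^bsub>A\<^esub>x\<in>carrier G. \<delta> x) \<in> carrier A" by (intro A.M.finsum_closed) auto
  show "f \<in> carrier A \<and> (\<forall>x\<in>carrier G. f x = f \<one>\<^bsub>G\<^esub>)" if "f \<in> J"
    using that z by (auto simp: scalar_multiples_def)
  assume f: "f \<in> carrier A \<and> (\<forall>x\<in>carrier G. f x = f \<one>\<^bsub>G\<^esub>)"
  then have fA: "f \<in> carrier A" and const: "\<And>x. x \<in> carrier G \<Longrightarrow> f x = f \<one>\<^bsub>G\<^esub>" by blast+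
  have f1: "f \<one>\<^bsub>G\<^esub> \<in> carrier R" using fA by simp
  have "f = f \<one>\<^bsub>G\<^esub> \<odot>\<^bsub>A\<^esub> (\<Oplus>\<^bsub>A\<^esub>x\<in>carrier G. \<delta> x)"
  proof (rule A_eqI[OF fA A.smult_closed[OF f1 z]])
    fix x assume x: "x \<in> carrier G"
    show "f x = (f \<one>\<^bsub>G\<^esub> \<odot>\<^bsub>A\<^esub> (\<Oplus>\<^bsub>A\<^esub>x\<in>carrier G. \<delta> x)) x"
      using x f1 by (subst const[OF x]) simp
  qed
  then show "f \<in> J"
    unfolding scalar_multiples_def by (intro CollectI exI[of _ "f \<one>\<^bsub>G\<^esub>"] conjI f1)
qed

lemma J_closed: "f \<in> J \<Longrightarrow> f \<in> carrier A"
  and J_const: "f \<in> J \<Longrightarrow> x \<in> carrier G \<Longrightarrow> f x = f \<one>\<^bsub>G\<^esub>"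
  unfolding mem_J_iff by blast+

lemma J_memI: "f \<in> carrier A \<Longrightarrow> (\<And>x. x \<in> carrier G \<Longrightarrow> f x = f \<one>\<^bsub>G\<^esub>) \<Longrightarrow> f \<in> J"
  unfolding mem_J_iff by blast

lemma mult_coeff_const:
  assumes [simp]: "k \<in> J" "u \<in> carrier A"
  shows "k \<otimes>\<^bsub>A\<^esub> u = (\<lambda>x\<in>carrier G. k \<one>\<^bsub>G\<^esub> \<otimes> \<epsilon> u)"
    and "u \<otimes>\<^bsub>A\<^esub> k = (\<lambda>x\<in>carrier G. \<epsilon> u \<otimes> k \<one>\<^bsub>G\<^esub>)"
proof -
  note [simp] = J_closed[OF assms(1)] and k = J_const[OF assms(1)]
  show "k \<otimes>\<^bsub>A\<^esub> u = (\<lambda>x\<in>carrier G. k \<one>\<^bsub>G\<^esub> \<otimes> \<epsilon> u)"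
  proof (rule A_eqI)
    fix x assume x [simp]: "x \<in> carrier G"
    have "(k \<otimes>\<^bsub>A\<^esub> u) x = (\<Oplus>y\<in>carrier G. k (x \<otimes>\<^bsub>G\<^esub> inv\<^bsub>G\<^esub> y) \<otimes> u (inv\<^bsub>G\<^esub> (x \<otimes>\<^bsub>G\<^esub> inv\<^bsub>G\<^esub> y) \<otimes>\<^bsub>G\<^esub> x))"
      unfolding mult_coeff[OF x] by (rule finsum_translate_inv[symmetric]) auto
    also have "\<dots> = (\<Oplus>y\<in>carrier G. k \<one>\<^bsub>G\<^esub> \<otimes> u y)"
      by (intro R.finsum_cong') (auto simp: G.inv_mult_group G.m_assoc k[of "x \<otimes>\<^bsub>G\<^esub> inv\<^bsub>G\<^esub> _"])
    finally show "(k \<otimes>\<^bsub>A\<^esub> u) x = (\<lambda>x\<in>carrier G. k \<one>\<^bsub>G\<^esub> \<otimes> \<epsilon> u) x"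
      by (simp add: augmentation_def R.finsum_rdistr Pi_def)
  qed auto
  show "u \<otimes>\<^bsub>A\<^esub> k = (\<lambda>x\<in>carrier G. \<epsilon> u \<otimes> k \<one>\<^bsub>G\<^esub>)"
  proof (rule A_eqI)
    fix x assume x [simp]: "x \<in> carrier G"
    have "(u \<otimes>\<^bsub>A\<^esub> k) x = (\<Oplus>y\<in>carrier G. u y \<otimes> k \<one>\<^bsub>G\<^esub>)"
      unfolding mult_coeff[OF x] by (intro R.finsum_cong') (auto simp: k[of "inv\<^bsub>G\<^esub> _ \<otimes>\<^bsub>G\<^esub> x"])
    then show "(u \<otimes>\<^bsub>A\<^esub> k) x = (\<lambda>x\<in>carrier G. \<epsilon> u \<otimes> k \<one>\<^bsub>G\<^esub>) x"
      by (simp add: augmentation_def R.finsum_ldistr Pi_def)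
  qed auto
qed

lemma J_ideal: "ideal J A"
proof (rule idealI[OF group_algebra_ring])
  show "subgroup J (add_monoid A)"
  proof (rule A.M.add.subgroupI)
    have "\<zero>\<^bsub>A\<^esub> \<in> J" by (rule J_memI) simp_all
    then show "J \<noteq> {}" by blast
    show "J \<subseteq> carrier A" using J_closed by blast
    fix k l assume k: "k \<in> J" and l: "l \<in> J"
    note [simp] = J_closed[OF k] J_closed[OF l]
    show "\<ominus>\<^bsub>A\<^esub> k \<in> J"
    proof (rule J_memI)
      fix x assume x: "x \<in> carrier G"
      show "(\<ominus>\<^bsub>A\<^esub> k) x = (\<ominus>\<^bsub>A\<^esub> k) \<one>\<^bsub>G\<^esub>" using x J_const[OF k x] by simp
    qed simp
    show "k \<oplus>\<^bsub>A\<^esub> l \<in> J"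
    proof (rule J_memI)
      fix x assume x: "x \<in> carrier G"
      show "(k \<oplus>\<^bsub>A\<^esub> l) x = (k \<oplus>\<^bsub>A\<^esub> l) \<one>\<^bsub>G\<^esub>" using x J_const[OF k x] J_const[OF l x] by simp
    qed simp
  qed
  fix k u assume k: "k \<in> J" and u [simp]: "u \<in> carrier A"
  note [simp] = J_closed[OF k]
  show "u \<otimes>\<^bsub>A\<^esub> k \<in> J" by (rule J_memI) (auto simp: mult_coeff_const(2)[OF k u])
  show "k \<otimes>\<^bsub>A\<^esub> u \<in> J" by (rule J_memI) (auto simp: mult_coeff_const(1)[OF k u])
qed

sublocale quot: algebra_quotient R A J
  by (intro algebra_quotient.intro J_ideal group_algebra_assoc_algebra)

abbreviation Q where "Q \<equiv> quot.Q"
abbreviation q where "q \<equiv> quot.q"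

lemma q_group_sum: "q (\<Oplus>\<^bsub>A\<^esub>x\<in>carrier G. \<delta> x) = \<zero>\<^bsub>Q\<^esub>"
proof -
  have z: "(\<Oplus>\<^bsub>A\<^esub>x\<in>carrier G. \<delta> x) \<in> carrier A" by (intro A.M.finsum_closed) auto
  then show ?thesis
    by (simp add: quot.q_zero quot.q_eq_iff) (rule J_memI, simp_all)
qed

lemma trace_commute:
  assumes [simp]: "f \<in> carrier A" "g \<in> carrier A"
  shows "(f \<otimes>\<^bsub>A\<^esub> g) \<one>\<^bsub>G\<^esub> = (g \<otimes>\<^bsub>A\<^esub> f) \<one>\<^bsub>G\<^esub>"
proof -
  have "(g \<otimes>\<^bsub>A\<^esub> f) \<one>\<^bsub>G\<^esub> = (\<Oplus>y\<in>carrier G. g (\<one>\<^bsub>G\<^esub> \<otimes>\<^bsub>G\<^esub> inv\<^bsub>G\<^esub> y) \<otimes> f (inv\<^bsub>G\<^esub> (\<one>\<^bsub>G\<^esub> \<otimes>\<^bsub>G\<^esub> inv\<^bsub>G\<^esub> y) \<otimes>\<^bsub>G\<^esub> \<one>\<^bsub>G\<^esub>))"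
    unfolding mult_coeff[OF G.one_closed] by (rule finsum_translate_inv[symmetric]) auto
  also have "\<dots> = (f \<otimes>\<^bsub>A\<^esub> g) \<one>\<^bsub>G\<^esub>"
    unfolding mult_coeff[OF G.one_closed] by (intro R.finsum_cong') (auto simp: R.m_comm)
  finally show ?thesis by simp
qed

text \<open>Pairing with \<open>x\<^sup>-\<^sup>1\<close> extracts the coefficient at \<open>x\<close>.\<close>

lemma trace_nondegenerate:
  assumes [simp]: "u \<in> carrier A" "v \<in> carrier A"
    and eq: "\<And>f. f \<in> carrier A \<Longrightarrow> (f \<otimes>\<^bsub>A\<^esub> u) \<one>\<^bsub>G\<^esub> = (f \<otimes>\<^bsub>A\<^esub> v) \<one>\<^bsub>G\<^esub>"
  shows "u = v"
proof (rule A_eqI)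
  fix x assume [simp]: "x \<in> carrier G"
  show "u x = v x" using eq[of "\<delta> (inv\<^bsub>G\<^esub> x)"] by (simp add: group_elt_mult_coeff)
qed auto

text \<open>The linear form \<open>f \<mapsto> (f u)(1)\<close>, transported to cosets by a choice of representatives. It depends on the
  choice unless \<open>\<epsilon> u = 0\<close>; see \<open>functional_q\<close>.\<close>

definition functional :: "('g \<Rightarrow> 'r) \<Rightarrow> ('g \<Rightarrow> 'r) set \<Rightarrow> 'r"
  where "functional u = (\<lambda>C\<in>carrier Q. ((SOME f. f \<in> carrier A \<and> q f = C) \<otimes>\<^bsub>A\<^esub> u) \<one>\<^bsub>G\<^esub>)"

lemma functional_extensional [simp]: "functional u \<in> extensional (carrier Q)"
  by (simp add: functional_def)

lemma functional_q:
  assumes u [simp]: "u \<in> carrier A" and \<epsilon>u: "\<epsilon> u = \<zero>" and f [simp]: "f \<in> carrier A"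
  shows "functional u (q f) = (f \<otimes>\<^bsub>A\<^esub> u) \<one>\<^bsub>G\<^esub>"
proof -
  define g where "g = (SOME g. g \<in> carrier A \<and> q g = q f)"
  have "g \<in> carrier A \<and> q g = q f" unfolding g_def by (rule someI[of _ f]) simp
  then have g [simp]: "g \<in> carrier A" and gf: "g \<ominus>\<^bsub>A\<^esub> f \<in> J" by (auto simp: quot.q_eq_iff)
  have "(g \<ominus>\<^bsub>A\<^esub> f) \<otimes>\<^bsub>A\<^esub> u = g \<otimes>\<^bsub>A\<^esub> u \<ominus>\<^bsub>A\<^esub> f \<otimes>\<^bsub>A\<^esub> u"
    by (simp add: a_minus_def A.l_distr A.l_minus)
  moreover have "((g \<ominus>\<^bsub>A\<^esub> f) \<otimes>\<^bsub>A\<^esub> u) \<one>\<^bsub>G\<^esub> = \<zero>"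
    unfolding mult_coeff_const(1)[OF gf u] by (simp add: \<epsilon>u)
  ultimately have "(g \<otimes>\<^bsub>A\<^esub> u) \<one>\<^bsub>G\<^esub> = (f \<otimes>\<^bsub>A\<^esub> u) \<one>\<^bsub>G\<^esub>" by simp
  then show ?thesis by (simp add: functional_def g_def)
qed

lemma functional_dual:
  assumes u [simp]: "u \<in> carrier A" and \<epsilon>u: "\<epsilon> u = \<zero>"
  shows "functional u \<in> carrier (dual_bimodule R Q)"
  by (auto simp: dual_bimodule_def module_hom_def ring_as_module_def quot.carrier_Q functional_q \<epsilon>u
      A.l_distr A.smult_mult_left functional_extensional[unfolded quot.carrier_Q])

lemma functional_inj:
  assumes [simp]: "u \<in> carrier A" "v \<in> carrier A" and \<epsilon>: "\<epsilon> u = \<zero>" "\<epsilon> v = \<zero>"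
    and eq: "functional u = functional v"
  shows "u = v"
proof (rule trace_nondegenerate)
  fix f assume "f \<in> carrier A"
  then show "(f \<otimes>\<^bsub>A\<^esub> u) \<one>\<^bsub>G\<^esub> = (f \<otimes>\<^bsub>A\<^esub> v) \<one>\<^bsub>G\<^esub>"
    using functional_q[of u f] functional_q[of v f] \<epsilon> eq by simp
qed auto

lemma functional_eqI:
  assumes "u \<in> carrier A" "\<epsilon> u = \<zero>" "\<psi> \<in> extensional (carrier Q)"
    and "\<And>f. f \<in> carrier A \<Longrightarrow> \<psi> (q f) = (f \<otimes>\<^bsub>A\<^esub> u) \<one>\<^bsub>G\<^esub>"
  shows "\<psi> = functional u"
proof (rule extensionalityI[OF assms(3)])
  show "functional u \<in> extensional (carrier Q)" by simp
  fix C assume "C \<in> carrier Q"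
  then obtain f where f: "f \<in> carrier A" "C = q f" by (auto simp: quot.carrier_Q)
  show "\<psi> C = functional u C" unfolding f(2) using f assms by (simp add: functional_q)
qed

lemma linear_functional_expansion:
  assumes L: "\<And>f. f \<in> carrier A \<Longrightarrow> L f \<in> carrier R"
    and add: "\<And>f g. f \<in> carrier A \<Longrightarrow> g \<in> carrier A \<Longrightarrow> L (f \<oplus>\<^bsub>A\<^esub> g) = L f \<oplus> L g"
    and smult: "\<And>r f. r \<in> carrier R \<Longrightarrow> f \<in> carrier A \<Longrightarrow> L (r \<odot>\<^bsub>A\<^esub> f) = r \<otimes> L f"
    and f [simp]: "f \<in> carrier A"
  shows "L f = (\<Oplus>x\<in>carrier G. f x \<otimes> L (\<delta> x))"
proof -
  have zero: "L \<zero>\<^bsub>A\<^esub> = \<zero>" using smult[of \<zero> f] L[of f] by simp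
  have "L (\<Oplus>\<^bsub>A\<^esub>x\<in>K. f x \<odot>\<^bsub>A\<^esub> \<delta> x) = (\<Oplus>x\<in>K. f x \<otimes> L (\<delta> x))" if "finite K" "K \<subseteq> carrier G" for K
    using that
  proof (induction K rule: finite_induct)
    case (insert x K)
    have "(\<Oplus>\<^bsub>A\<^esub>x\<in>insert x K. f x \<odot>\<^bsub>A\<^esub> \<delta> x) = f x \<odot>\<^bsub>A\<^esub> \<delta> x \<oplus>\<^bsub>A\<^esub> (\<Oplus>\<^bsub>A\<^esub>x\<in>K. f x \<odot>\<^bsub>A\<^esub> \<delta> x)"
      using insert by (intro A.M.finsum_insert) auto
    moreover have "(\<Oplus>\<^bsub>A\<^esub>x\<in>K. f x \<odot>\<^bsub>A\<^esub> \<delta> x) \<in> carrier A"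
      using insert by (intro A.M.finsum_closed) auto
    moreover have "(\<Oplus>x\<in>insert x K. f x \<otimes> L (\<delta> x)) = f x \<otimes> L (\<delta> x) \<oplus> (\<Oplus>x\<in>K. f x \<otimes> L (\<delta> x))"
      using insert L by (intro R.finsum_insert) auto
    ultimately show ?case using insert by (simp add: add smult)
  qed (simp add: zero)
  from this[of "carrier G"] show ?thesis by (simp add: basis_expansion[OF f, symmetric])
qed

text \<open>The element \<open>u\<close> has the value of \<open>\<psi>\<close> at \<open>x\<^sup>-\<^sup>1\<close> as its coefficient at \<open>x\<close>, and \<open>\<epsilon> u = 0\<close> says that \<open>\<psi>\<close>
  vanishes on the sum of the group elements. Together with \<open>functional_inj\<close> this identifies the dual of the
  quotient with the augmentation ideal.\<close>

lemma dual_functional: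
  assumes \<psi>: "\<psi> \<in> carrier (dual_bimodule R Q)"
  obtains u where "u \<in> carrier A" "\<epsilon> u = \<zero>" "\<psi> = functional u"
proof -
  have ext: "\<psi> \<in> extensional (carrier Q)"
    and hom: "\<psi> \<in> module_hom R Q (ring_as_module R)"
    using \<psi> by (auto simp: dual_bimodule_def)
  have \<psi>_closed [simp]: "\<psi> C \<in> carrier R" if "C \<in> carrier Q" for C
    using hom that by (auto simp: module_hom_def ring_as_module_def)
  have hom_add: "\<forall>C\<in>carrier Q. \<forall>D\<in>carrier Q. \<psi> (C \<oplus>\<^bsub>Q\<^esub> D) = \<psi> C \<oplus> \<psi> D"
    and hom_smult: "\<forall>r\<in>carrier R. \<forall>C\<in>carrier Q. \<psi> (r \<odot>\<^bsub>Q\<^esub> C) = r \<otimes> \<psi> C"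
    using hom by (simp_all add: module_hom_def ring_as_module_def)
  have \<psi>_add: "\<psi> (q (f \<oplus>\<^bsub>A\<^esub> g)) = \<psi> (q f) \<oplus> \<psi> (q g)" if "f \<in> carrier A" "g \<in> carrier A" for f g
    using bspec[OF bspec[OF hom_add, of "q f"], of "q g"] that by simp
  have \<psi>_smult: "\<psi> (q (r \<odot>\<^bsub>A\<^esub> f)) = r \<otimes> \<psi> (q f)" if "r \<in> carrier R" "f \<in> carrier A" for r f
    using bspec[OF bspec[OF hom_smult, of r], of "q f"] that by simp
  have expand: "\<psi> (q f) = (\<Oplus>x\<in>carrier G. f x \<otimes> \<psi> (q (\<delta> x)))" if "f \<in> carrier A" for f
    by (rule linear_functional_expansion[of "\<lambda>f. \<psi> (q f)"]) (simp_all add: \<psi>_add \<psi>_smult that)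
  define u where "u = (\<lambda>x\<in>carrier G. \<psi> (q (\<delta> (inv\<^bsub>G\<^esub> x))))"
  have u [simp]: "u \<in> carrier A" by (auto simp: u_def)
  have rep: "\<psi> (q f) = (f \<otimes>\<^bsub>A\<^esub> u) \<one>\<^bsub>G\<^esub>" if [simp]: "f \<in> carrier A" for f
    unfolding expand[OF that] mult_coeff[OF G.one_closed]
    by (intro R.finsum_cong') (auto simp: u_def)
  let ?z = "\<Oplus>\<^bsub>A\<^esub>x\<in>carrier G. \<delta> x"
  have z [simp]: "?z \<in> carrier A" by (intro A.M.finsum_closed) auto
  have zJ: "?z \<in> J" by (rule J_memI) simp_all
  have "\<epsilon> u = (?z \<otimes>\<^bsub>A\<^esub> u) \<one>\<^bsub>G\<^esub>"
    unfolding mult_coeff_const(1)[OF zJ u] by simp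
  also have "\<dots> = \<psi> (q \<zero>\<^bsub>A\<^esub>)"
    unfolding rep[OF z, symmetric] q_group_sum by (simp add: quot.q_zero)
  also have "\<dots> = \<zero>" using \<psi>_smult[of \<zero> "\<zero>\<^bsub>A\<^esub>"] by simp
  finally have "\<epsilon> u = \<zero>" .
  then show thesis using that functional_eqI[OF u _ ext rep] u by blast
qed

text \<open>Multiplication by \<open>w\<close> has no kernel on the quotient: \<open>k w = 0\<close> gives \<open>k (x - 1) = k b w = k w b = 0\<close>,
  so \<open>k\<close> is invariant under right translations.\<close>

lemma annihilates_generator_imp_mem_J:
  assumes gen: "central_generator w" and k [simp]: "k \<in> carrier A" and kw: "k \<otimes>\<^bsub>A\<^esub> w = \<zero>\<^bsub>A\<^esub>"
  shows "k \<in> J"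
proof -
  have w [simp]: "w \<in> carrier A" and cen: "\<And>b. b \<in> carrier A \<Longrightarrow> b \<otimes>\<^bsub>A\<^esub> w = w \<otimes>\<^bsub>A\<^esub> b"
    using gen by (auto simp: central_generator_def)
  have "k x = k \<one>\<^bsub>G\<^esub>" if x [simp]: "x \<in> carrier G" for x
  proof -
    have "\<epsilon> (\<delta> x \<ominus>\<^bsub>A\<^esub> \<one>\<^bsub>A\<^esub>) = \<zero>" by (simp add: a_minus_def R.r_neg)
    then obtain b where b [simp]: "b \<in> carrier A" and bw: "\<delta> x \<ominus>\<^bsub>A\<^esub> \<one>\<^bsub>A\<^esub> = b \<otimes>\<^bsub>A\<^esub> w"
      using augmentation_generated[OF gen, of "\<delta> x \<ominus>\<^bsub>A\<^esub> \<one>\<^bsub>A\<^esub>"] by auto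
    have "k \<otimes>\<^bsub>A\<^esub> \<delta> x \<ominus>\<^bsub>A\<^esub> k = k \<otimes>\<^bsub>A\<^esub> (\<delta> x \<ominus>\<^bsub>A\<^esub> \<one>\<^bsub>A\<^esub>)"
      by (simp add: a_minus_def A.r_distr A.r_minus)
    also have "\<dots> = (k \<otimes>\<^bsub>A\<^esub> w) \<otimes>\<^bsub>A\<^esub> b" unfolding bw using cen[OF b] by (simp add: A.m_assoc)
    finally have "k \<otimes>\<^bsub>A\<^esub> \<delta> x \<ominus>\<^bsub>A\<^esub> k = \<zero>\<^bsub>A\<^esub>" using kw by simp
    then have "k \<otimes>\<^bsub>A\<^esub> \<delta> x = k" by simp
    then have "(k \<otimes>\<^bsub>A\<^esub> \<delta> x) x = k x" by simp
    then show ?thesis by (simp add: mult_group_elt_coeff)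
  qed
  then show ?thesis by (rule J_memI[OF k])
qed

text \<open>Let \<open>w\<close> represent the image of \<open>1\<close>. Compatibility with the left and the right action expresses the image of
  \<open>a\<close> as the form of \<open>a w\<close> and as the form of \<open>w a\<close>, so \<open>w\<close> is central, and surjectivity says that the multiples
  of \<open>w\<close> exhaust the augmentation ideal.\<close>

lemma bimodule_iso_imp_central_generator:
  assumes "\<Phi> \<in> bimodule_iso R Q (regular_bimodule Q) (dual_bimodule R Q)"
  shows "\<exists>w. central_generator w"
proof -
  have bij: "bij_betw \<Phi> (carrier Q) (carrier (dual_bimodule R Q))"
    using assms by (simp add: bimodule_iso_def module_iso_def regular_bimodule_def)
  have act: "\<forall>C\<in>carrier Q. \<forall>D\<in>carrier (regular_bimodule Q).
      \<Phi> (lact (regular_bimodule Q) C D) = lact (dual_bimodule R Q) C (\<Phi> D) \<and>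
      \<Phi> (ract (regular_bimodule Q) D C) = ract (dual_bimodule R Q) (\<Phi> D) C"
    using assms unfolding bimodule_iso_def by blast
  have lact: "\<Phi> (C \<otimes>\<^bsub>Q\<^esub> D) = (\<lambda>x\<in>carrier Q. \<Phi> D (x \<otimes>\<^bsub>Q\<^esub> C))"
    and ract: "\<Phi> (D \<otimes>\<^bsub>Q\<^esub> C) = (\<lambda>x\<in>carrier Q. \<Phi> D (C \<otimes>\<^bsub>Q\<^esub> x))"
    if "C \<in> carrier Q" "D \<in> carrier Q" for C D
    using bspec[OF bspec[OF act that(1)], of D] that
    by (simp_all add: regular_bimodule_def dual_bimodule_def)
  have "\<Phi> \<one>\<^bsub>Q\<^esub> \<in> carrier (dual_bimodule R Q)" by (rule bij_betw_apply[OF bij]) simp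
  then obtain w where w [simp]: "w \<in> carrier A" and \<epsilon>w: "\<epsilon> w = \<zero>" and \<Phi>1: "\<Phi> \<one>\<^bsub>Q\<^esub> = functional w"
    by (rule dual_functional)
  have left: "\<Phi> (q a) = functional (a \<otimes>\<^bsub>A\<^esub> w)" if a [simp]: "a \<in> carrier A" for a
  proof -
    have "\<Phi> (q a) = (\<lambda>x\<in>carrier Q. functional w (x \<otimes>\<^bsub>Q\<^esub> q a))"
      using lact[of "q a" "\<one>\<^bsub>Q\<^esub>"] \<Phi>1 by simp
    also have "\<dots> = functional (a \<otimes>\<^bsub>A\<^esub> w)"
      by (rule functional_eqI) (simp_all add: \<epsilon>w functional_q A.m_assoc)
    finally show ?thesis .
  qed
  have right: "\<Phi> (q a) = functional (w \<otimes>\<^bsub>A\<^esub> a)" if a [simp]: "a \<in> carrier A" for a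
  proof -
    have "\<Phi> (q a) = (\<lambda>x\<in>carrier Q. functional w (q a \<otimes>\<^bsub>Q\<^esub> x))"
      using ract[of "q a" "\<one>\<^bsub>Q\<^esub>"] \<Phi>1 by simp
    also have "\<dots> = functional (w \<otimes>\<^bsub>A\<^esub> a)"
    proof (rule functional_eqI)
      fix f assume f [simp]: "f \<in> carrier A"
      show "(\<lambda>x\<in>carrier Q. functional w (q a \<otimes>\<^bsub>Q\<^esub> x)) (q f) = (f \<otimes>\<^bsub>A\<^esub> (w \<otimes>\<^bsub>A\<^esub> a)) \<one>\<^bsub>G\<^esub>"
        using trace_commute[of a "f \<otimes>\<^bsub>A\<^esub> w"] by (simp add: functional_q \<epsilon>w A.m_assoc)
    qed (simp_all add: \<epsilon>w)
    finally show ?thesis .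
  qed
  have "central_generator w"
    unfolding central_generator_def
  proof (intro conjI ballI impI w \<epsilon>w)
    fix b assume b [simp]: "b \<in> carrier A"
    show "b \<otimes>\<^bsub>A\<^esub> w = w \<otimes>\<^bsub>A\<^esub> b"
      by (rule functional_inj) (simp_all add: \<epsilon>w left[symmetric] right[symmetric])
  next
    fix f assume f [simp]: "f \<in> carrier A" and \<epsilon>f: "\<epsilon> f = \<zero>"
    have "functional f \<in> \<Phi> ` carrier Q"
      using functional_dual[OF f \<epsilon>f] bij by (simp add: bij_betw_def)
    then obtain a where a: "a \<in> carrier A" "functional f = \<Phi> (q a)" by (auto simp: quot.carrier_Q)
    then have "f = a \<otimes>\<^bsub>A\<^esub> w"
      using functional_inj[of f "a \<otimes>\<^bsub>A\<^esub> w"] \<epsilon>f \<epsilon>w left[OF a(1)] by simp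
    then show "\<exists>a\<in>carrier A. f = a \<otimes>\<^bsub>A\<^esub> w" using a by blast
  qed
  then show ?thesis by blast
qed

text \<open>The relation \<open>z = 0\<close> expresses the image of \<open>1\<close> through the images of the other group elements, which
  form a basis: subtracting the constant function \<open>f(1)\<close> makes the coefficient of \<open>f\<close> at \<open>1\<close> vanish. Over a
  nontrivial ring these images are distinct, so the set of images can serve as the index set of the basis.\<close>

lemma quotient_free:
  assumes nontrivial: "\<one> \<noteq> \<zero>"
  shows "finitely_generated_module R Q" "projective_module R Q"
proof -
  let ?G' = "carrier G - {\<one>\<^bsub>G\<^esub>}"
  let ?B = "(\<lambda>x. q (\<delta> x)) ` ?G'"
  have inj: "inj_on (\<lambda>x. q (\<delta> x)) ?G'"
  proof (rule inj_onI, rule ccontr)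
    fix x y assume x: "x \<in> ?G'" and y: "y \<in> ?G'" and eq: "q (\<delta> x) = q (\<delta> y)" and ne: "x \<noteq> y"
    have "\<delta> x \<ominus>\<^bsub>A\<^esub> \<delta> y \<in> J" using eq by (simp add: quot.q_eq_iff)
    then have "(\<delta> x \<ominus>\<^bsub>A\<^esub> \<delta> y) x = (\<delta> x \<ominus>\<^bsub>A\<^esub> \<delta> y) \<one>\<^bsub>G\<^esub>" using x by (intro J_const) simp_all
    then show False using x y ne nontrivial by (auto simp: group_elt_coeff a_minus_def)
  qed
  define vec where "vec c = (\<lambda>x\<in>carrier G. if x = \<one>\<^bsub>G\<^esub> then \<zero> else c (q (\<delta> x)))" for c
  have vec_coeff: "vec c x = (if x = \<one>\<^bsub>G\<^esub> then \<zero> else c (q (\<delta> x)))" if "x \<in> carrier G" for c x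
    using that by (simp add: vec_def)
  have vec_closed [simp]: "vec c \<in> carrier A" if "c \<in> ?B \<rightarrow>\<^sub>E carrier R" for c
    unfolding vec_def using that by (intro restrict_mem_A) auto
  have lin: "(\<Oplus>\<^bsub>Q\<^esub>b\<in>?B. c b \<odot>\<^bsub>Q\<^esub> b) = q (vec c)" if c: "c \<in> ?B \<rightarrow>\<^sub>E carrier R" for c
  proof -
    have cc [simp]: "c (q (\<delta> x)) \<in> carrier R" if "x \<in> ?G'" for x using c that by auto
    have "(\<Oplus>\<^bsub>Q\<^esub>b\<in>?B. c b \<odot>\<^bsub>Q\<^esub> b) = (\<Oplus>\<^bsub>Q\<^esub>x\<in>?G'. c (q (\<delta> x)) \<odot>\<^bsub>Q\<^esub> q (\<delta> x))"
      using inj by (intro quot.Q.M.finsum_reindex) auto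
    also have "\<dots> = (\<Oplus>\<^bsub>Q\<^esub>x\<in>?G'. q (c (q (\<delta> x)) \<odot>\<^bsub>A\<^esub> \<delta> x))"
      by (intro quot.Q.M.finsum_cong') auto
    also have "\<dots> = q (\<Oplus>\<^bsub>A\<^esub>x\<in>?G'. c (q (\<delta> x)) \<odot>\<^bsub>A\<^esub> \<delta> x)"
      by (intro quot.q_finsum) auto
    also have "(\<Oplus>\<^bsub>A\<^esub>x\<in>?G'. c (q (\<delta> x)) \<odot>\<^bsub>A\<^esub> \<delta> x) = vec c"
    proof (rule A_eqI)
      fix y assume y [simp]: "y \<in> carrier G"
      have "(\<Oplus>x\<in>?G'. c (q (\<delta> x)) \<otimes> \<delta> x y) = vec c y"
      proof (cases "y = \<one>\<^bsub>G\<^esub>")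
        case True
        have "c (q (\<delta> x)) \<otimes> \<delta> x y = \<zero>" if "x \<in> ?G'" for x
          using cc[OF that] that True by (auto simp: group_elt_coeff)
        then have "(\<Oplus>x\<in>?G'. c (q (\<delta> x)) \<otimes> \<delta> x y) = \<zero>"
          by (rule R.add.finprod_one_eqI)
        then show ?thesis using True by (simp add: vec_coeff)
      next
        case False
        then show ?thesis
          by (subst R.finsum_single[where a = y]) (auto simp: vec_coeff group_elt_coeff)
      qed
      then show "(\<Oplus>\<^bsub>A\<^esub>x\<in>?G'. c (q (\<delta> x)) \<odot>\<^bsub>A\<^esub> \<delta> x) y = vec c y"
        by (subst finsum_coeff) auto
    qed (use c in \<open>auto intro!: A.M.finsum_closed\<close>)
    finally show ?thesis .
  qed
  have fin: "finite ?B" by simp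
  have sub: "?B \<subseteq> carrier Q" by auto
  have span: "\<exists>c\<in>?B \<rightarrow>\<^sub>E carrier R. C = (\<Oplus>\<^bsub>Q\<^esub>b\<in>?B. c b \<odot>\<^bsub>Q\<^esub> b)" if CQ: "C \<in> carrier Q" for C
  proof -
    obtain f where f [simp]: "f \<in> carrier A" and C: "C = q f" using CQ by (auto simp: quot.carrier_Q)
    define c where "c = (\<lambda>b\<in>?B. f (the_inv_into ?G' (\<lambda>x. q (\<delta> x)) b) \<ominus> f \<one>\<^bsub>G\<^esub>)"
    have cx: "c (q (\<delta> x)) = f x \<ominus> f \<one>\<^bsub>G\<^esub>" if "x \<in> ?G'" for x
      using that the_inv_into_f_f[OF inj that] by (auto simp: c_def)
    have c: "c \<in> ?B \<rightarrow>\<^sub>E carrier R"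
    proof (rule PiE_I)
      fix b assume "b \<in> ?B"
      then obtain x where "x \<in> ?G'" "b = q (\<delta> x)" by blast
      then show "c b \<in> carrier R" using cx[of x] by simp
    qed (simp add: c_def)
    have "f \<ominus>\<^bsub>A\<^esub> vec c \<in> J"
    proof -
      have val: "(f \<ominus>\<^bsub>A\<^esub> vec c) x = f \<one>\<^bsub>G\<^esub>" if "x \<in> carrier G" for x
      proof (cases "x = \<one>\<^bsub>G\<^esub>")
        case False
        have "(f \<ominus>\<^bsub>A\<^esub> vec c) x = f x \<oplus> \<ominus> (f x \<oplus> \<ominus> f \<one>\<^bsub>G\<^esub>)"
          using that False c cx[of x] by (simp add: vec_coeff a_minus_def)
        then show ?thesis using that by (simp add: R.minus_add R.r_neg2)
      qed (use that c in \<open>simp add: vec_coeff a_minus_def\<close>)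
      show ?thesis using c val by (intro J_memI) simp_all
    qed
    then have "C = q (vec c)" unfolding C using c by (simp add: quot.q_eq_iff)
    then show ?thesis using lin[OF c] c by auto
  qed
  have indep: "c = d" if c: "c \<in> ?B \<rightarrow>\<^sub>E carrier R" and d: "d \<in> ?B \<rightarrow>\<^sub>E carrier R"
    and eq: "(\<Oplus>\<^bsub>Q\<^esub>b\<in>?B. c b \<odot>\<^bsub>Q\<^esub> b) = (\<Oplus>\<^bsub>Q\<^esub>b\<in>?B. d b \<odot>\<^bsub>Q\<^esub> b)" for c d
  proof (rule PiE_ext[OF c d])
    fix b assume "b \<in> ?B"
    then obtain x where x: "x \<in> ?G'" "b = q (\<delta> x)" by blast
    have "vec c \<ominus>\<^bsub>A\<^esub> vec d \<in> J" using eq c d by (simp add: lin quot.q_eq_iff)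
    then have "(vec c \<ominus>\<^bsub>A\<^esub> vec d) x = (vec c \<ominus>\<^bsub>A\<^esub> vec d) \<one>\<^bsub>G\<^esub>" using x by (intro J_const) simp_all
    moreover have "c (q (\<delta> x)) \<in> carrier R" "d (q (\<delta> x)) \<in> carrier R" using c d x by auto
    moreover have "\<zero> \<ominus> \<zero> = \<zero>" by (simp add: a_minus_def)
    ultimately show "c b = d b" using x c d by (simp add: vec_coeff)
  qed
  show "finitely_generated_module R Q" "projective_module R Q"
    using quot.Q.free_on_finite_basis[OF fin sub span indep] by blast+
qed

text \<open>The isomorphism sends the coset of \<open>a\<close> to the form given by \<open>a w\<close>. Compatibility with the right action uses
  both the centrality of \<open>w\<close> and the symmetry of the trace form.\<close>

lemma central_generator_imp_symmetric:
  assumes nontrivial: "\<one> \<noteq> \<zero>" and gen: "central_generator w"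
  shows "symmetric_algebra R Q"
proof -
  have w [simp]: "w \<in> carrier A" and \<epsilon>w: "\<epsilon> w = \<zero>"
    and cen: "\<And>b. b \<in> carrier A \<Longrightarrow> b \<otimes>\<^bsub>A\<^esub> w = w \<otimes>\<^bsub>A\<^esub> b"
    using gen by (auto simp: central_generator_def)
  define \<Phi> where "\<Phi> C = functional ((SOME a. a \<in> carrier A \<and> q a = C) \<otimes>\<^bsub>A\<^esub> w)" for C
  have \<Phi>: "\<Phi> (q a) = functional (a \<otimes>\<^bsub>A\<^esub> w)" if a [simp]: "a \<in> carrier A" for a
  proof -
    define b where "b = (SOME b. b \<in> carrier A \<and> q b = q a)"
    have "b \<in> carrier A \<and> q b = q a" unfolding b_def by (rule someI[of _ a]) simp
    then have b [simp]: "b \<in> carrier A" and ba: "b \<ominus>\<^bsub>A\<^esub> a \<in> J" by (auto simp: quot.q_eq_iff)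
    have "b \<otimes>\<^bsub>A\<^esub> w \<ominus>\<^bsub>A\<^esub> a \<otimes>\<^bsub>A\<^esub> w = (b \<ominus>\<^bsub>A\<^esub> a) \<otimes>\<^bsub>A\<^esub> w"
      by (simp add: a_minus_def A.l_distr A.l_minus)
    also have "\<dots> = \<zero>\<^bsub>A\<^esub>"
      unfolding mult_coeff_const(1)[OF ba w] by (rule A_eqI) (auto simp: \<epsilon>w)
    finally have "b \<otimes>\<^bsub>A\<^esub> w = a \<otimes>\<^bsub>A\<^esub> w" by simp
    then show ?thesis by (simp add: \<Phi>_def b_def)
  qed
  have "\<Phi> \<in> bimodule_iso R Q (regular_bimodule Q) (dual_bimodule R Q)"
    unfolding bimodule_iso_def module_iso_def module_hom_def
  proof (intro CollectI conjI ballI)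
    show "\<Phi> \<in> carrier (regular_bimodule Q) \<rightarrow> carrier (dual_bimodule R Q)"
      by (auto simp: regular_bimodule_def quot.carrier_Q \<Phi> \<epsilon>w intro!: functional_dual)
    show "bij_betw \<Phi> (carrier (regular_bimodule Q)) (carrier (dual_bimodule R Q))"
      unfolding bij_betw_def
    proof
      show "inj_on \<Phi> (carrier (regular_bimodule Q))"
      proof (rule inj_onI)
        fix C D assume "C \<in> carrier (regular_bimodule Q)" "D \<in> carrier (regular_bimodule Q)" and eq: "\<Phi> C = \<Phi> D"
        then obtain a b where a [simp]: "a \<in> carrier A" and C: "C = q a" and b [simp]: "b \<in> carrier A" and D: "D = q b"
          by (auto simp: regular_bimodule_def quot.carrier_Q)
        have "a \<otimes>\<^bsub>A\<^esub> w = b \<otimes>\<^bsub>A\<^esub> w"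
          using eq unfolding C D by (intro functional_inj) (simp_all add: \<Phi> \<epsilon>w)
        then have "(a \<ominus>\<^bsub>A\<^esub> b) \<otimes>\<^bsub>A\<^esub> w = \<zero>\<^bsub>A\<^esub>" by (simp add: a_minus_def A.l_distr A.l_minus A.M.r_neg)
        then have "a \<ominus>\<^bsub>A\<^esub> b \<in> J" by (intro annihilates_generator_imp_mem_J[OF gen]) simp_all
        then show "C = D" unfolding C D by (simp add: quot.q_eq_iff)
      qed
      show "\<Phi> ` carrier (regular_bimodule Q) = carrier (dual_bimodule R Q)"
      proof
        show "\<Phi> ` carrier (regular_bimodule Q) \<subseteq> carrier (dual_bimodule R Q)"
          by (auto simp: regular_bimodule_def quot.carrier_Q \<Phi> \<epsilon>w intro!: functional_dual)
        show "carrier (dual_bimodule R Q) \<subseteq> \<Phi> ` carrier (regular_bimodule Q)"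
        proof
          fix \<psi> assume "\<psi> \<in> carrier (dual_bimodule R Q)"
          then obtain u where u: "u \<in> carrier A" "\<epsilon> u = \<zero>" "\<psi> = functional u" by (rule dual_functional)
          obtain a where a: "a \<in> carrier A" "u = a \<otimes>\<^bsub>A\<^esub> w" using augmentation_generated[OF gen u(1,2)] .
          have "\<psi> = \<Phi> (q a)" using u(3) a by (simp add: \<Phi>)
          then show "\<psi> \<in> \<Phi> ` carrier (regular_bimodule Q)"
            using a(1) by (auto simp: regular_bimodule_def)
        qed
      qed
    qed
    fix C assume "C \<in> carrier (regular_bimodule Q)"
    then obtain a where a [simp]: "a \<in> carrier A" and C: "C = q a" by (auto simp: regular_bimodule_def quot.carrier_Q)
    show "\<Phi> (C \<oplus>\<^bsub>regular_bimodule Q\<^esub> D) = \<Phi> C \<oplus>\<^bsub>dual_bimodule R Q\<^esub> \<Phi> D"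
      if DQ: "D \<in> carrier (regular_bimodule Q)" for D
    proof -
      obtain b where b [simp]: "b \<in> carrier A" and D: "D = q b"
        using DQ by (auto simp: regular_bimodule_def quot.carrier_Q)
      have "\<Phi> C \<oplus>\<^bsub>dual_bimodule R Q\<^esub> \<Phi> D = functional ((a \<oplus>\<^bsub>A\<^esub> b) \<otimes>\<^bsub>A\<^esub> w)"
        by (rule functional_eqI) (simp_all add: C D \<Phi> dual_bimodule_def functional_q \<epsilon>w A.l_distr A.r_distr)
      then show ?thesis by (simp add: C D \<Phi> regular_bimodule_def)
    qed
    show "\<Phi> (r \<odot>\<^bsub>regular_bimodule Q\<^esub> C) = r \<odot>\<^bsub>dual_bimodule R Q\<^esub> \<Phi> C" if [simp]: "r \<in> carrier R" for r
    proof -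
      have "r \<odot>\<^bsub>dual_bimodule R Q\<^esub> \<Phi> C = functional ((r \<odot>\<^bsub>A\<^esub> a) \<otimes>\<^bsub>A\<^esub> w)"
        by (rule functional_eqI)
          (simp_all add: C \<Phi> dual_bimodule_def functional_q \<epsilon>w A.smult_mult_left A.smult_mult_right)
      then show ?thesis by (simp add: C \<Phi> regular_bimodule_def)
    qed
  next
    fix D C assume "D \<in> carrier Q" "C \<in> carrier (regular_bimodule Q)"
    then obtain a b where a [simp]: "a \<in> carrier A" and C: "C = q a" and b [simp]: "b \<in> carrier A" and D: "D = q b"
      by (auto simp: regular_bimodule_def quot.carrier_Q)
    have "lact (dual_bimodule R Q) D (\<Phi> C) = functional ((b \<otimes>\<^bsub>A\<^esub> a) \<otimes>\<^bsub>A\<^esub> w)"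
      by (rule functional_eqI) (simp_all add: C D \<Phi> dual_bimodule_def functional_q \<epsilon>w A.m_assoc)
    then show "\<Phi> (lact (regular_bimodule Q) D C) = lact (dual_bimodule R Q) D (\<Phi> C)"
      by (simp add: C D \<Phi> regular_bimodule_def)
    have "ract (dual_bimodule R Q) (\<Phi> C) D = functional ((a \<otimes>\<^bsub>A\<^esub> b) \<otimes>\<^bsub>A\<^esub> w)"
    proof (rule functional_eqI)
      fix f assume f [simp]: "f \<in> carrier A"
      have "((b \<otimes>\<^bsub>A\<^esub> f) \<otimes>\<^bsub>A\<^esub> (a \<otimes>\<^bsub>A\<^esub> w)) \<one>\<^bsub>G\<^esub> = (f \<otimes>\<^bsub>A\<^esub> ((a \<otimes>\<^bsub>A\<^esub> b) \<otimes>\<^bsub>A\<^esub> w)) \<one>\<^bsub>G\<^esub>"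
        using trace_commute[of b "f \<otimes>\<^bsub>A\<^esub> (a \<otimes>\<^bsub>A\<^esub> w)"] cen[OF b] by (simp add: A.m_assoc)
      then show "ract (dual_bimodule R Q) (\<Phi> C) D (q f) = (f \<otimes>\<^bsub>A\<^esub> ((a \<otimes>\<^bsub>A\<^esub> b) \<otimes>\<^bsub>A\<^esub> w)) \<one>\<^bsub>G\<^esub>"
        by (simp add: C D \<Phi> dual_bimodule_def functional_q \<epsilon>w)
    qed (simp_all add: dual_bimodule_def \<epsilon>w)
    then show "\<Phi> (ract (regular_bimodule Q) C D) = ract (dual_bimodule R Q) (\<Phi> C) D"
      by (simp add: C D \<Phi> regular_bimodule_def)
  qed
  then show ?thesis
    using quotient_free[OF nontrivial] quot.quotient_assoc_algebra unfolding symmetric_algebra_def by blast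
qed

theorem symmetric_iff_central_generator:
  assumes "\<one> \<noteq> \<zero>"
  shows "symmetric_algebra R Q \<longleftrightarrow> (\<exists>w. central_generator w)"
  using bimodule_iso_imp_central_generator central_generator_imp_symmetric[OF assms]
  unfolding symmetric_algebra_def by blast

end

section \<open>Consequences of a central generator over a field\<close>

context finite_group_ring
begin

text \<open>Finite dimensionality, in a form that needs neither bases nor dimensions. Induction on the set \<open>Y\<close> of
  coordinates in which the functions may be nonzero. The subspaces \<open>T i\<close> of functions vanishing at one further
  coordinate \<open>y\<close> become stationary by induction. Either some \<open>S i\<close> vanishes at \<open>y\<close> and equals \<open>T i\<close>
  from then on, or every \<open>S i\<close> has a member that can be used to clear the coordinate \<open>y\<close>.\<close>

lemma descending_subspaces_stabilize:
  assumes "field R" and "finite Y"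
    and sub: "\<And>i::nat. S i \<subseteq> carrier A" and zero: "\<And>i. \<zero>\<^bsub>A\<^esub> \<in> S i"
    and diff: "\<And>i f g c. f \<in> S i \<Longrightarrow> g \<in> S i \<Longrightarrow> c \<in> carrier R \<Longrightarrow> f \<ominus>\<^bsub>A\<^esub> c \<odot>\<^bsub>A\<^esub> g \<in> S i"
    and desc: "\<And>i. S (Suc i) \<subseteq> S i"
    and supp: "\<And>i f x. f \<in> S i \<Longrightarrow> x \<in> carrier G \<Longrightarrow> x \<notin> Y \<Longrightarrow> f x = \<zero>"
  shows "\<exists>n. \<forall>i\<ge>n. S i = S n"
  using assms(2-)
proof (induction Y arbitrary: S rule: finite_induct)
  case (empty S)
  have "f = \<zero>\<^bsub>A\<^esub>" if "f \<in> S i" for f i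
    using that empty.prems(1,5) by (intro A_eqI) auto
  then have "S i = {\<zero>\<^bsub>A\<^esub>}" for i
    using empty.prems(2) by blast
  then show ?case by simp
next
  case (insert y Y S)
  interpret F: field R by fact
  note sub = insert.prems(1) and zero = insert.prems(2) and diff = insert.prems(3)
  have anti: "S j \<subseteq> S i" if "i \<le> j" for i j
    using lift_Suc_antimono_le[of S i j] insert.prems(4) that by simp
  show ?case
  proof (cases "y \<in> carrier G")
    case False
    show ?thesis
    proof (rule insert.IH[of S, OF sub zero diff insert.prems(4)])
      fix i f x assume "f \<in> S i" "x \<in> carrier G" "x \<notin> Y"
      then show "f x = \<zero>" using False insert.prems(5)[of f i x] by (cases "x = y") auto
    qed
  next
    case y: True
    define T where "T i = {f \<in> S i. f y = \<zero>}" for i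
    have "\<exists>n. \<forall>i\<ge>n. T i = T n"
    proof (rule insert.IH)
      fix i f g c assume fg: "f \<in> T i" "g \<in> T i" "c \<in> carrier R"
      then have "f \<in> carrier A" "g \<in> carrier A" using sub by (auto simp: T_def)
      then show "f \<ominus>\<^bsub>A\<^esub> c \<odot>\<^bsub>A\<^esub> g \<in> T i"
        using fg diff[of f i g c] y by (simp add: T_def a_minus_def)
    next
      show "T (Suc i) \<subseteq> T i" for i using insert.prems(4)[of i] by (auto simp: T_def)
    next
      fix i f x assume "f \<in> T i" "x \<in> carrier G" "x \<notin> Y"
      then show "f x = \<zero>" using insert.prems(5)[of f i x] by (cases "x = y") (auto simp: T_def)
    qed (use sub zero y in \<open>auto simp: T_def\<close>)
    then obtain n where n: "\<And>i. i \<ge> n \<Longrightarrow> T i = T n" by blast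
    show ?thesis
    proof (cases "\<forall>i. \<exists>g\<in>S i. g y \<noteq> \<zero>")
      case True
      have "S i = S n" if i: "i \<ge> n" for i
      proof
        show "S i \<subseteq> S n" using anti[OF i] .
        show "S n \<subseteq> S i"
        proof
          fix f assume f: "f \<in> S n"
          obtain g where g: "g \<in> S i" "g y \<noteq> \<zero>" using True by blast
          have gn: "g \<in> S n" using g anti[OF i] by blast
          have [simp]: "f \<in> carrier A" "g \<in> carrier A" using f g sub by auto
          define c where "c = f y \<otimes> inv (g y)"
          have u: "g y \<in> Units R" using g(2) y F.field_Units by simp
          have c [simp]: "c \<in> carrier R" using u y by (simp add: c_def)
          have cg: "c \<otimes> g y = f y" using u y by (simp add: c_def R.m_assoc)
          let ?h = "f \<ominus>\<^bsub>A\<^esub> c \<odot>\<^bsub>A\<^esub> g"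
          have "?h \<in> S n" using diff[OF f gn c] .
          moreover have "?h y = \<zero>" using y cg by simp
          ultimately have h: "?h \<in> S i" using n[OF i] by (auto simp: T_def)
          have "f = ?h \<ominus>\<^bsub>A\<^esub> (\<ominus> c) \<odot>\<^bsub>A\<^esub> g"
            by (rule A_eqI) (simp_all add: a_minus_def R.l_minus R.a_assoc R.l_neg)
          then show "f \<in> S i" using diff[OF h g(1), of "\<ominus> c"] by simp
        qed
      qed
      then show ?thesis by blast
    next
      case False
      then obtain j where j: "\<And>g. g \<in> S j \<Longrightarrow> g y = \<zero>" by blast
      have "S i = T i" if "i \<ge> j" for i
        using anti[OF that] j by (auto simp: T_def)
      then have "S i = S (max n j)" if "i \<ge> max n j" for i
        using n that by (metis max.bounded_iff max.cobounded1 max.cobounded2)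
      then show ?thesis by blast
    qed
  qed
qed

lemma pow_central:
  assumes "w \<in> carrier A" "\<And>b. b \<in> carrier A \<Longrightarrow> b \<otimes>\<^bsub>A\<^esub> w = w \<otimes>\<^bsub>A\<^esub> b" "b \<in> carrier A"
  shows "b \<otimes>\<^bsub>A\<^esub> w [^]\<^bsub>A\<^esub> (n::nat) = w [^]\<^bsub>A\<^esub> n \<otimes>\<^bsub>A\<^esub> b"
proof (induction n)
  case (Suc n)
  have "b \<otimes>\<^bsub>A\<^esub> w [^]\<^bsub>A\<^esub> Suc n = (b \<otimes>\<^bsub>A\<^esub> w [^]\<^bsub>A\<^esub> n) \<otimes>\<^bsub>A\<^esub> w"
    using assms(1,3) by (simp add: A.m_assoc)
  also have "\<dots> = w [^]\<^bsub>A\<^esub> n \<otimes>\<^bsub>A\<^esub> (b \<otimes>\<^bsub>A\<^esub> w)"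
    using Suc assms(1,3) by (simp add: A.m_assoc)
  also have "\<dots> = w [^]\<^bsub>A\<^esub> Suc n \<otimes>\<^bsub>A\<^esub> b"
    using assms(2)[OF assms(3)] assms(1,3) by (simp add: A.m_assoc)
  finally show ?case .
qed (use assms in simp)

text \<open>The left ideals \<open>A w\<^sup>i\<close> become stationary. The index \<open>n\<close> is taken positive because only then is
  \<open>\<epsilon> (w\<^sup>n) = 0\<close> when \<open>\<epsilon> w = 0\<close>.\<close>

lemma exists_Fitting_factor:
  assumes "field R" and w [simp]: "w \<in> carrier A"
    and cen: "\<And>b. b \<in> carrier A \<Longrightarrow> b \<otimes>\<^bsub>A\<^esub> w = w \<otimes>\<^bsub>A\<^esub> b"
  obtains n b where "n > 0" "b \<in> carrier A"
    "w [^]\<^bsub>A\<^esub> (n::nat) = b \<otimes>\<^bsub>A\<^esub> (w [^]\<^bsub>A\<^esub> n \<otimes>\<^bsub>A\<^esub> w [^]\<^bsub>A\<^esub> n)"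
proof -
  define S where "S i = (\<lambda>a. a \<otimes>\<^bsub>A\<^esub> w [^]\<^bsub>A\<^esub> (i::nat)) ` carrier A" for i
  have "\<exists>n. \<forall>i\<ge>n. S i = S n"
  proof (rule descending_subspaces_stabilize[OF assms(1) finite_G])
    show "S i \<subseteq> carrier A" for i by (auto simp: S_def)
    show "\<zero>\<^bsub>A\<^esub> \<in> S i" for i
      unfolding S_def by (rule image_eqI[of _ _ "\<zero>\<^bsub>A\<^esub>"]) simp_all
    show "S (Suc i) \<subseteq> S i" for i
    proof
      fix f assume "f \<in> S (Suc i)"
      then obtain a where a: "a \<in> carrier A" "f = a \<otimes>\<^bsub>A\<^esub> w [^]\<^bsub>A\<^esub> Suc i" by (auto simp: S_def)
      have "f = (a \<otimes>\<^bsub>A\<^esub> w) \<otimes>\<^bsub>A\<^esub> w [^]\<^bsub>A\<^esub> i"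
        using a pow_central[OF w cen w, of i] by (simp add: A.m_assoc)
      then show "f \<in> S i" unfolding S_def by (rule image_eqI[of _ _ "a \<otimes>\<^bsub>A\<^esub> w"]) (simp_all add: a)
    qed
    fix i f g c assume "f \<in> S i" "g \<in> S i" and c: "c \<in> carrier R"
    then obtain a b where ab: "a \<in> carrier A" "f = a \<otimes>\<^bsub>A\<^esub> w [^]\<^bsub>A\<^esub> i"
      "b \<in> carrier A" "g = b \<otimes>\<^bsub>A\<^esub> w [^]\<^bsub>A\<^esub> i" by (auto simp: S_def)
    then have "f \<ominus>\<^bsub>A\<^esub> c \<odot>\<^bsub>A\<^esub> g = (a \<ominus>\<^bsub>A\<^esub> c \<odot>\<^bsub>A\<^esub> b) \<otimes>\<^bsub>A\<^esub> w [^]\<^bsub>A\<^esub> i"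
      using c by (simp add: a_minus_def A.l_distr A.l_minus A.smult_mult_left)
    then show "f \<ominus>\<^bsub>A\<^esub> c \<odot>\<^bsub>A\<^esub> g \<in> S i"
      unfolding S_def by (rule image_eqI[of _ _ "a \<ominus>\<^bsub>A\<^esub> c \<odot>\<^bsub>A\<^esub> b"]) (simp_all add: ab c)
  qed auto
  then obtain n where n: "\<And>i. i \<ge> n \<Longrightarrow> S i = S n" by blast
  have "w [^]\<^bsub>A\<^esub> Suc n \<in> S (Suc n)"
    unfolding S_def by (rule image_eqI[of _ _ "\<one>\<^bsub>A\<^esub>"]) simp_all
  also have "S (Suc n) = S (Suc n + Suc n)" using n[of "Suc n"] n[of "Suc n + Suc n"] by simp
  finally obtain b where "b \<in> carrier A" "w [^]\<^bsub>A\<^esub> Suc n = b \<otimes>\<^bsub>A\<^esub> w [^]\<^bsub>A\<^esub> (Suc n + Suc n)"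
    by (auto simp: S_def)
  then show thesis
    using that[of "Suc n" b] A.nat_pow_mult[OF w, of "Suc n" "Suc n"] by simp
qed

text \<open>With \<open>u = w\<^sup>n = b u\<^sup>2\<close>, the element \<open>b u\<close> is the projection onto the part of \<open>A\<close> on which \<open>w\<close> is invertible,
  and \<open>e = 1 - b u\<close> the projection onto the part on which \<open>w\<close> is nilpotent. Centrality of \<open>b u\<close> has to be
  proved, as \<open>b\<close> itself may fail to be central.\<close>

lemma exists_principal_block_element:
  assumes "field R" and gen: "central_generator w"
  obtains e n where "e \<in> carrier A" "\<And>b. b \<in> carrier A \<Longrightarrow> b \<otimes>\<^bsub>A\<^esub> e = e \<otimes>\<^bsub>A\<^esub> b"
    "w [^]\<^bsub>A\<^esub> (n::nat) \<otimes>\<^bsub>A\<^esub> e = \<zero>\<^bsub>A\<^esub>" "\<epsilon> e = \<one>"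
proof -
  have w [simp]: "w \<in> carrier A" and \<epsilon>w: "\<epsilon> w = \<zero>"
    and cen: "\<And>b. b \<in> carrier A \<Longrightarrow> b \<otimes>\<^bsub>A\<^esub> w = w \<otimes>\<^bsub>A\<^esub> b"
    using gen by (auto simp: central_generator_def)
  obtain n b where n: "n > 0" and b [simp]: "b \<in> carrier A"
    and fit: "w [^]\<^bsub>A\<^esub> (n::nat) = b \<otimes>\<^bsub>A\<^esub> (w [^]\<^bsub>A\<^esub> n \<otimes>\<^bsub>A\<^esub> w [^]\<^bsub>A\<^esub> n)"
    using exists_Fitting_factor[OF assms(1) w cen] by blast
  define u where "u = w [^]\<^bsub>A\<^esub> n"
  have u [simp]: "u \<in> carrier A" by (simp add: u_def)
  have ucen: "x \<otimes>\<^bsub>A\<^esub> u = u \<otimes>\<^bsub>A\<^esub> x" if "x \<in> carrier A" for x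
    using pow_central[OF w cen that] by (simp add: u_def)
  have uucen: "x \<otimes>\<^bsub>A\<^esub> (u \<otimes>\<^bsub>A\<^esub> u) = (u \<otimes>\<^bsub>A\<^esub> u) \<otimes>\<^bsub>A\<^esub> x" if "x \<in> carrier A" for x
    using ucen[OF that] that by (metis A.m_assoc u ucen)
  have fit: "u = b \<otimes>\<^bsub>A\<^esub> (u \<otimes>\<^bsub>A\<^esub> u)" using fit by (simp add: u_def)
  have xbu: "x \<otimes>\<^bsub>A\<^esub> (b \<otimes>\<^bsub>A\<^esub> u) = b \<otimes>\<^bsub>A\<^esub> (x \<otimes>\<^bsub>A\<^esub> u)" if x [simp]: "x \<in> carrier A" for x
  proof -
    \<comment> \<open>The claim holds with \<open>u\<^sup>2\<close> in place of \<open>u\<close>; then \<open>u = u\<^sup>2 b\<close> removes one factor.\<close>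
    have "x \<otimes>\<^bsub>A\<^esub> (b \<otimes>\<^bsub>A\<^esub> (u \<otimes>\<^bsub>A\<^esub> u)) = u \<otimes>\<^bsub>A\<^esub> x"
      using ucen[OF x] by (simp only: fit[symmetric])
    also have "\<dots> = b \<otimes>\<^bsub>A\<^esub> (u \<otimes>\<^bsub>A\<^esub> u) \<otimes>\<^bsub>A\<^esub> x" by (simp only: fit[symmetric])
    also have "\<dots> = b \<otimes>\<^bsub>A\<^esub> (x \<otimes>\<^bsub>A\<^esub> (u \<otimes>\<^bsub>A\<^esub> u))" using uucen[OF x] by (simp add: A.m_assoc)
    finally have *: "x \<otimes>\<^bsub>A\<^esub> (b \<otimes>\<^bsub>A\<^esub> (u \<otimes>\<^bsub>A\<^esub> u)) = b \<otimes>\<^bsub>A\<^esub> (x \<otimes>\<^bsub>A\<^esub> (u \<otimes>\<^bsub>A\<^esub> u))" .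
    have fit': "u = (u \<otimes>\<^bsub>A\<^esub> u) \<otimes>\<^bsub>A\<^esub> b" using fit unfolding uucen[OF b] .
    have "x \<otimes>\<^bsub>A\<^esub> (b \<otimes>\<^bsub>A\<^esub> u) = x \<otimes>\<^bsub>A\<^esub> (b \<otimes>\<^bsub>A\<^esub> ((u \<otimes>\<^bsub>A\<^esub> u) \<otimes>\<^bsub>A\<^esub> b))" by (simp only: fit'[symmetric])
    also have "\<dots> = x \<otimes>\<^bsub>A\<^esub> (b \<otimes>\<^bsub>A\<^esub> (u \<otimes>\<^bsub>A\<^esub> u)) \<otimes>\<^bsub>A\<^esub> b" by (simp add: A.m_assoc)
    also have "\<dots> = b \<otimes>\<^bsub>A\<^esub> (x \<otimes>\<^bsub>A\<^esub> ((u \<otimes>\<^bsub>A\<^esub> u) \<otimes>\<^bsub>A\<^esub> b))" unfolding * by (simp add: A.m_assoc)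
    also have "\<dots> = b \<otimes>\<^bsub>A\<^esub> (x \<otimes>\<^bsub>A\<^esub> u)" by (simp only: fit'[symmetric])
    finally show ?thesis .
  qed
  define e where "e = \<one>\<^bsub>A\<^esub> \<ominus>\<^bsub>A\<^esub> b \<otimes>\<^bsub>A\<^esub> u"
  show thesis
  proof
    show "e \<in> carrier A" by (simp add: e_def)
    show "x \<otimes>\<^bsub>A\<^esub> e = e \<otimes>\<^bsub>A\<^esub> x" if x [simp]: "x \<in> carrier A" for x
      using xbu[OF x] ucen[OF x]
      by (simp add: e_def a_minus_def A.l_distr A.r_distr A.l_minus A.r_minus A.m_assoc)
    have "u \<otimes>\<^bsub>A\<^esub> e = u \<ominus>\<^bsub>A\<^esub> u \<otimes>\<^bsub>A\<^esub> (b \<otimes>\<^bsub>A\<^esub> u)"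
      by (simp add: e_def a_minus_def A.r_distr A.r_minus)
    also have "u \<otimes>\<^bsub>A\<^esub> (b \<otimes>\<^bsub>A\<^esub> u) = u"
      unfolding xbu[OF u] by (rule fit[symmetric])
    finally show "w [^]\<^bsub>A\<^esub> n \<otimes>\<^bsub>A\<^esub> e = \<zero>\<^bsub>A\<^esub>"
      by (simp add: u_def a_minus_def A.M.r_neg)
    have "\<epsilon> u = \<zero>" using n by (simp add: u_def augmentation_pow \<epsilon>w R.nat_pow_zero)
    then show "\<epsilon> e = \<one>" by (simp add: e_def a_minus_def)
  qed
qed

text \<open>Descending induction on the exponent of \<open>w\<close>: writing \<open>b = \<epsilon>(b) 1 + a w\<close> gives
  \<open>b w\<^sup>j e = \<epsilon>(b) w\<^sup>j e + a w\<^sup>j\<^sup>+\<^sup>1 e\<close>, a scalar multiple of a central element plus an element treated before.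
  The induction starts at \<open>w\<^sup>n e = 0\<close>.\<close>

lemma principal_block_central:
  assumes gen: "central_generator w"
    and e [simp]: "e \<in> carrier A" and cen: "\<And>b. b \<in> carrier A \<Longrightarrow> b \<otimes>\<^bsub>A\<^esub> e = e \<otimes>\<^bsub>A\<^esub> b"
    and nil: "w [^]\<^bsub>A\<^esub> (n::nat) \<otimes>\<^bsub>A\<^esub> e = \<zero>\<^bsub>A\<^esub>"
    and b: "b \<in> carrier A" and x [simp]: "x \<in> carrier A"
  shows "x \<otimes>\<^bsub>A\<^esub> (b \<otimes>\<^bsub>A\<^esub> e) = (b \<otimes>\<^bsub>A\<^esub> e) \<otimes>\<^bsub>A\<^esub> x"
proof -
  have w [simp]: "w \<in> carrier A" and wcen: "\<And>b. b \<in> carrier A \<Longrightarrow> b \<otimes>\<^bsub>A\<^esub> w = w \<otimes>\<^bsub>A\<^esub> b"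
    using gen by (auto simp: central_generator_def)
  have wecen: "x \<otimes>\<^bsub>A\<^esub> (w [^]\<^bsub>A\<^esub> j \<otimes>\<^bsub>A\<^esub> e) = (w [^]\<^bsub>A\<^esub> j \<otimes>\<^bsub>A\<^esub> e) \<otimes>\<^bsub>A\<^esub> x" for j :: nat
  proof -
    have "x \<otimes>\<^bsub>A\<^esub> (w [^]\<^bsub>A\<^esub> j \<otimes>\<^bsub>A\<^esub> e) = (x \<otimes>\<^bsub>A\<^esub> w [^]\<^bsub>A\<^esub> j) \<otimes>\<^bsub>A\<^esub> e" by (simp add: A.m_assoc)
    also have "\<dots> = w [^]\<^bsub>A\<^esub> j \<otimes>\<^bsub>A\<^esub> (x \<otimes>\<^bsub>A\<^esub> e)" using pow_central[OF w wcen x, of j] by (simp add: A.m_assoc)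
    also have "\<dots> = (w [^]\<^bsub>A\<^esub> j \<otimes>\<^bsub>A\<^esub> e) \<otimes>\<^bsub>A\<^esub> x" using cen[OF x] by (simp add: A.m_assoc)
    finally show ?thesis .
  qed
  have "\<forall>b\<in>carrier A. x \<otimes>\<^bsub>A\<^esub> (b \<otimes>\<^bsub>A\<^esub> (w [^]\<^bsub>A\<^esub> (n - j) \<otimes>\<^bsub>A\<^esub> e)) =
      (b \<otimes>\<^bsub>A\<^esub> (w [^]\<^bsub>A\<^esub> (n - j) \<otimes>\<^bsub>A\<^esub> e)) \<otimes>\<^bsub>A\<^esub> x" if "j \<le> n" for j
    using that
  proof (induction j)
    case 0
    then show ?case using nil by simp
  next
    case (Suc j)
    let ?v = "w [^]\<^bsub>A\<^esub> (n - Suc j) \<otimes>\<^bsub>A\<^esub> e"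
    have v: "w \<otimes>\<^bsub>A\<^esub> ?v = w [^]\<^bsub>A\<^esub> (n - j) \<otimes>\<^bsub>A\<^esub> e"
    proof -
      have "w [^]\<^bsub>A\<^esub> (n - j) = w [^]\<^bsub>A\<^esub> Suc (n - Suc j)" using Suc.prems by (simp add: Suc_diff_Suc)
      also have "\<dots> = w \<otimes>\<^bsub>A\<^esub> w [^]\<^bsub>A\<^esub> (n - Suc j)" using pow_central[OF w wcen w] by simp
      finally show ?thesis by (simp add: A.m_assoc)
    qed
    show ?case
    proof
      fix b assume b [simp]: "b \<in> carrier A"
      let ?r = "\<epsilon> b"
      have "\<epsilon> (b \<ominus>\<^bsub>A\<^esub> ?r \<odot>\<^bsub>A\<^esub> \<one>\<^bsub>A\<^esub>) = \<zero>" by (simp add: a_minus_def R.r_neg)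
      then obtain a where a [simp]: "a \<in> carrier A" and aw: "b \<ominus>\<^bsub>A\<^esub> ?r \<odot>\<^bsub>A\<^esub> \<one>\<^bsub>A\<^esub> = a \<otimes>\<^bsub>A\<^esub> w"
        using augmentation_generated[OF gen, of "b \<ominus>\<^bsub>A\<^esub> ?r \<odot>\<^bsub>A\<^esub> \<one>\<^bsub>A\<^esub>"] by auto
      have "b = a \<otimes>\<^bsub>A\<^esub> w \<oplus>\<^bsub>A\<^esub> ?r \<odot>\<^bsub>A\<^esub> \<one>\<^bsub>A\<^esub>"
        unfolding aw[symmetric] by (simp add: a_minus_def A.M.a_assoc A.M.l_neg)
      then have bv: "b \<otimes>\<^bsub>A\<^esub> ?v = a \<otimes>\<^bsub>A\<^esub> (w [^]\<^bsub>A\<^esub> (n - j) \<otimes>\<^bsub>A\<^esub> e) \<oplus>\<^bsub>A\<^esub> ?r \<odot>\<^bsub>A\<^esub> ?v"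
        unfolding v[symmetric]
        by (metis A.l_distr A.l_one A.m_assoc A.m_closed A.nat_pow_closed A.one_closed A.smult_closed
            A.smult_mult_left a augmentation_closed b e w)
      show "x \<otimes>\<^bsub>A\<^esub> (b \<otimes>\<^bsub>A\<^esub> ?v) = (b \<otimes>\<^bsub>A\<^esub> ?v) \<otimes>\<^bsub>A\<^esub> x"
        unfolding bv using Suc wecen[of "n - Suc j"]
        by (simp add: A.l_distr A.r_distr A.smult_mult_left A.smult_mult_right)
    qed
  qed
  from this[of n] show ?thesis using b by simp
qed

definition fixing_subgroup :: "('g \<Rightarrow> 'r) \<Rightarrow> 'g set"
  where "fixing_subgroup e = {g \<in> carrier G. \<delta> g \<otimes>\<^bsub>A\<^esub> e = e}"

lemma fixing_subgroup_is_subgroup: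
  assumes [simp]: "e \<in> carrier A"
  shows "subgroup (fixing_subgroup e) G"
proof (rule G.subgroupI)
  fix x y assume x: "x \<in> fixing_subgroup e" and y: "y \<in> fixing_subgroup e"
  have [simp]: "x \<in> carrier G" "y \<in> carrier G" using x y by (auto simp: fixing_subgroup_def)
  have "\<delta> (inv\<^bsub>G\<^esub> x) \<otimes>\<^bsub>A\<^esub> e = \<delta> (inv\<^bsub>G\<^esub> x) \<otimes>\<^bsub>A\<^esub> (\<delta> x \<otimes>\<^bsub>A\<^esub> e)"
    using x by (simp add: fixing_subgroup_def)
  also have "\<dots> = e" by (simp add: A.m_assoc[symmetric] group_elt_mult group_elt_one)
  finally show "inv\<^bsub>G\<^esub> x \<in> fixing_subgroup e" by (simp add: fixing_subgroup_def)
  have "\<delta> (x \<otimes>\<^bsub>G\<^esub> y) \<otimes>\<^bsub>A\<^esub> e = \<delta> x \<otimes>\<^bsub>A\<^esub> (\<delta> y \<otimes>\<^bsub>A\<^esub> e)"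
    by (simp add: A.m_assoc[symmetric] group_elt_mult)
  also have "\<dots> = e" using x y by (simp add: fixing_subgroup_def)
  finally show "x \<otimes>\<^bsub>G\<^esub> y \<in> fixing_subgroup e" by (simp add: fixing_subgroup_def)
next
  have "\<one>\<^bsub>G\<^esub> \<in> fixing_subgroup e" by (simp add: fixing_subgroup_def group_elt_one)
  then show "fixing_subgroup e \<noteq> {}" by blast
qed (auto simp: fixing_subgroup_def)

lemma fixing_subgroup_normal:
  assumes [simp]: "e \<in> carrier A" and cen: "\<And>b. b \<in> carrier A \<Longrightarrow> b \<otimes>\<^bsub>A\<^esub> e = e \<otimes>\<^bsub>A\<^esub> b"
  shows "fixing_subgroup e \<lhd> G"
proof (rule G.normal_invI[OF fixing_subgroup_is_subgroup[OF assms(1)]])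
  fix x h assume h: "h \<in> fixing_subgroup e" and x [simp]: "x \<in> carrier G"
  have [simp]: "h \<in> carrier G" using h by (simp add: fixing_subgroup_def)
  have "\<delta> (x \<otimes>\<^bsub>G\<^esub> h \<otimes>\<^bsub>G\<^esub> inv\<^bsub>G\<^esub> x) \<otimes>\<^bsub>A\<^esub> e = \<delta> x \<otimes>\<^bsub>A\<^esub> (\<delta> h \<otimes>\<^bsub>A\<^esub> (\<delta> (inv\<^bsub>G\<^esub> x) \<otimes>\<^bsub>A\<^esub> e))"
    by (simp add: group_elt_mult[symmetric] A.m_assoc)
  also have "\<dots> = \<delta> x \<otimes>\<^bsub>A\<^esub> ((\<delta> h \<otimes>\<^bsub>A\<^esub> e) \<otimes>\<^bsub>A\<^esub> \<delta> (inv\<^bsub>G\<^esub> x))"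
    by (simp add: A.m_assoc cen[of "\<delta> (inv\<^bsub>G\<^esub> x)"])
  also have "\<dots> = \<delta> x \<otimes>\<^bsub>A\<^esub> (\<delta> (inv\<^bsub>G\<^esub> x) \<otimes>\<^bsub>A\<^esub> e)"
    using h by (simp add: cen[of "\<delta> (inv\<^bsub>G\<^esub> x)"] fixing_subgroup_def)
  also have "\<dots> = e" by (simp add: A.m_assoc[symmetric] group_elt_mult group_elt_one)
  finally show "x \<otimes>\<^bsub>G\<^esub> h \<otimes>\<^bsub>G\<^esub> inv\<^bsub>G\<^esub> x \<in> fixing_subgroup e" by (simp add: fixing_subgroup_def)
qed

text \<open>For commuting \<open>x\<close> and \<open>y e\<close> the elements \<open>x y\<close> and \<open>y x\<close> act alike on \<open>e\<close>.\<close>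

lemma fixing_subgroup_commutator:
  assumes [simp]: "e \<in> carrier A" "x \<in> carrier G" "y \<in> carrier G"
    and cen: "\<delta> x \<otimes>\<^bsub>A\<^esub> (\<delta> y \<otimes>\<^bsub>A\<^esub> e) = (\<delta> y \<otimes>\<^bsub>A\<^esub> e) \<otimes>\<^bsub>A\<^esub> \<delta> x"
    and cen_e: "\<delta> x \<otimes>\<^bsub>A\<^esub> e = e \<otimes>\<^bsub>A\<^esub> \<delta> x"
    and normal: "fixing_subgroup e \<lhd> G"
  shows "x \<otimes>\<^bsub>G\<^esub> y \<otimes>\<^bsub>G\<^esub> inv\<^bsub>G\<^esub> x \<otimes>\<^bsub>G\<^esub> inv\<^bsub>G\<^esub> y \<in> fixing_subgroup e"
proof -
  let ?z = "inv\<^bsub>G\<^esub> x \<otimes>\<^bsub>G\<^esub> inv\<^bsub>G\<^esub> y"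
  have swap: "\<delta> x \<otimes>\<^bsub>A\<^esub> (\<delta> y \<otimes>\<^bsub>A\<^esub> e) = \<delta> y \<otimes>\<^bsub>A\<^esub> (\<delta> x \<otimes>\<^bsub>A\<^esub> e)"
    unfolding cen by (simp add: A.m_assoc cen_e)
  have cancel: "?z \<otimes>\<^bsub>G\<^esub> (y \<otimes>\<^bsub>G\<^esub> x) = \<one>\<^bsub>G\<^esub>"
    by (simp add: G.m_assoc G.inv_mult_cancel_left)
  have "\<delta> (?z \<otimes>\<^bsub>G\<^esub> (x \<otimes>\<^bsub>G\<^esub> y)) \<otimes>\<^bsub>A\<^esub> e = \<delta> ?z \<otimes>\<^bsub>A\<^esub> (\<delta> x \<otimes>\<^bsub>A\<^esub> (\<delta> y \<otimes>\<^bsub>A\<^esub> e))"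
    by (simp add: group_elt_mult[symmetric] A.m_assoc)
  also have "\<dots> = \<delta> (?z \<otimes>\<^bsub>G\<^esub> (y \<otimes>\<^bsub>G\<^esub> x)) \<otimes>\<^bsub>A\<^esub> e"
    unfolding swap by (simp add: group_elt_mult[symmetric] A.m_assoc)
  also have "\<dots> = e"
    unfolding cancel by (simp add: group_elt_one)
  finally have fixed: "\<delta> (?z \<otimes>\<^bsub>G\<^esub> (x \<otimes>\<^bsub>G\<^esub> y)) \<otimes>\<^bsub>A\<^esub> e = e" .
  have z: "?z \<otimes>\<^bsub>G\<^esub> (x \<otimes>\<^bsub>G\<^esub> y) \<in> carrier G" by simp
  have "?z \<otimes>\<^bsub>G\<^esub> (x \<otimes>\<^bsub>G\<^esub> y) \<in> fixing_subgroup e"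
    unfolding fixing_subgroup_def by (intro CollectI conjI z fixed)
  then have "(x \<otimes>\<^bsub>G\<^esub> y) \<otimes>\<^bsub>G\<^esub> (?z \<otimes>\<^bsub>G\<^esub> (x \<otimes>\<^bsub>G\<^esub> y)) \<otimes>\<^bsub>G\<^esub> inv\<^bsub>G\<^esub> (x \<otimes>\<^bsub>G\<^esub> y) \<in> fixing_subgroup e"
    using normal.inv_op_closed2[OF normal, of "x \<otimes>\<^bsub>G\<^esub> y"] by simp
  also have "(x \<otimes>\<^bsub>G\<^esub> y) \<otimes>\<^bsub>G\<^esub> (?z \<otimes>\<^bsub>G\<^esub> (x \<otimes>\<^bsub>G\<^esub> y)) \<otimes>\<^bsub>G\<^esub> inv\<^bsub>G\<^esub> (x \<otimes>\<^bsub>G\<^esub> y) =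
      (x \<otimes>\<^bsub>G\<^esub> y) \<otimes>\<^bsub>G\<^esub> ?z"
    by (simp add: G.m_assoc del: G.inv_mult_group)
  finally show ?thesis by (simp add: G.m_assoc)
qed

text \<open>Translation invariance makes \<open>e\<close> constant on the cosets of the fixing subgroup \<open>N\<close>, so \<open>\<epsilon> e\<close> is a multiple
  of \<open>card N\<close>; but \<open>\<epsilon> e = 1\<close>.\<close>

lemma fixing_subgroup_card_coprime:
  assumes [simp]: "e \<in> carrier A" and \<epsilon>e: "\<epsilon> e = \<one>" and "\<one> \<noteq> \<zero>"
    and char: "[p] \<cdot> \<one> = \<zero>" and p: "Factorial_Ring.prime (p::nat)"
  shows "coprime p (card (fixing_subgroup e))"
proof (rule ccontr)
  let ?N = "fixing_subgroup e"
  assume "\<not> coprime p (card ?N)"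
  then have "p dvd card ?N" using p prime_imp_coprime by blast
  then obtain k where k: "card ?N = p * k" by auto
  note N = fixing_subgroup_is_subgroup[OF assms(1)]
  have sumC: "(\<Oplus>x\<in>C. e x) = \<zero>" if "C \<in> rcosets\<^bsub>G\<^esub> ?N" for C
  proof -
    obtain y where y [simp]: "y \<in> carrier G" and C: "C = ?N #>\<^bsub>G\<^esub> y"
      using \<open>C \<in> rcosets\<^bsub>G\<^esub> ?N\<close> by (auto simp: RCOSETS_def)
    have "e x = e y" if xC: "x \<in> C" for x
    proof -
      obtain h where h: "h \<in> ?N" and x: "x = h \<otimes>\<^bsub>G\<^esub> y" using xC C by (auto simp: r_coset_def)
      have hG [simp]: "h \<in> carrier G" using h by (simp add: fixing_subgroup_def)
      have "e x = (\<delta> h \<otimes>\<^bsub>A\<^esub> e) x" using h by (simp add: fixing_subgroup_def)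
      also have "\<dots> = e y" by (simp add: group_elt_mult_coeff x G.inv_mult_cancel_left)
      finally show ?thesis .
    qed
    then have "(\<Oplus>x\<in>C. e x) = (\<Oplus>x\<in>C. e y)" by (intro R.finsum_cong') auto
    also have "\<dots> = [card C] \<cdot> e y" by (simp add: R.add.finprod_const)
    also have "card C = p * k"
      using G.card_rcosets_equal[OF that] N k by (simp add: subgroup.subset)
    also have "[(p * k)] \<cdot> e y = [k] \<cdot> ([p] \<cdot> (\<one> \<otimes> e y))" by (simp add: R.add.nat_pow_pow)
    also have "[p] \<cdot> (\<one> \<otimes> e y) = \<zero>"
      using R.add_pow_ldistr[of \<one> "e y" p] char by simp
    finally show ?thesis by simp
  qed
  have "\<epsilon> e = (\<Oplus>x\<in>\<Union>((\<lambda>C. C) ` (rcosets\<^bsub>G\<^esub> ?N)). e x)"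
    by (simp add: augmentation_def G.rcosets_part_G[OF N])
  also have "\<dots> = (\<Oplus>C\<in>rcosets\<^bsub>G\<^esub> ?N. \<Oplus>x\<in>C. e x)"
  proof (rule R.add.finprod_UN_disjoint)
    show "finite (rcosets\<^bsub>G\<^esub> ?N)" by (simp add: RCOSETS_def)
    show "pairwise (\<lambda>i j. disjnt i j) (rcosets\<^bsub>G\<^esub> ?N)" using G.rcos_disjoint[OF N] .
    have *: "C \<subseteq> carrier G" if "C \<in> rcosets\<^bsub>G\<^esub> ?N" for C
      using G.rcosets_part_G[OF N] that by blast
    show "finite C" if "C \<in> rcosets\<^bsub>G\<^esub> ?N" for C using *[OF that] finite_subset by blast
    show "e x \<in> carrier R" if "C \<in> rcosets\<^bsub>G\<^esub> ?N" "x \<in> C" for C x using *[OF that(1)] that(2) by auto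
  qed
  also have "\<dots> = \<zero>" by (rule R.add.finprod_one_eqI[OF sumC])
  finally show False using \<epsilon>e \<open>\<one> \<noteq> \<zero>\<close> by simp
qed

text \<open>Passing from \<open>x\<close> to \<open>x\<^sup>p\<close> multiplies \<open>x - 1\<close> by \<open>1 + x + \<dots> + x\<^sup>p\<^sup>-\<^sup>1\<close>, which has augmentation \<open>p = 0\<close> and is
  therefore a multiple of \<open>w\<close>. So \<open>g\<^sup>q - 1\<close> with \<open>q = p\<^sup>k\<close> is a multiple of \<open>w\<^sup>k\<close>, and \<open>w\<^sup>n\<close> kills \<open>e\<close>.\<close>

lemma pow_prime_power_mem_fixing_subgroup:
  assumes gen: "central_generator w" and e [simp]: "e \<in> carrier A"
    and nil: "w [^]\<^bsub>A\<^esub> (n::nat) \<otimes>\<^bsub>A\<^esub> e = \<zero>\<^bsub>A\<^esub>"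
    and char: "[(p::nat)] \<cdot> \<one> = \<zero>" and g [simp]: "g \<in> carrier G"
  shows "g [^]\<^bsub>G\<^esub> (p ^ n) \<in> fixing_subgroup e"
proof -
  have w [simp]: "w \<in> carrier A" and wcen: "\<And>b. b \<in> carrier A \<Longrightarrow> b \<otimes>\<^bsub>A\<^esub> w = w \<otimes>\<^bsub>A\<^esub> b"
    using gen by (auto simp: central_generator_def)
  have "\<exists>a\<in>carrier A. \<delta> (g [^]\<^bsub>G\<^esub> (p ^ k)) \<ominus>\<^bsub>A\<^esub> \<one>\<^bsub>A\<^esub> = a \<otimes>\<^bsub>A\<^esub> w [^]\<^bsub>A\<^esub> k" for k :: nat
  proof (induction k)
    case 0
    show ?case
      by (rule bexI[of _ "\<delta> g \<ominus>\<^bsub>A\<^esub> \<one>\<^bsub>A\<^esub>"]) simp_all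
  next
    case (Suc k)
    let ?x = "\<delta> (g [^]\<^bsub>G\<^esub> (p ^ k))"
    obtain a where a [simp]: "a \<in> carrier A" and ax: "?x \<ominus>\<^bsub>A\<^esub> \<one>\<^bsub>A\<^esub> = a \<otimes>\<^bsub>A\<^esub> w [^]\<^bsub>A\<^esub> k"
      using Suc by blast
    obtain s where s [simp]: "s \<in> carrier A" and
      sx: "?x [^]\<^bsub>A\<^esub> p \<ominus>\<^bsub>A\<^esub> \<one>\<^bsub>A\<^esub> = s \<otimes>\<^bsub>A\<^esub> (?x \<ominus>\<^bsub>A\<^esub> \<one>\<^bsub>A\<^esub>)" and \<epsilon>s: "\<epsilon> s = \<zero>"
      using geometric_factor[of ?x p] char by auto
    obtain c where c [simp]: "c \<in> carrier A" and sc: "s = c \<otimes>\<^bsub>A\<^esub> w"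
      using augmentation_generated[OF gen s \<epsilon>s] .
    have "g [^]\<^bsub>G\<^esub> (p ^ Suc k) = (g [^]\<^bsub>G\<^esub> (p ^ k)) [^]\<^bsub>G\<^esub> p"
      by (simp add: G.nat_pow_pow mult.commute)
    then have "\<delta> (g [^]\<^bsub>G\<^esub> (p ^ Suc k)) \<ominus>\<^bsub>A\<^esub> \<one>\<^bsub>A\<^esub> = (c \<otimes>\<^bsub>A\<^esub> w) \<otimes>\<^bsub>A\<^esub> (a \<otimes>\<^bsub>A\<^esub> w [^]\<^bsub>A\<^esub> k)"
      using sx unfolding ax sc by (simp add: group_elt_pow)
    also have "\<dots> = c \<otimes>\<^bsub>A\<^esub> (a \<otimes>\<^bsub>A\<^esub> w) \<otimes>\<^bsub>A\<^esub> w [^]\<^bsub>A\<^esub> k"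
      using wcen[OF a] by (simp add: A.m_assoc)
    also have "\<dots> = (c \<otimes>\<^bsub>A\<^esub> a) \<otimes>\<^bsub>A\<^esub> w [^]\<^bsub>A\<^esub> Suc k"
      using pow_central[OF w wcen w, of k] by (simp add: A.m_assoc)
    finally show ?case by (rule bexI[of _ "c \<otimes>\<^bsub>A\<^esub> a"]) simp
  qed
  then obtain a where a [simp]: "a \<in> carrier A" and
    ax: "\<delta> (g [^]\<^bsub>G\<^esub> (p ^ n)) \<ominus>\<^bsub>A\<^esub> \<one>\<^bsub>A\<^esub> = a \<otimes>\<^bsub>A\<^esub> w [^]\<^bsub>A\<^esub> n" by blast
  have "\<delta> (g [^]\<^bsub>G\<^esub> (p ^ n)) \<otimes>\<^bsub>A\<^esub> e \<ominus>\<^bsub>A\<^esub> e = (\<delta> (g [^]\<^bsub>G\<^esub> (p ^ n)) \<ominus>\<^bsub>A\<^esub> \<one>\<^bsub>A\<^esub>) \<otimes>\<^bsub>A\<^esub> e"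
    by (simp add: a_minus_def A.l_distr A.l_minus)
  also have "\<dots> = \<zero>\<^bsub>A\<^esub>" unfolding ax using nil by (simp add: A.m_assoc)
  finally show ?thesis by (simp add: fixing_subgroup_def)
qed

text \<open>The linear extension of an additive map is a derivation along the augmentation. In particular it vanishes on
  products of two elements of augmentation zero.\<close>

lemma additive_extension_mult:
  assumes [simp]: "f \<in> carrier A" "g \<in> carrier A" "\<And>x. x \<in> carrier G \<Longrightarrow> \<phi> x \<in> carrier R"
    and add: "\<And>x y. x \<in> carrier G \<Longrightarrow> y \<in> carrier G \<Longrightarrow> \<phi> (x \<otimes>\<^bsub>G\<^esub> y) = \<phi> x \<oplus> \<phi> y"
  shows "(\<Oplus>x\<in>carrier G. (f \<otimes>\<^bsub>A\<^esub> g) x \<otimes> \<phi> x) =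
    (\<Oplus>x\<in>carrier G. f x \<otimes> \<phi> x) \<otimes> \<epsilon> g \<oplus> \<epsilon> f \<otimes> (\<Oplus>x\<in>carrier G. g x \<otimes> \<phi> x)"
proof -
  have "(\<Oplus>x\<in>carrier G. (f \<otimes>\<^bsub>A\<^esub> g) x \<otimes> \<phi> x) =
      (\<Oplus>x\<in>carrier G. \<Oplus>y\<in>carrier G. f y \<otimes> g (inv\<^bsub>G\<^esub> y \<otimes>\<^bsub>G\<^esub> x) \<otimes> \<phi> x)"
    by (intro R.finsum_cong') (auto simp: mult_coeff R.finsum_ldistr Pi_def)
  also have "\<dots> = (\<Oplus>y\<in>carrier G. \<Oplus>x\<in>carrier G. f y \<otimes> g (inv\<^bsub>G\<^esub> y \<otimes>\<^bsub>G\<^esub> x) \<otimes> \<phi> x)"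
    by (intro R.finsum_swap) auto
  also have "\<dots> = (\<Oplus>y\<in>carrier G. f y \<otimes> \<phi> y \<otimes> \<epsilon> g \<oplus> f y \<otimes> (\<Oplus>x\<in>carrier G. g x \<otimes> \<phi> x))"
  proof (intro R.finsum_cong')
    fix y assume y [simp]: "y \<in> carrier G"
    have "(\<Oplus>x\<in>carrier G. f y \<otimes> g (inv\<^bsub>G\<^esub> y \<otimes>\<^bsub>G\<^esub> x) \<otimes> \<phi> x) =
        (\<Oplus>x\<in>carrier G. f y \<otimes> g (inv\<^bsub>G\<^esub> y \<otimes>\<^bsub>G\<^esub> (y \<otimes>\<^bsub>G\<^esub> x)) \<otimes> \<phi> (y \<otimes>\<^bsub>G\<^esub> x))"
      by (rule finsum_translate[symmetric]) auto
    also have "\<dots> = (\<Oplus>x\<in>carrier G. f y \<otimes> \<phi> y \<otimes> g x \<oplus> f y \<otimes> (g x \<otimes> \<phi> x))"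
      by (intro R.finsum_cong') (auto simp: G.inv_mult_cancel_left add R.r_distr R.m_ac)
    also have "\<dots> = (\<Oplus>x\<in>carrier G. f y \<otimes> \<phi> y \<otimes> g x) \<oplus> (\<Oplus>x\<in>carrier G. f y \<otimes> (g x \<otimes> \<phi> x))"
      by (rule R.finsum_addf) auto
    also have "\<dots> = f y \<otimes> \<phi> y \<otimes> \<epsilon> g \<oplus> f y \<otimes> (\<Oplus>x\<in>carrier G. g x \<otimes> \<phi> x)"
      by (simp add: augmentation_def R.finsum_rdistr Pi_def)
    finally show "(\<Oplus>x\<in>carrier G. f y \<otimes> g (inv\<^bsub>G\<^esub> y \<otimes>\<^bsub>G\<^esub> x) \<otimes> \<phi> x) =
      f y \<otimes> \<phi> y \<otimes> \<epsilon> g \<oplus> f y \<otimes> (\<Oplus>x\<in>carrier G. g x \<otimes> \<phi> x)" .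
  qed (auto intro!: R.finsum_closed R.m_closed R.a_closed)
  also have "\<dots> = (\<Oplus>y\<in>carrier G. f y \<otimes> \<phi> y \<otimes> \<epsilon> g) \<oplus> (\<Oplus>y\<in>carrier G. f y \<otimes> (\<Oplus>x\<in>carrier G. g x \<otimes> \<phi> x))"
    by (rule R.finsum_addf) (auto intro!: R.finsum_closed R.m_closed)
  also have "\<dots> = (\<Oplus>x\<in>carrier G. f x \<otimes> \<phi> x) \<otimes> \<epsilon> g \<oplus> \<epsilon> f \<otimes> (\<Oplus>x\<in>carrier G. g x \<otimes> \<phi> x)"
  proof -
    have [simp]: "(\<Oplus>x\<in>carrier G. g x \<otimes> \<phi> x) \<in> carrier R" by (intro R.finsum_closed) auto
    show ?thesis by (simp add: augmentation_def[of R G f] R.finsum_ldistr Pi_def)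
  qed
  finally show ?thesis .
qed

lemma additive_map_eq:
  assumes gen: "central_generator w" and [simp]: "\<And>x. x \<in> carrier G \<Longrightarrow> \<phi> x \<in> carrier R"
    and add: "\<And>x y. x \<in> carrier G \<Longrightarrow> y \<in> carrier G \<Longrightarrow> \<phi> (x \<otimes>\<^bsub>G\<^esub> y) = \<phi> x \<oplus> \<phi> y"
    and [simp]: "a \<in> carrier A" "x \<in> carrier G" and ax: "\<delta> x \<ominus>\<^bsub>A\<^esub> \<one>\<^bsub>A\<^esub> = a \<otimes>\<^bsub>A\<^esub> w"
  shows "\<phi> x = \<epsilon> a \<otimes> (\<Oplus>y\<in>carrier G. w y \<otimes> \<phi> y)"
proof -
  have w [simp]: "w \<in> carrier A" and \<epsilon>w: "\<epsilon> w = \<zero>"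
    using gen by (auto simp: central_generator_def)
  have [simp]: "(\<Oplus>y\<in>carrier G. f y \<otimes> \<phi> y) \<in> carrier R" if "f \<in> carrier A" for f
    using that by (intro R.finsum_closed) auto
  have delta: "(\<Oplus>y\<in>carrier G. \<delta> z y \<otimes> \<phi> y) = \<phi> z" if "z \<in> carrier G" for z
    using that by (subst R.finsum_single[where a = z]) (auto simp: group_elt_coeff)
  have one: "\<phi> \<one>\<^bsub>G\<^esub> = \<zero>" using add[of "\<one>\<^bsub>G\<^esub>" "\<one>\<^bsub>G\<^esub>"] by simp
  have "\<phi> x = (\<Oplus>y\<in>carrier G. \<delta> x y \<otimes> \<phi> y) \<oplus> \<ominus> (\<Oplus>y\<in>carrier G. \<delta> \<one>\<^bsub>G\<^esub> y \<otimes> \<phi> y)"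
    by (simp add: delta one)
  also have "\<dots> = (\<Oplus>y\<in>carrier G. \<delta> x y \<otimes> \<phi> y) \<oplus> (\<ominus> \<one>) \<otimes> (\<Oplus>y\<in>carrier G. \<delta> \<one>\<^bsub>G\<^esub> y \<otimes> \<phi> y)"
    by (simp add: R.l_minus)
  also have "\<dots> = (\<Oplus>y\<in>carrier G. \<delta> x y \<otimes> \<phi> y) \<oplus> (\<Oplus>y\<in>carrier G. (\<ominus> \<one>) \<otimes> (\<delta> \<one>\<^bsub>G\<^esub> y \<otimes> \<phi> y))"
    by (subst R.finsum_rdistr) auto
  also have "\<dots> = (\<Oplus>y\<in>carrier G. \<delta> x y \<otimes> \<phi> y \<oplus> (\<ominus> \<one>) \<otimes> (\<delta> \<one>\<^bsub>G\<^esub> y \<otimes> \<phi> y))"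
    by (rule R.finsum_addf[symmetric]) auto
  also have "\<dots> = (\<Oplus>y\<in>carrier G. (\<delta> x \<ominus>\<^bsub>A\<^esub> \<one>\<^bsub>A\<^esub>) y \<otimes> \<phi> y)"
    by (intro R.finsum_cong') (auto simp: a_minus_def R.l_distr R.l_minus group_elt_one)
  also have "\<dots> = \<epsilon> a \<otimes> (\<Oplus>y\<in>carrier G. w y \<otimes> \<phi> y)"
    unfolding ax by (subst additive_extension_mult) (auto simp: add \<epsilon>w)
  finally show ?thesis .
qed

text \<open>By \<open>additive_map_eq\<close> all values of \<open>\<phi>\<close> are multiples of its extension to \<open>w\<close>. If some group element \<open>g\<close> has a
  nonzero factor, \<open>\<phi> g = 0\<close> forces the value at \<open>w\<close> to vanish; otherwise every \<open>\<phi>\<close> is zero and \<open>g = 1\<close> will do.\<close>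

lemma additive_maps_determined:
  assumes "field R" and gen: "central_generator w"
  obtains g where "g \<in> carrier G" "\<And>\<phi> x. (\<And>x. x \<in> carrier G \<Longrightarrow> \<phi> x \<in> carrier R) \<Longrightarrow>
     (\<And>x y. x \<in> carrier G \<Longrightarrow> y \<in> carrier G \<Longrightarrow> \<phi> (x \<otimes>\<^bsub>G\<^esub> y) = \<phi> x \<oplus> \<phi> y) \<Longrightarrow>
     \<phi> g = \<zero> \<Longrightarrow> x \<in> carrier G \<Longrightarrow> \<phi> x = \<zero>"
proof -
  interpret F: field R by fact
  have w [simp]: "w \<in> carrier A"
    using gen by (auto simp: central_generator_def)
  have ex: "\<exists>a\<in>carrier A. \<delta> x \<ominus>\<^bsub>A\<^esub> \<one>\<^bsub>A\<^esub> = a \<otimes>\<^bsub>A\<^esub> w" if "x \<in> carrier G" for x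
    using augmentation_generated[OF gen, of "\<delta> x \<ominus>\<^bsub>A\<^esub> \<one>\<^bsub>A\<^esub>"] that
    by (auto simp: a_minus_def R.r_neg)
  show thesis
  proof (cases "\<exists>g\<in>carrier G. \<exists>a\<in>carrier A. \<delta> g \<ominus>\<^bsub>A\<^esub> \<one>\<^bsub>A\<^esub> = a \<otimes>\<^bsub>A\<^esub> w \<and> \<epsilon> a \<noteq> \<zero>")
    case True
    then obtain g a where g: "g \<in> carrier G" and a: "a \<in> carrier A"
      "\<delta> g \<ominus>\<^bsub>A\<^esub> \<one>\<^bsub>A\<^esub> = a \<otimes>\<^bsub>A\<^esub> w" "\<epsilon> a \<noteq> \<zero>" by blast
    show thesis
    proof (rule that[OF g])
      fix \<phi> x assume \<phi>: "\<And>x. x \<in> carrier G \<Longrightarrow> \<phi> x \<in> carrier R"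
        "\<And>x y. x \<in> carrier G \<Longrightarrow> y \<in> carrier G \<Longrightarrow> \<phi> (x \<otimes>\<^bsub>G\<^esub> y) = \<phi> x \<oplus> \<phi> y"
        and \<phi>g: "\<phi> g = \<zero>" and x: "x \<in> carrier G"
      let ?s = "\<Oplus>y\<in>carrier G. w y \<otimes> \<phi> y"
      have s: "?s \<in> carrier R" using \<phi>(1) by (intro R.finsum_closed) auto
      have "\<epsilon> a \<otimes> ?s = \<zero>" using additive_map_eq[OF gen \<phi> a(1) g a(2)] \<phi>g by simp
      then have "?s = \<zero>" using F.integral[of "\<epsilon> a" ?s] a s by auto
      then show "\<phi> x = \<zero>" using ex[OF x] additive_map_eq[OF gen \<phi> _ x] by auto
    qed
  next
    case False
    show thesis
    proof (rule that[OF G.one_closed])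
      fix \<phi> x assume \<phi>: "\<And>x. x \<in> carrier G \<Longrightarrow> \<phi> x \<in> carrier R"
        "\<And>x y. x \<in> carrier G \<Longrightarrow> y \<in> carrier G \<Longrightarrow> \<phi> (x \<otimes>\<^bsub>G\<^esub> y) = \<phi> x \<oplus> \<phi> y"
        and x: "x \<in> carrier G"
      let ?s = "\<Oplus>y\<in>carrier G. w y \<otimes> \<phi> y"
      have s: "?s \<in> carrier R" using \<phi>(1) by (intro R.finsum_closed) auto
      obtain a where a: "a \<in> carrier A" "\<delta> x \<ominus>\<^bsub>A\<^esub> \<one>\<^bsub>A\<^esub> = a \<otimes>\<^bsub>A\<^esub> w" using ex[OF x] by blast
      then have "\<epsilon> a = \<zero>" using False x by blast
      then show "\<phi> x = \<zero>" using additive_map_eq[OF gen \<phi> a(1) x a(2)] s by simp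
    qed
  qed
qed

text \<open>The complement is the subgroup fixing the principal block element; homomorphisms to \<open>\<int>/p\<close> become
  additive maps to the field through the prime field.\<close>

theorem p_nilpotent_cyclic_if_central_generator:
  assumes "field R" and gen: "central_generator w"
    and p: "Factorial_Ring.prime (p::nat)" and char: "\<And>i::int. [i] \<cdot> \<one> = \<zero> \<longleftrightarrow> int p dvd i"
  shows "p_nilpotent p G \<and> (\<forall>P. sylow_subgroup p P G \<longrightarrow> cyclic_group (G\<lparr>carrier := P\<rparr>))"
proof -
  interpret F: field R by fact
  have char': "[p] \<cdot> \<one> = \<zero>" using char[of "int p"] by (simp add: add_pow_def int_pow_int)
  obtain e n where e: "e \<in> carrier A" and cen: "\<And>b. b \<in> carrier A \<Longrightarrow> b \<otimes>\<^bsub>A\<^esub> e = e \<otimes>\<^bsub>A\<^esub> b"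
    and nil: "w [^]\<^bsub>A\<^esub> (n::nat) \<otimes>\<^bsub>A\<^esub> e = \<zero>\<^bsub>A\<^esub>" and \<epsilon>e: "\<epsilon> e = \<one>"
    using exists_principal_block_element[OF assms(1) gen] by blast
  obtain g where g: "g \<in> carrier G" and det: "\<And>\<phi> x. (\<And>x. x \<in> carrier G \<Longrightarrow> \<phi> x \<in> carrier R) \<Longrightarrow>
     (\<And>x y. x \<in> carrier G \<Longrightarrow> y \<in> carrier G \<Longrightarrow> \<phi> (x \<otimes>\<^bsub>G\<^esub> y) = \<phi> x \<oplus> \<phi> y) \<Longrightarrow>
     \<phi> g = \<zero> \<Longrightarrow> x \<in> carrier G \<Longrightarrow> \<phi> x = \<zero>"
    using additive_maps_determined[OF assms(1) gen] by blast
  note N = fixing_subgroup_normal[OF e cen]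
  show ?thesis
  proof (rule G.p_nilpotent_cyclicI[OF finite_G p N])
    show "coprime p (card (fixing_subgroup e))"
      using fixing_subgroup_card_coprime[OF e \<epsilon>e _ char' p] by simp
    show "x \<otimes>\<^bsub>G\<^esub> y \<otimes>\<^bsub>G\<^esub> inv\<^bsub>G\<^esub> x \<otimes>\<^bsub>G\<^esub> inv\<^bsub>G\<^esub> y \<in> fixing_subgroup e"
      if "x \<in> carrier G" "y \<in> carrier G" for x y
      using fixing_subgroup_commutator[OF e that principal_block_central[OF gen e cen nil] cen N] by simp
    show "x [^]\<^bsub>G\<^esub> (p ^ n) \<in> fixing_subgroup e" if "x \<in> carrier G" for x
      using pow_prime_power_mem_fixing_subgroup[OF gen e nil char' that] .
    show "g \<in> carrier G" by fact
    fix \<alpha> :: "'g \<Rightarrow> int" and x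
    assume \<alpha>: "\<And>x y. x \<in> carrier G \<Longrightarrow> y \<in> carrier G \<Longrightarrow> int p dvd \<alpha> (x \<otimes>\<^bsub>G\<^esub> y) - (\<alpha> x + \<alpha> y)"
      and \<alpha>g: "int p dvd \<alpha> g" and x: "x \<in> carrier G"
    have "[\<alpha> x] \<cdot> \<one> = \<zero>"
    proof (rule det[of "\<lambda>x. [\<alpha> x] \<cdot> \<one>"])
      fix x y assume "x \<in> carrier G" "y \<in> carrier G"
      then have "[(\<alpha> (x \<otimes>\<^bsub>G\<^esub> y) - (\<alpha> x + \<alpha> y))] \<cdot> \<one> = \<zero>" using \<alpha> char by blast
      then have "[(\<alpha> (x \<otimes>\<^bsub>G\<^esub> y))] \<cdot> \<one> = [(\<alpha> x + \<alpha> y)] \<cdot> \<one>"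
        by (simp add: R.add.int_pow_diff R.r_right_minus_eq a_minus_def[symmetric])
      then show "[(\<alpha> (x \<otimes>\<^bsub>G\<^esub> y))] \<cdot> \<one> = [(\<alpha> x)] \<cdot> \<one> \<oplus> [(\<alpha> y)] \<cdot> \<one>"
        by (simp add: R.add.int_pow_mult)
    qed (use \<alpha>g x char in auto)
    then show "int p dvd \<alpha> x" using char by blast
  qed
qed

section \<open>A central generator from a complement with cyclic quotient\<close>

text \<open>The mean \<open>e\<close> of the elements of \<open>N\<close> is a central idempotent, and \<open>A\<close> splits as \<open>A (1 - e) \<oplus> A e\<close>. The first
  summand lies in the augmentation ideal; the second is the group algebra of the cyclic group \<open>G/N\<close>, whose
  augmentation ideal is generated by \<open>g - 1\<close>. So \<open>w = (1 - e) + (g - 1) e\<close> works. Products \<open>x e\<close> are class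
  functions since \<open>G/N\<close> is abelian, which gives centrality.\<close>

lemma exists_central_generator:
  assumes N: "N \<lhd> G" and comm: "comm_group (G Mod N)"
    and c [simp]: "c \<in> carrier R" and cN: "[card N] \<cdot> c = \<one>"
    and g [simp]: "g \<in> carrier G"
    and cover: "\<And>x. x \<in> carrier G \<Longrightarrow> \<exists>n\<in>N. \<exists>i::nat. x = n \<otimes>\<^bsub>G\<^esub> g [^]\<^bsub>G\<^esub> i"
  shows "\<exists>w. central_generator w"
proof -
  interpret N: normal N G by (rule N)
  interpret Q: comm_group "G Mod N" by (rule comm)
  have sub: "N \<subseteq> carrier G" by (rule N.subset)
  define e where "e = (\<lambda>x\<in>carrier G. if x \<in> N then c else \<zero>)"
  have e [simp]: "e \<in> carrier A" by (auto simp: e_def)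
  have e_coeff: "e x = (if x \<in> N then c else \<zero>)" if "x \<in> carrier G" for x
    using that by (simp add: e_def)
  have N_iff: "inv\<^bsub>G\<^esub> x \<otimes>\<^bsub>G\<^esub> y \<in> N \<longleftrightarrow> N #>\<^bsub>G\<^esub> x = N #>\<^bsub>G\<^esub> y" if "x \<in> carrier G" "y \<in> carrier G" for x y
  proof -
    have "inv\<^bsub>G\<^esub> x \<otimes>\<^bsub>G\<^esub> y \<in> N \<longleftrightarrow> y \<in> x <#\<^bsub>G\<^esub> N"
      using that sub by (auto simp: l_coset_def G.inv_mult_cancel_left G.m_assoc[symmetric]
         intro!: bexI[of _ "inv\<^bsub>G\<^esub> x \<otimes>\<^bsub>G\<^esub> y"])
    also have "x <#\<^bsub>G\<^esub> N = N #>\<^bsub>G\<^esub> x" using N.coset_eq that by simp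
    also have "y \<in> N #>\<^bsub>G\<^esub> x \<longleftrightarrow> N #>\<^bsub>G\<^esub> x = N #>\<^bsub>G\<^esub> y"
      using G.repr_independence[of y N x] G.rcos_self[OF that(2) N.subgroup_axioms] that N.subgroup_axioms by auto
    finally show ?thesis .
  qed
  have comm': "N #>\<^bsub>G\<^esub> (x \<otimes>\<^bsub>G\<^esub> y) = N #>\<^bsub>G\<^esub> (y \<otimes>\<^bsub>G\<^esub> x)" if "x \<in> carrier G" "y \<in> carrier G" for x y
  proof -
    have "N #>\<^bsub>G\<^esub> x \<in> carrier (G Mod N)" "N #>\<^bsub>G\<^esub> y \<in> carrier (G Mod N)"
      using that by (auto simp: FactGroup_def RCOSETS_def)
    from Q.m_comm[OF this] show ?thesis
      using N.rcos_sum[OF that] N.rcos_sum[OF that(2,1)] by (simp add: FactGroup_def)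
  qed
  have translate_coeff: "(\<delta> x \<otimes>\<^bsub>A\<^esub> e) y = (if N #>\<^bsub>G\<^esub> x = N #>\<^bsub>G\<^esub> y then c else \<zero>)"
    if "x \<in> carrier G" "y \<in> carrier G" for x y
    using that by (simp add: group_elt_mult_coeff e_coeff N_iff)
  have cen: "b \<otimes>\<^bsub>A\<^esub> (\<delta> x \<otimes>\<^bsub>A\<^esub> e) = (\<delta> x \<otimes>\<^bsub>A\<^esub> e) \<otimes>\<^bsub>A\<^esub> b"
    if "b \<in> carrier A" "x \<in> carrier G" for b x
    using that by (intro class_function_central) (auto simp: translate_coeff comm')
  have ecen: "b \<otimes>\<^bsub>A\<^esub> e = e \<otimes>\<^bsub>A\<^esub> b" if "b \<in> carrier A" for b
    using cen[OF that G.one_closed] by (simp add: group_elt_one)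
  have absorb: "\<delta> n \<otimes>\<^bsub>A\<^esub> e = e" if "n \<in> N" for n
  proof (rule A_eqI)
    have [simp]: "n \<in> carrier G" using that sub by blast
    show "\<delta> n \<otimes>\<^bsub>A\<^esub> e \<in> carrier A" by simp
    fix x assume x [simp]: "x \<in> carrier G"
    have "inv\<^bsub>G\<^esub> n \<otimes>\<^bsub>G\<^esub> x \<in> N \<longleftrightarrow> x \<in> N"
      using N.m_closed[OF N.m_inv_closed[OF that], of x] N.m_closed[OF that, of "inv\<^bsub>G\<^esub> n \<otimes>\<^bsub>G\<^esub> x"]
      by (auto simp: G.m_assoc[symmetric])
    then show "(\<delta> n \<otimes>\<^bsub>A\<^esub> e) x = e x" by (simp add: group_elt_mult_coeff e_coeff)
  qed simp
  have \<epsilon>e: "\<epsilon> e = \<one>"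
  proof -
    have "\<epsilon> e = (\<Oplus>x\<in>N. c)"
      unfolding augmentation_def using sub
      by (intro R.add.finprod_mono_neutral_cong_right) (auto simp: e_def)
    also have "\<dots> = \<one>" using cN by (simp add: R.add.finprod_const)
    finally show ?thesis .
  qed
  have ee: "e \<otimes>\<^bsub>A\<^esub> e = e"
  proof (rule A_eqI)
    fix x assume x [simp]: "x \<in> carrier G"
    have "(e \<otimes>\<^bsub>A\<^esub> e) x = (\<Oplus>y\<in>carrier G. e y \<otimes> e x)"
    proof (unfold mult_coeff[OF x], intro R.finsum_cong')
      fix y assume y [simp]: "y \<in> carrier G"
      show "e y \<otimes> e (inv\<^bsub>G\<^esub> y \<otimes>\<^bsub>G\<^esub> x) = e y \<otimes> e x"
      proof (cases "y \<in> N")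
        case True
        then show ?thesis using absorb[OF True] group_elt_mult_coeff[OF e y x] by simp
      qed (simp add: e_coeff)
    qed auto
    also have "\<dots> = \<epsilon> e \<otimes> e x" by (simp add: augmentation_def R.finsum_ldistr Pi_def)
    finally show "(e \<otimes>\<^bsub>A\<^esub> e) x = e x" by (simp add: \<epsilon>e)
  qed auto
  let ?d = "\<delta> g \<ominus>\<^bsub>A\<^esub> \<one>\<^bsub>A\<^esub>" and ?e' = "\<one>\<^bsub>A\<^esub> \<ominus>\<^bsub>A\<^esub> e"
  define w where "w = ?e' \<oplus>\<^bsub>A\<^esub> ?d \<otimes>\<^bsub>A\<^esub> e"
  have w [simp]: "w \<in> carrier A" by (simp add: w_def)
  have e'e: "?e' \<otimes>\<^bsub>A\<^esub> e = \<zero>\<^bsub>A\<^esub>"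
    by (simp add: a_minus_def A.l_distr A.l_minus ee A.M.r_neg)
  have e'd: "?e' \<otimes>\<^bsub>A\<^esub> (b \<otimes>\<^bsub>A\<^esub> e) = \<zero>\<^bsub>A\<^esub>" if b [simp]: "b \<in> carrier A" for b
  proof -
    have "?e' \<otimes>\<^bsub>A\<^esub> (b \<otimes>\<^bsub>A\<^esub> e) = (?e' \<otimes>\<^bsub>A\<^esub> e) \<otimes>\<^bsub>A\<^esub> b"
      using ecen[OF b] by (simp add: A.m_assoc)
    then show ?thesis using e'e by simp
  qed
  have e'w: "?e' \<otimes>\<^bsub>A\<^esub> w = ?e'"
  proof -
    have "b \<otimes>\<^bsub>A\<^esub> ?e' = b \<ominus>\<^bsub>A\<^esub> b \<otimes>\<^bsub>A\<^esub> e" if "b \<in> carrier A" for b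
      using that by (simp add: a_minus_def A.r_distr A.r_minus)
    from this[of ?e'] have "?e' \<otimes>\<^bsub>A\<^esub> ?e' = ?e'" unfolding e'e by (simp add: a_minus_def)
    then show ?thesis by (simp add: w_def A.r_distr e'd)
  qed
  have ew: "e \<otimes>\<^bsub>A\<^esub> w = ?d \<otimes>\<^bsub>A\<^esub> e"
  proof -
    have "w \<otimes>\<^bsub>A\<^esub> e = ?d \<otimes>\<^bsub>A\<^esub> e"
      by (simp add: w_def A.l_distr e'e A.m_assoc ee)
    then show ?thesis using ecen[OF w] by simp
  qed
  have "central_generator w"
    unfolding central_generator_def
  proof (intro conjI ballI impI)
    show "w \<in> carrier A" by simp
    show "\<epsilon> w = \<zero>" by (simp add: w_def \<epsilon>e a_minus_def R.r_neg)
  next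
    fix b assume b [simp]: "b \<in> carrier A"
    have "w = ?e' \<oplus>\<^bsub>A\<^esub> (\<delta> g \<otimes>\<^bsub>A\<^esub> e \<ominus>\<^bsub>A\<^esub> e)"
      by (simp add: w_def a_minus_def A.l_distr A.l_minus)
    then show "b \<otimes>\<^bsub>A\<^esub> w = w \<otimes>\<^bsub>A\<^esub> b"
      using cen[OF b g] ecen[OF b] by (simp add: a_minus_def A.l_distr A.r_distr A.l_minus A.r_minus)
  next
    fix f assume f: "f \<in> carrier A" "\<epsilon> f = \<zero>"
    define S where "S = {f \<in> carrier A. \<exists>a\<in>carrier A. f \<otimes>\<^bsub>A\<^esub> e = a \<otimes>\<^bsub>A\<^esub> w}"
    have "f \<in> S"
    proof (rule augmentation_ideal_induct[OF _ _ _ _ _ f])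
      show "\<zero>\<^bsub>A\<^esub> \<in> S" unfolding S_def by (auto intro!: bexI[of _ "\<zero>\<^bsub>A\<^esub>"])
      show "S \<subseteq> carrier A" by (auto simp: S_def)
      fix f1 f2 assume "f1 \<in> S" "f2 \<in> S"
      then obtain a1 a2 where "f1 \<in> carrier A" "f2 \<in> carrier A" "a1 \<in> carrier A" "a2 \<in> carrier A"
        "f1 \<otimes>\<^bsub>A\<^esub> e = a1 \<otimes>\<^bsub>A\<^esub> w" "f2 \<otimes>\<^bsub>A\<^esub> e = a2 \<otimes>\<^bsub>A\<^esub> w" by (auto simp: S_def)
      then show "f1 \<oplus>\<^bsub>A\<^esub> f2 \<in> S"
        unfolding S_def by (auto simp: A.l_distr intro!: bexI[of _ "a1 \<oplus>\<^bsub>A\<^esub> a2"])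
    next
      fix r f1 assume "r \<in> carrier R" "f1 \<in> S"
      then obtain a1 where "r \<in> carrier R" "f1 \<in> carrier A" "a1 \<in> carrier A" "f1 \<otimes>\<^bsub>A\<^esub> e = a1 \<otimes>\<^bsub>A\<^esub> w"
        by (auto simp: S_def)
      then show "r \<odot>\<^bsub>A\<^esub> f1 \<in> S"
        unfolding S_def by (auto simp: A.smult_mult_left intro!: bexI[of _ "r \<odot>\<^bsub>A\<^esub> a1"])
    next
      fix x assume x [simp]: "x \<in> carrier G"
      obtain n i where n: "n \<in> N" and xn: "x = n \<otimes>\<^bsub>G\<^esub> g [^]\<^bsub>G\<^esub> (i::nat)" using cover[OF x] by blast
      have [simp]: "n \<in> carrier G" using n sub by blast
      have "\<delta> x \<otimes>\<^bsub>A\<^esub> e = \<delta> n \<otimes>\<^bsub>A\<^esub> (\<delta> (g [^]\<^bsub>G\<^esub> i) \<otimes>\<^bsub>A\<^esub> e)"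
        unfolding xn by (simp add: group_elt_mult[symmetric] A.m_assoc)
      also have "\<dots> = (\<delta> n \<otimes>\<^bsub>A\<^esub> e) \<otimes>\<^bsub>A\<^esub> \<delta> (g [^]\<^bsub>G\<^esub> i)"
        using ecen[of "\<delta> (g [^]\<^bsub>G\<^esub> i)"] by (simp add: A.m_assoc)
      also have "\<dots> = \<delta> (g [^]\<^bsub>G\<^esub> i) \<otimes>\<^bsub>A\<^esub> e"
        using absorb[OF n] ecen[of "\<delta> (g [^]\<^bsub>G\<^esub> i)"] by simp
      finally have xe: "\<delta> x \<otimes>\<^bsub>A\<^esub> e = \<delta> (g [^]\<^bsub>G\<^esub> i) \<otimes>\<^bsub>A\<^esub> e" .
      obtain s where s: "s \<in> carrier A" "\<delta> g [^]\<^bsub>A\<^esub> i \<ominus>\<^bsub>A\<^esub> \<one>\<^bsub>A\<^esub> = s \<otimes>\<^bsub>A\<^esub> ?d"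
        using geometric_factor[of "\<delta> g" i] by auto
      have "(\<delta> x \<ominus>\<^bsub>A\<^esub> \<one>\<^bsub>A\<^esub>) \<otimes>\<^bsub>A\<^esub> e = (\<delta> g [^]\<^bsub>A\<^esub> i \<ominus>\<^bsub>A\<^esub> \<one>\<^bsub>A\<^esub>) \<otimes>\<^bsub>A\<^esub> e"
        by (simp add: a_minus_def A.l_distr A.l_minus group_elt_pow xe)
      also have "\<dots> = s \<otimes>\<^bsub>A\<^esub> (?d \<otimes>\<^bsub>A\<^esub> e)" unfolding s(2) using s(1) by (simp add: A.m_assoc)
      also have "\<dots> = (s \<otimes>\<^bsub>A\<^esub> e) \<otimes>\<^bsub>A\<^esub> w" using s(1) unfolding ew[symmetric] by (simp add: A.m_assoc)
      finally show "\<delta> x \<ominus>\<^bsub>A\<^esub> \<one>\<^bsub>A\<^esub> \<in> S"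
        unfolding S_def using s(1) by (auto intro!: bexI[of _ "s \<otimes>\<^bsub>A\<^esub> e"])
    qed
    then obtain a where a [simp]: "a \<in> carrier A" and fe: "f \<otimes>\<^bsub>A\<^esub> e = a \<otimes>\<^bsub>A\<^esub> w" by (auto simp: S_def)
    have "(f \<otimes>\<^bsub>A\<^esub> ?e' \<oplus>\<^bsub>A\<^esub> a) \<otimes>\<^bsub>A\<^esub> w = f \<otimes>\<^bsub>A\<^esub> ?e' \<oplus>\<^bsub>A\<^esub> f \<otimes>\<^bsub>A\<^esub> e"
      using f(1) by (simp add: A.l_distr A.m_assoc e'w fe)
    also have "\<dots> = f"
      using f(1) by (simp add: a_minus_def A.r_distr A.r_minus A.M.a_assoc A.M.l_neg)
    finally show "\<exists>a\<in>carrier A. f = a \<otimes>\<^bsub>A\<^esub> w" using f(1) by (metis A.a_closed A.m_closed A.minus_closed A.one_closed a e)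
  qed
  then show ?thesis by blast
qed

end

section \<open>Passage to the residue field\<close>

text \<open>A nonunit has an irreducible divisor, which generates a maximal ideal and hence the only one.\<close>

lemma (in discrete_valuation_ring) Units_if_not_mem_maximalideal:
  assumes a: "a \<in> carrier R" "a \<notin> \<mm>"
  shows "a \<in> Units R"
proof (rule ccontr)
  assume "a \<notin> Units R"
  moreover have "a \<noteq> \<zero>" using a(2) additive_subgroup.zero_closed[OF is_additive_subgroup] by blast
  ultimately obtain b where b: "b \<in> carrier R" "ring_irreducible b" "b divides a"
    using exists_irreducible_divisor[of a] a(1) by blast
  have "PIdl b = \<mm>" using irreducible_imp_maximalideal[OF b(1,2)] unique_maximalideal by blast
  moreover have "a \<in> PIdl b"
    using b(1,3) to_contain_is_to_divide[OF a(1) b(1)] cgenideal_self[OF a(1)] 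
    by (metis a(1) cgenideal_self subsetD to_contain_is_to_divide)
  ultimately show False using a(2) by blast
qed

lemma (in ring_hom_cring) hom_add_pow_one: "h ([(n::nat)] \<cdot> \<one>) = [n] \<cdot>\<^bsub>S\<^esub> \<one>\<^bsub>S\<^esub>"
  by (induction n) simp_all

lemma (in ring) add_pow_one_eq_zero_iff:
  "[(i::int)] \<cdot> \<one> = \<zero> \<longleftrightarrow> int (characteristic R) dvd i"
  unfolding characteristic_def using add.int_pow_eq_id[of \<one> i] by simp

text \<open>Coefficientwise application of \<open>h\<close> is a surjective ring homomorphism of group algebras. An element of augmentation zero
  has a lift of augmentation zero: correct any lift by a multiple of \<open>1\<close>.\<close>

lemma central_generator_map:
  fixes R :: "('r, 'b) ring_scheme" and S :: "('s, 'c) ring_scheme" and G :: "('g, 'e) monoid_scheme"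
  assumes hom: "ring_hom_cring R S h" and surj: "h ` carrier R = carrier S"
    and G: "group G" "finite (carrier G)"
    and gen: "finite_group_ring.central_generator R G w"
  shows "finite_group_ring.central_generator S G (\<lambda>x\<in>carrier G. h (w x))"
proof -
  interpret h: ring_hom_cring R S h by (rule hom)
  interpret G: group G by fact
  interpret R: finite_group_ring R G using h.R.is_cring G by (simp add: finite_group_ring_def finite_group_ring_axioms_def)
  interpret S: finite_group_ring S G using h.S.is_cring G by (simp add: finite_group_ring_def finite_group_ring_axioms_def)
  define red where "red f = (\<lambda>x\<in>carrier G. h (f x))" for f
  have red_closed [simp]: "red f \<in> carrier S.A" if "f \<in> carrier R.A" for f
    using that by (auto simp: red_def)
  have red_coeff [simp]: "red f x = h (f x)" if "x \<in> carrier G" for f x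
    using that by (simp add: red_def)
  have red_mult: "red (a \<otimes>\<^bsub>R.A\<^esub> b) = red a \<otimes>\<^bsub>S.A\<^esub> red b"
    if [simp]: "a \<in> carrier R.A" "b \<in> carrier R.A" for a b
  proof (rule S.A_eqI)
    fix x assume [simp]: "x \<in> carrier G"
    have "h ((a \<otimes>\<^bsub>R.A\<^esub> b) x) = (\<Oplus>\<^bsub>S\<^esub>y\<in>carrier G. (h \<circ> (\<lambda>y. a y \<otimes>\<^bsub>R\<^esub> b (inv\<^bsub>G\<^esub> y \<otimes>\<^bsub>G\<^esub> x))) y)"
      by (subst h.hom_finsum[symmetric]) (auto simp: R.mult_coeff)
    also have "\<dots> = (red a \<otimes>\<^bsub>S.A\<^esub> red b) x"
      by (simp add: S.mult_coeff) (intro h.S.finsum_cong', auto)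
    finally show "red (a \<otimes>\<^bsub>R.A\<^esub> b) x = (red a \<otimes>\<^bsub>S.A\<^esub> red b) x" by simp
  qed auto
  have red_aug: "S.\<epsilon> (red f) = h (R.\<epsilon> f)" if [simp]: "f \<in> carrier R.A" for f
    unfolding augmentation_def by (subst h.hom_finsum) (auto intro!: h.S.finsum_cong')
  have lift: "\<exists>f\<in>carrier R.A. red f = g" if g: "g \<in> carrier S.A" for g
  proof -
    define f where "f = (\<lambda>x\<in>carrier G. inv_into (carrier R) h (g x))"
    have gh: "g x \<in> h ` carrier R" if "x \<in> carrier G" for x using g that surj by auto
    then have f: "f \<in> carrier R.A" unfolding f_def by (intro R.restrict_mem_A inv_into_into[OF gh])
    have "red f = g"
      by (rule S.A_eqI) (use f g gh in \<open>auto simp: f_def f_inv_into_f\<close>)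
    then show ?thesis using f by blast
  qed
  have w [simp]: "w \<in> carrier R.A" and \<epsilon>w: "R.\<epsilon> w = \<zero>\<^bsub>R\<^esub>"
    and cen: "\<And>b. b \<in> carrier R.A \<Longrightarrow> b \<otimes>\<^bsub>R.A\<^esub> w = w \<otimes>\<^bsub>R.A\<^esub> b"
    and gen: "\<And>f. f \<in> carrier R.A \<Longrightarrow> R.\<epsilon> f = \<zero>\<^bsub>R\<^esub> \<Longrightarrow> \<exists>a\<in>carrier R.A. f = a \<otimes>\<^bsub>R.A\<^esub> w"
    using gen by (auto simp: R.central_generator_def)
  have "S.central_generator (red w)"
    unfolding S.central_generator_def
  proof (intro conjI ballI impI)
    show "red w \<in> carrier S.A" by simp
    show "S.\<epsilon> (red w) = \<zero>\<^bsub>S\<^esub>" by (simp add: red_aug \<epsilon>w)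
    show "b \<otimes>\<^bsub>S.A\<^esub> red w = red w \<otimes>\<^bsub>S.A\<^esub> b" if bA: "b \<in> carrier S.A" for b
    proof -
      obtain b' where b': "b' \<in> carrier R.A" "red b' = b" using lift[OF bA] by blast
      then show ?thesis using cen[OF b'(1)] red_mult w by metis
    qed
    fix g assume g: "g \<in> carrier S.A" and \<epsilon>g: "S.\<epsilon> g = \<zero>\<^bsub>S\<^esub>"
    obtain f where f [simp]: "f \<in> carrier R.A" and fg: "red f = g" using lift[OF g] by blast
    let ?f = "f \<ominus>\<^bsub>R.A\<^esub> R.\<epsilon> f \<odot>\<^bsub>R.A\<^esub> \<one>\<^bsub>R.A\<^esub>"
    have "R.\<epsilon> ?f = \<zero>\<^bsub>R\<^esub>" by (simp add: a_minus_def h.R.r_neg)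
    then obtain a where a: "a \<in> carrier R.A" "?f = a \<otimes>\<^bsub>R.A\<^esub> w" using gen[of ?f] by auto
    have h0: "h (R.\<epsilon> f) = \<zero>\<^bsub>S\<^esub>" using red_aug[OF f] fg \<epsilon>g by simp
    have "red ?f = red f"
      by (rule S.A_eqI) (simp_all add: a_minus_def h0)
    then have "g = red a \<otimes>\<^bsub>S.A\<^esub> red w" using a fg red_mult[OF a(1) w] by simp
    then show "\<exists>a\<in>carrier S.A. g = a \<otimes>\<^bsub>S.A\<^esub> red w" using red_closed[OF a(1)] by blast
  qed
  then show ?thesis by (simp add: red_def)
qed

lemma zero_FactRing: "\<zero>\<^bsub>R Quot I\<^esub> = I"
  by (simp add: FactRing_def)

theorem proposition1p9:
  fixes p :: nat
    and R :: "('r, 'b) ring_scheme" and \<mm> :: "'r set"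
    and K :: "('c, 'd) ring_scheme" and \<iota> :: "'r \<Rightarrow> 'c"
    and G :: "('g, 'e) monoid_scheme"
  assumes "Factorial_Ring.prime p"
    and "complete_discrete_valuation_ring R \<mm>"
    and "characteristic (R Quot \<mm>) = p"
    and "is_quotient_field R K \<iota>"
    and "characteristic K = 0"
    and "group G" and "finite (carrier G)"
  shows "symmetric_algebra R
           (quotient_algebra (group_algebra R G)
             (scalar_multiples R (group_algebra R G)
               (\<Oplus>\<^bsub>group_algebra R G\<^esub>x\<in>carrier G. group_elt R G x)))
         \<longleftrightarrow>
         p_nilpotent p G \<and> (\<forall>P. sylow_subgroup p P G \<longrightarrow> cyclic_group (G\<lparr>carrier := P\<rparr>))"
proof -
  interpret dvr: discrete_valuation_ring R \<mm>
    using assms(2) by (rule complete_discrete_valuation_ring.axioms(1))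
  interpret G: group G by fact
  interpret RG: finite_group_ring R G
    using dvr.is_cring assms(6,7) by (simp add: finite_group_ring_def finite_group_ring_axioms_def)
  let ?k = "R Quot \<mm>" and ?\<pi> = "\<lambda>a. \<mm> +>\<^bsub>R\<^esub> a"
  interpret k: field ?k by (rule dvr.quotient_is_field[OF dvr.is_cring])
  interpret \<pi>: ring_hom_cring R ?k ?\<pi> by (rule dvr.rcos_ring_hom_cring[OF dvr.is_cring])
  interpret kG: finite_group_ring ?k G
    using k.is_cring assms(6,7) by (simp add: finite_group_ring_def finite_group_ring_axioms_def)
  have char: "[i] \<cdot>\<^bsub>?k\<^esub> \<one>\<^bsub>?k\<^esub> = \<zero>\<^bsub>?k\<^esub> \<longleftrightarrow> int p dvd i" for i :: int
    using k.add_pow_one_eq_zero_iff[of i] assms(3) by simp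
  have surj: "?\<pi> ` carrier R = carrier ?k"
    by (auto simp: FactRing_def A_RCOSETS_def RCOSETS_def a_r_coset_def)
  have "symmetric_algebra R RG.Q \<longleftrightarrow> (\<exists>w. RG.central_generator w)"
    by (rule RG.symmetric_iff_central_generator) simp
  also have "\<dots> \<longleftrightarrow> p_nilpotent p G \<and> (\<forall>P. sylow_subgroup p P G \<longrightarrow> cyclic_group (G\<lparr>carrier := P\<rparr>))"
  proof
    assume "\<exists>w. RG.central_generator w"
    then obtain w where w: "RG.central_generator w" by blast
    show "p_nilpotent p G \<and> (\<forall>P. sylow_subgroup p P G \<longrightarrow> cyclic_group (G\<lparr>carrier := P\<rparr>))"
      by (rule kG.p_nilpotent_cyclic_if_central_generator[OF k.field_axioms
            central_generator_map[OF \<pi>.ring_hom_cring_axioms surj assms(6,7) w] assms(1) char])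
  next
    assume ii: "p_nilpotent p G \<and> (\<forall>P. sylow_subgroup p P G \<longrightarrow> cyclic_group (G\<lparr>carrier := P\<rparr>))"
    obtain N g where N: "N \<lhd> G" "coprime p (card N)" "comm_group (G Mod N)" and g: "g \<in> carrier G"
      and cover: "\<And>x. x \<in> carrier G \<Longrightarrow> \<exists>n\<in>N. \<exists>i::nat. x = n \<otimes>\<^bsub>G\<^esub> g [^]\<^bsub>G\<^esub> i"
      using G.p_nilpotent_cyclicE[OF assms(7,1) conjunct1[OF ii] conjunct2[OF ii]] by blast
    let ?n = "add_pow R (card N) \<one>\<^bsub>R\<^esub>"
    have "?n \<notin> \<mm>"
    proof
      assume n: "?n \<in> \<mm>"
      have nR: "?n \<in> carrier R" by simp
      have "?\<pi> ?n = \<mm>" by (rule dvr.a_coset_join2[OF nR dvr.a_subgroup n])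
      also have "\<mm> = \<zero>\<^bsub>?k\<^esub>" by (rule zero_FactRing[symmetric])
      finally have "add_pow ?k (card N) \<one>\<^bsub>?k\<^esub> = \<zero>\<^bsub>?k\<^esub>"
        unfolding \<pi>.hom_add_pow_one .
      then have "add_pow ?k (int (card N)) \<one>\<^bsub>?k\<^esub> = \<zero>\<^bsub>?k\<^esub>"
        unfolding add_pow_def int_pow_int .
      then have "p dvd card N" unfolding char by simp
      then show False using N(2) assms(1) by (metis coprime_absorb_left not_prime_unit)
    qed
    then have unit: "?n \<in> Units R" by (intro dvr.Units_if_not_mem_maximalideal) auto
    define c where "c = inv\<^bsub>R\<^esub> ?n"
    have c: "c \<in> carrier R" using unit by (simp add: c_def)
    have "add_pow R (card N) c = ?n \<otimes>\<^bsub>R\<^esub> c" using c dvr.add_pow_ldistr[of "\<one>\<^bsub>R\<^esub>" c "card N"] by simp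
    also have "\<dots> = \<one>\<^bsub>R\<^esub>" using unit by (simp add: c_def)
    finally show "\<exists>w. RG.central_generator w"
      using RG.exists_central_generator[OF N(1,3) c _ g cover] by blast
  qed
  finally show ?thesis .
qed

end
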